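(* Fix a positive integer $k$. If $\Pi_n$ is a uniformly random element of $\mathbf{Iv}_n(123\cdots k(k+1))$, then \[ fp(\Pi_{2n}) \rightarrow_d X_{even} \quad\text{and}\quad fp(\Pi_{2n-1})\rightarrow_d X_{odd},\] where $\mathbb{P}(X_{even}=i)=\binom{k}{i}/2^{k-1}$ if $i$ is even and $0$ if $i$ is odd, and $\mathbb{P}(X_{odd}=i)=\binom{k}{i}/2^{k-1}$ if $i$ is odd and $0$ if $i$ is even (for $i\in\{0,1,\dots,k\}$).
   Context: For a permutation $\pi$, $fp(\pi)$ denotes its number of fixed points. A permutation $\pi$ of $[n]$ contains a pattern $\tau\in S_m$ if there are indices $i_1<\cdots<i_m$ such that $(\pi_{i_1},\dots,\pi_{i_m})$ is in the same relative order as $\tau$; otherwise $\pi$ avoids $\tau$. An involution is a permutation with $\pi^{-1}=\pi$. $\mathbf{Iv}_n(\tau)$ is the set of $\tau$-avoiding involutions of $[n]$; here $123\cdots k(k+1)$ is the increasing pattern of length $k+1$. $\rightarrow_d$ denotes convergence in distribution as $n\to\infty$. *)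

theory Defs
  imports "HOL-Probability.Probability" "HOL-Combinatorics.Permutations"
begin

text \<open>A permutation of \<open>[n]\<close> is a function with \<open>\<pi> permutes {1..n}\<close>, hence the identity
  outside \<open>{1..n}\<close>. A pattern of length \<open>m\<close> is likewise a \<open>\<tau>\<close> with \<open>\<tau> permutes {1..m}\<close>.\<close>

definition contains_pattern :: "nat \<Rightarrow> (nat \<Rightarrow> nat) \<Rightarrow> nat \<Rightarrow> (nat \<Rightarrow> nat) \<Rightarrow> bool" where
  "contains_pattern n \<pi> m \<tau> \<longleftrightarrow>
     (\<exists>f. f ` {1..m} \<subseteq> {1..n} \<and> strict_mono_on {1..m} f \<and>
          (\<forall>a\<in>{1..m}. \<forall>b\<in>{1..m}. \<pi> (f a) < \<pi> (f b) \<longleftrightarrow> \<tau> a < \<tau> b))"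

definition Iv :: "nat \<Rightarrow> nat \<Rightarrow> (nat \<Rightarrow> nat) \<Rightarrow> (nat \<Rightarrow> nat) set" where
  "Iv n m \<tau> = {\<pi>. \<pi> permutes {1..n} \<and> inv \<pi> = \<pi> \<and> \<not> contains_pattern n \<pi> m \<tau>}"

definition increasing_pattern :: "nat \<Rightarrow> nat" where
  "increasing_pattern = id"

definition fp :: "nat \<Rightarrow> (nat \<Rightarrow> nat) \<Rightarrow> nat" where
  "fp n \<pi> = card {i \<in> {1..n}. \<pi> i = i}"

text \<open>The law, on the real line, of \<open>fp(\<Pi>)\<close> for \<open>\<Pi>\<close> uniform in \<open>Iv n (k+1) (12...(k+1))\<close>.\<close>

definition fp_law :: "nat \<Rightarrow> nat \<Rightarrow> real measure" where
  "fp_law k n = distr (measure_pmf (pmf_of_set (Iv n (k + 1) increasing_pattern)))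
                      borel (\<lambda>\<pi>. real (fp n \<pi>))"

definition X_even :: "nat \<Rightarrow> nat pmf" where
  "X_even k = embed_pmf (\<lambda>i. if even i then real (k choose i) / 2 ^ (k - 1) else 0)"

definition X_odd :: "nat \<Rightarrow> nat pmf" where
  "X_odd k = embed_pmf (\<lambda>i. if odd i then real (k choose i) / 2 ^ (k - 1) else 0)"

text \<open>The functions above are probability mass functions for \<open>k \<ge> 1\<close>.\<close>

lemma nn_integral_finite_support_eq_1:
  fixes f :: "nat \<Rightarrow> real"
  assumes "\<And>i. f i \<ge> 0" "\<And>i. i > k \<Longrightarrow> f i = 0" "(\<Sum>i\<le>k. f i) = 1"
  shows "(\<integral>\<^sup>+ i. ennreal (f i) \<partial>count_space UNIV) = 1"
proof -
  have "(\<integral>\<^sup>+ i. ennreal (f i) \<partial>count_space UNIV) = (\<Sum>i\<le>k. ennreal (f i))"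
    using assms(2) by (intro nn_integral_count_space') (auto simp: not_le)
  also have "\<dots> = ennreal (\<Sum>i\<le>k. f i)"
    using assms(1) by (intro sum_ennreal) auto
  finally show ?thesis using assms(3) by simp
qed

lemma pmf_X_even:
  assumes "k \<ge> 1"
  shows "pmf (X_even k) i = (if even i then real (k choose i) / 2 ^ (k - 1) else 0)"
  unfolding X_even_def
proof (rule pmf_embed_pmf)
  have *: "2 * (\<Sum>i\<le>k. if even i then real (k choose i) else 0) = 2 ^ k"
    using assms by (intro choose_even_sum) auto
  have "(\<Sum>i\<le>k. if even i then real (k choose i) / 2 ^ (k - 1) else 0)
        = (\<Sum>i\<le>k. if even i then real (k choose i) else 0) / 2 ^ (k - 1)"
    unfolding sum_divide_distrib by (intro sum.cong) auto
  also have "\<dots> = 1" using * assms by (cases k) auto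
  finally show "(\<integral>\<^sup>+ i. ennreal (if even i then real (k choose i) / 2 ^ (k - 1) else 0)
                  \<partial>count_space UNIV) = 1"
    by (intro nn_integral_finite_support_eq_1[where k = k]) auto
qed auto

lemma pmf_X_odd:
  assumes "k \<ge> 1"
  shows "pmf (X_odd k) i = (if odd i then real (k choose i) / 2 ^ (k - 1) else 0)"
  unfolding X_odd_def
proof (rule pmf_embed_pmf)
  have *: "2 * (\<Sum>i\<le>k. if odd i then real (k choose i) else 0) = 2 ^ k"
    using assms by (intro choose_odd_sum) auto
  have "(\<Sum>i\<le>k. if odd i then real (k choose i) / 2 ^ (k - 1) else 0)
        = (\<Sum>i\<le>k. if odd i then real (k choose i) else 0) / 2 ^ (k - 1)"
    unfolding sum_divide_distrib by (intro sum.cong) auto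
  also have "\<dots> = 1" using * assms by (cases k) auto
  finally show "(\<integral>\<^sup>+ i. ennreal (if odd i then real (k choose i) / 2 ^ (k - 1) else 0)
                  \<partial>count_space UNIV) = 1"
    by (intro nn_integral_finite_support_eq_1[where k = k]) auto
qed auto

text \<open>\<open>pmf_of_set\<close> is the uniform distribution only on finite nonempty sets; both hold here.\<close>

lemma finite_Iv: "finite (Iv n m \<tau>)"
  by (rule finite_subset[OF _ finite_permutations[of "{1..n}"]]) (auto simp: Iv_def)

lemma Iv_increasing_nonempty:
  assumes "k \<ge> 1"
  shows "Iv n (k + 1) increasing_pattern \<noteq> {}"
proof -
  define r where "r = (\<lambda>i. if i \<in> {1..n} then n + 1 - i else i)"
  have rr: "r (r i) = i" for i by (auto simp: r_def)
  have "bij_betw r {1..n} {1..n}"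
    by (rule bij_betw_byWitness[where f' = r]) (auto simp: r_def)
  then have "r permutes {1..n}"
    by (rule bij_imp_permutes) (auto simp: r_def)
  moreover have "inv r = r" using rr by (intro inv_equality) auto
  moreover have "\<not> contains_pattern n r (k + 1) increasing_pattern"
  proof
    assume "contains_pattern n r (k + 1) increasing_pattern"
    then obtain f where f: "f ` {1..k+1} \<subseteq> {1..n}" "strict_mono_on {1..k+1} f"
      "\<forall>a\<in>{1..k+1}. \<forall>b\<in>{1..k+1}. r (f a) < r (f b) \<longleftrightarrow> a < b"
      by (auto simp: contains_pattern_def increasing_pattern_def)
    have 12: "1 \<in> {1..k+1}" "2 \<in> {1..k+1}" using assms by auto
    have "f 1 \<in> {1..n}" "f 2 \<in> {1..n}" using f(1) 12 by blast+
    moreover have "f 1 < f 2" using strict_mono_onD[OF f(2) 12] by simp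
    moreover have "r (f 1) < r (f 2)" using f(3) 12 by simp
    ultimately show False by (auto simp: r_def)
  qed
  ultimately show ?thesis by (auto simp: Iv_def)
qed

end

theory Submission
  imports Defs "Jordan_Normal_Form.Determinant"
begin

text \<open>
  Fomin's growth diagrams match the involutions of \<open>[n]\<close> with chains of shapes of length \<open>n\<close>;
  the longest increasing subsequence is the first row of the last shape and the number of fixed
  points is its number of odd columns. With at most \<open>k\<close> columns, the shifted column lengths
  \<open>l\<close> form a strictly increasing \<open>k\<close>-tuple of sum \<open>N = n + k (k - 1) / 2\<close>, and
  the number of chains ending there is \<open>n! V(l) / \<Prod> l\<^sub>j!\<close> with \<open>V\<close> the Vandermonde product.
  Since \<open>V\<close> is harmonic for the free walk, its second moment under multinomial weights is explicit,
  so by Cauchy--Schwarz the total weight has order \<open>(k\<^sup>N / N!) N\<^bsup>k (k - 1) / 4\<^esup>\<close>. Moving a unit from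
  one coordinate to another flips two parities and changes the weight only by a factor
  \<open>1 + O(N\<^bsup>- 1 / 2\<^esup>)\<close> on average; tuples lost at the walls have \<open>V = 0\<close>. Hence all parity
  patterns with the right total parity are asymptotically equally likely.
\<close>


section \<open>The Vandermonde product\<close>

text \<open>Only ratios of parity classes matter, so the total weight may be known up to constants
  and no Selberg-type integral has to be evaluated. The second moment closes up because it contains
  V twice: one factor is expanded by the weighted decrement identity, the summation is shifted one
  level down, and the increment identity then sums the other factor, which leaves a one-term
  recursion in N. For the first moment a lower bound suffices; the third moment needed for it is
  bounded above by exponential tilting. The gain N^(-1/2) has two sources: moving a unit changes
  each factor of V by at most 2, while a typical factor has size sqrt N, and it changes the
  multinomial weight by a relative amount of order |l a - l b| / N. The obstacle is that moving a
  unit can leave the chamber. A sign resolves it: if exactly one of the two tuples is in the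
  chamber, V is nonpositive at the other, so replacing that value by 0 only brings the two values
  closer.\<close>

definition vandermonde :: "nat \<Rightarrow> (nat \<Rightarrow> real) \<Rightarrow> real" where
  "vandermonde k x = (\<Prod>i<k. \<Prod>m<i. x i - x m)"

text \<open>The falling factorial. It replaces the monomial \<open>z ^ j\<close> because the map
  sending \<open>f z\<close> to \<open>z * f (z - 1)\<close> acts on it by the factor
  \<open>z - real j\<close>.\<close>

definition ffac :: "real \<Rightarrow> nat \<Rightarrow> real" where
  "ffac z j = (\<Prod>m<j. z - real m)"

lemma ffac_Suc: "ffac z (Suc j) = ffac z j * (z - real j)"
  by (simp add: ffac_def)

lemma ffac_Suc_shift: "ffac z (Suc j) = z * ffac (z - 1) j"
  unfolding ffac_def prod.lessThan_Suc_shift by (simp add: algebra_simps)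

text \<open>The coefficients of the falling factorials in the Newton basis at the nodes \<open>x\<close>.\<close>

primrec newton_coeff :: "(nat \<Rightarrow> real) \<Rightarrow> nat \<Rightarrow> nat \<Rightarrow> real" where
  "newton_coeff x 0 m = (if m = 0 then 1 else 0)"
| "newton_coeff x (Suc j) m =
     (if m = 0 then 0 else newton_coeff x j (m - 1)) + (x m - real j) * newton_coeff x j m"

lemma newton_coeff_gt: "j < m \<Longrightarrow> newton_coeff x j m = 0"
  by (induction j arbitrary: m) auto

lemma newton_coeff_diag: "newton_coeff x j j = 1"
  by (induction j) (auto simp: newton_coeff_gt)

text \<open>The recursion of \<open>newton_coeff\<close> comes from splitting
  \<open>z - real j = (z - x m) + (x m - real j)\<close>: the first summand passes to the next
  Newton product, the second keeps the current one.\<close>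

lemma ffac_newton: "ffac z j = (\<Sum>m\<le>j. newton_coeff x j m * (\<Prod>i<m. z - x i))"
proof (induction j)
  case 0
  show ?case by (simp add: ffac_def)
next
  case (Suc j)
  let ?P = "\<lambda>m. \<Prod>i<m. z - x i"
  let ?c = "newton_coeff x j"
  have "ffac z (Suc j) = (\<Sum>m\<le>j. ?c m * ?P m * (z - real j))"
    by (simp add: ffac_Suc Suc sum_distrib_right)
  also have "\<dots> = (\<Sum>m\<le>j. ?c m * ?P (Suc m)) + (\<Sum>m\<le>j. (x m - real j) * ?c m * ?P m)"
    unfolding sum.distrib[symmetric] by (intro sum.cong) (auto simp: algebra_simps)
  also have "(\<Sum>m\<le>j. ?c m * ?P (Suc m)) = (\<Sum>m\<le>Suc j. (if m = 0 then 0 else ?c (m - 1)) * ?P m)"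
    unfolding sum.atMost_Suc_shift by simp
  also have "(\<Sum>m\<le>j. (x m - real j) * ?c m * ?P m) = (\<Sum>m\<le>Suc j. (x m - real j) * ?c m * ?P m)"
    by (simp add: newton_coeff_gt)
  finally show ?case
    by (simp add: sum.distrib[symmetric] algebra_simps)
qed

text \<open>The matrix of falling factorials is a lower triangular matrix of Newton products, whose
  diagonal gives the Vandermonde product, times an upper unitriangular matrix of
  \<open>newton_coeff\<close>. Leibniz' formula then exposes the single factors on which a change of
  one coordinate acts.\<close>

lemma vandermonde_leibniz:
  "vandermonde k x = (\<Sum>p | p permutes {0..<k}. signof p * (\<Prod>i=0..<k. ffac (x i) (p i)))"
proof -
  define F where "F = mat k k (\<lambda>(i,j). ffac (x i) j)"
  define L where "L = mat k k (\<lambda>(i,m). \<Prod>a<m. x i - x a)"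
  define U where "U = mat k k (\<lambda>(m,j). newton_coeff x j m)"
  have [simp]: "F \<in> carrier_mat k k" "L \<in> carrier_mat k k" "U \<in> carrier_mat k k"
    by (auto simp: F_def L_def U_def)
  have "F = L * U"
  proof (rule eq_matI)
    fix i j assume ij: "i < dim_row (L * U)" "j < dim_col (L * U)"
    then have "ffac (x i) j = (\<Sum>m\<in>{..j}. newton_coeff x j m * (\<Prod>a<m. x i - x a))"
      by (rule_tac ffac_newton)
    also have "\<dots> = (\<Sum>m\<in>{0..<k}. newton_coeff x j m * (\<Prod>a<m. x i - x a))"
      using ij by (intro sum.mono_neutral_left) (auto simp: newton_coeff_gt U_def)
    finally show "F $$ (i, j) = (L * U) $$ (i, j)"
      using ij by (simp add: F_def L_def U_def scalar_prod_def mult.commute)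
  qed (auto simp: F_def L_def U_def)
  moreover have "det U = 1"
    by (subst det_upper_triangular[where n = k])
       (auto simp: U_def newton_coeff_gt newton_coeff_diag diag_mat_def
             simp flip: prod.distinct_set_conv_list)
  moreover have "det L = vandermonde k x"
  proof (subst det_lower_triangular[where n = k])
    fix i j assume "i < j" "j < k"
    then show "L $$ (i, j) = 0"
      by (auto simp: L_def)
  next
    show "prod_list (diag_mat L) = vandermonde k x"
      by (simp add: L_def diag_mat_def vandermonde_def lessThan_atLeast0 flip: prod.distinct_set_conv_list)
  qed auto
  ultimately have "vandermonde k x = det F"
    using det_mult[of L k U] by simp
  also have "\<dots> = (\<Sum>p | p permutes {0..<k}. signof p * (\<Prod>i=0..<k. F $$ (i, p i)))"
    by (rule det_def') simp
  also have "\<dots> = (\<Sum>p | p permutes {0..<k}. signof p * (\<Prod>i=0..<k. ffac (x i) (p i)))"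
    by (intro sum.cong refl arg_cong2[of _ _ _ _ "(*)"] prod.cong)
       (insert permutes_in_image, fastforce simp: F_def)+
  finally show ?thesis .
qed

text \<open>In the Leibniz term of \<open>p\<close>, decrementing coordinate \<open>i\<close> and
  multiplying by \<open>x i\<close> produces the factor \<open>x i - real (p i)\<close>. The sum of
  these factors over \<open>i\<close> does not depend on \<open>p\<close>.\<close>

lemma sum_mult_vandermonde_decrement:
  "(\<Sum>i<k. x i * vandermonde k (x(i := x i - 1)))
     = ((\<Sum>i<k. x i) - (\<Sum>i<k. real i)) * vandermonde k x"
proof -
  let ?S = "{p. p permutes {0..<k}}"
  have *: "x i * (\<Prod>j=0..<k. ffac ((x(i := x i - 1)) j) (p j))
          = (x i - real (p i)) * (\<Prod>j=0..<k. ffac (x j) (p j))" if i: "i < k" for i p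
  proof -
    have "(\<Prod>j=0..<k. ffac ((x(i := x i - 1)) j) (p j))
        = ffac (x i - 1) (p i) * (\<Prod>j\<in>{0..<k}-{i}. ffac (x j) (p j))"
      using i by (subst prod.remove[of _ i]) auto
    moreover have "(\<Prod>j=0..<k. ffac (x j) (p j))
        = ffac (x i) (p i) * (\<Prod>j\<in>{0..<k}-{i}. ffac (x j) (p j))"
      using i by (subst prod.remove[of _ i]) auto
    \<comment> \<open>Both sides equal \<open>ffac (x i) (Suc (p i))\<close>, with the first factor
      split off on the left and the last one on the right.\<close>
    moreover have "x i * ffac (x i - 1) (p i) = (x i - real (p i)) * ffac (x i) (p i)"
      using ffac_Suc[of "x i" "p i"] ffac_Suc_shift[of "x i" "p i"] by (simp add: mult.commute)
    ultimately show ?thesis by simp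
  qed
  have "(\<Sum>i<k. x i * vandermonde k (x(i := x i - 1)))
      = (\<Sum>p\<in>?S. \<Sum>i<k. signof p * (x i * (\<Prod>j=0..<k. ffac ((x(i := x i - 1)) j) (p j))))"
    unfolding vandermonde_leibniz by (subst sum.swap) (simp add: sum_distrib_left mult_ac)
  also have "\<dots> = (\<Sum>p\<in>?S. \<Sum>i<k. signof p * ((x i - real (p i)) * (\<Prod>j=0..<k. ffac (x j) (p j))))"
    by (intro sum.cong refl) (use * in auto)
  also have "\<dots> = (\<Sum>p\<in>?S. (\<Sum>i<k. x i - real (p i)) * (signof p * (\<Prod>j=0..<k. ffac (x j) (p j))))"
    by (simp add: sum_distrib_left sum_distrib_right mult_ac)
  also have "\<dots> = (\<Sum>p\<in>?S. ((\<Sum>i<k. x i) - (\<Sum>i<k. real i)) * (signof p * (\<Prod>j=0..<k. ffac (x j) (p j))))"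
  proof (intro sum.cong refl arg_cong2[of _ _ _ _ "(*)"])
    fix p assume "p \<in> ?S"
    then have "(\<Sum>i<k. real (p i)) = (\<Sum>i<k. real i)"
      using sum.permute[of p "{0..<k}" real] by (simp add: lessThan_atLeast0 comp_def)
    then show "(\<Sum>i<k. x i - real (p i)) = (\<Sum>i<k. x i) - (\<Sum>i<k. real i)"
      by (simp add: sum_subtractf)
  qed
  finally show ?thesis
    by (simp add: vandermonde_leibniz sum_distrib_left)
qed

text \<open>Comparing the previous identity at \<open>x\<close> and at its translate by 1 gives the version without
  weights, and \<open>x \<mapsto> -x\<close> turns decrements into increments.\<close>

lemma sum_vandermonde_increment:
  "(\<Sum>i<k. vandermonde k (x(i := x i + 1))) = real k * vandermonde k x"
proof -
  have dec: "(\<Sum>i<k. vandermonde k (y(i := y i - 1))) = real k * vandermonde k y" for y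
  proof -
    define z where "z = (\<lambda>i. y i + 1)"
    have 1: "vandermonde k z = vandermonde k y"
      by (simp add: vandermonde_def z_def)
    have 2: "vandermonde k (z(i := z i - 1)) = vandermonde k (y(i := y i - 1))" for i
      unfolding vandermonde_def z_def by (intro prod.cong refl) auto
    have "(\<Sum>i<k. (y i + 1) * vandermonde k (y(i := y i - 1)))
        = ((\<Sum>i<k. y i + 1) - (\<Sum>i<k. real i)) * vandermonde k y"
      using sum_mult_vandermonde_decrement[where x = z and k = k] unfolding 1 2 by (simp add: z_def)
    then show ?thesis
      using sum_mult_vandermonde_decrement[where x = y and k = k]
      by (simp add: algebra_simps sum.distrib)
  qed
  define s :: real where "s = (\<Prod>i<k. \<Prod>m<i. -1)"
  have neg: "vandermonde k (\<lambda>i. - y i) = s * vandermonde k y" for y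
    unfolding vandermonde_def s_def prod.distrib[symmetric] by (intro prod.cong refl) auto
  have [simp]: "s \<noteq> 0" by (simp add: s_def)
  have "(\<lambda>i. - x i)(i := - x i - 1) = (\<lambda>j. - (x(i := x i + 1)) j)" for i
    by auto
  then have "s * (\<Sum>i<k. vandermonde k (x(i := x i + 1))) = s * (real k * vandermonde k x)"
    using dec[of "\<lambda>i. - x i"] by (simp only: neg sum_distrib_left) (simp add: mult_ac)
  then show ?thesis by simp
qed

lemma vandermonde_eq_0: "a < b \<Longrightarrow> b < k \<Longrightarrow> x a = x b \<Longrightarrow> vandermonde k x = 0"
  unfolding vandermonde_def
  by (intro prod_zero finite_lessThan bexI[of _ b] bexI[of _ a]) auto


section \<open>Multinomial weights and their moments\<close>

definition comps :: "nat \<Rightarrow> nat \<Rightarrow> (nat \<Rightarrow> nat) set" where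
  "comps k N = {l. (\<forall>j\<ge>k. l j = 0) \<and> (\<Sum>j<k. l j) = N}"

text \<open>For \<open>l \<in> comps k N\<close> this is the multinomial coefficient divided by
  \<open>fact N\<close>.\<close>

definition wt :: "nat \<Rightarrow> (nat \<Rightarrow> nat) \<Rightarrow> real" where
  "wt k l = 1 / (\<Prod>j<k. fact (l j))"

text \<open>Serves twice: as a unit step of a tuple and, for shapes, as the addition of a box to a
  row.\<close>

definition inc :: "(nat \<Rightarrow> nat) \<Rightarrow> nat \<Rightarrow> nat \<Rightarrow> nat" where
  "inc l i = l(i := Suc (l i))"

abbreviation vand :: "nat \<Rightarrow> (nat \<Rightarrow> nat) \<Rightarrow> real" where
  "vand k l \<equiv> vandermonde k (\<lambda>i. real (l i))"

lemma finite_comps: "finite (comps k N)"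
proof (rule finite_subset)
  show "comps k N \<subseteq> {l. \<forall>j. (j \<in> {..<k} \<longrightarrow> l j \<in> {..N}) \<and> (j \<notin> {..<k} \<longrightarrow> l j = 0)}"
  proof (intro subsetI CollectI allI conjI impI)
    fix l j assume "l \<in> comps k N" "j \<in> {..<k}"
    then show "l j \<in> {..N}"
      using member_le_sum[of j "{..<k}" l] by (auto simp: comps_def)
  next
    fix l j assume "l \<in> comps k N" "j \<notin> {..<k}"
    then show "l j = 0" by (auto simp: comps_def)
  qed
qed (rule finite_set_of_finite_funs; simp)

lemma wt_pos: "wt k l > 0"
  by (auto simp: wt_def intro!: prod_pos divide_pos_pos)

lemma wt_inc: "i < k \<Longrightarrow> wt k (inc u i) = wt k u / (real (u i) + 1)"
proof -
  assume i: "i < k"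
  have "(\<Prod>j<k. fact (inc u i j) :: real) = fact (Suc (u i)) * (\<Prod>j\<in>{..<k}-{i}. fact (u j))"
    using i by (subst prod.remove[of _ i]) (auto simp: inc_def)
  moreover have "(\<Prod>j<k. fact (u j) :: real) = fact (u i) * (\<Prod>j\<in>{..<k}-{i}. fact (u j))"
    using i by (subst prod.remove[of _ i]) auto
  ultimately show ?thesis
    by (simp add: wt_def field_simps)
qed

lemma inc_in_comps: "i < k \<Longrightarrow> u \<in> comps k N \<Longrightarrow> inc u i \<in> comps k (Suc N)"
proof -
  assume i: "i < k" and u: "u \<in> comps k N"
  have "(\<Sum>j<k. inc u i j) = Suc (u i) + (\<Sum>j\<in>{..<k}-{i}. u j)"
    using i by (subst sum.remove[of _ i]) (auto simp: inc_def)
  moreover have "(\<Sum>j<k. u j) = u i + (\<Sum>j\<in>{..<k}-{i}. u j)"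
    using i by (subst sum.remove[of _ i]) auto
  ultimately show ?thesis
    using i u by (auto simp: comps_def inc_def)
qed

lemma inj_inc: "inj_on (\<lambda>u. inc u i) A"
proof (rule inj_onI)
  fix u v assume "inc u i = inc v i"
  then have "inc u i j = inc v i j" for j by simp
  then have "u j = v j" for j
    by (auto simp: inc_def fun_upd_def dest: meta_spec[of _ j] split: if_splits)
  then show "u = v" by auto
qed

lemma inc_image: "i < k \<Longrightarrow> (\<lambda>u. inc u i) ` comps k N = {l \<in> comps k (Suc N). l i \<noteq> 0}"
proof (intro equalityI subsetI)
  fix l assume i: "i < k" and "l \<in> {l \<in> comps k (Suc N). l i \<noteq> 0}"
  then have l: "l \<in> comps k (Suc N)" "l i \<noteq> 0" by auto
  have eq: "l = inc (l(i := l i - 1)) i"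
    using l by (auto simp: inc_def)
  have "(\<Sum>j<k. l j) = l i + (\<Sum>j\<in>{..<k}-{i}. l j)"
    using i by (subst sum.remove[of _ i]) auto
  moreover have "(\<Sum>j<k. (l(i := l i - 1)) j) = (l i - 1) + (\<Sum>j\<in>{..<k}-{i}. l j)"
    using i by (subst sum.remove[of _ i]) auto
  ultimately have "l(i := l i - 1) \<in> comps k N"
    using l i by (auto simp: comps_def)
  with eq show "l \<in> (\<lambda>u. inc u i) ` comps k N" by blast
qed (auto simp: inc_in_comps, auto simp: inc_def)

lemma sum_comps_reindex:
  "i < k \<Longrightarrow> (\<Sum>u\<in>comps k N. g (inc u i)) = (\<Sum>l\<in>{l \<in> comps k (Suc N). l i \<noteq> 0}. g l)"
  by (subst inc_image[symmetric]) (simp_all add: sum.reindex[OF inj_inc])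

text \<open>The factor \<open>real (l i)\<close> cancels against \<open>fact (l i)\<close> and kills
  the tuples with \<open>l i = 0\<close>, which are exactly those not of the form
  \<open>inc u i\<close>.\<close>

lemma sum_comps_shift:
  assumes "i < k"
  shows "(\<Sum>l\<in>comps k (Suc N). real (l i) * wt k l * h l) = (\<Sum>u\<in>comps k N. wt k u * h (inc u i))"
proof -
  have "(\<Sum>l\<in>comps k (Suc N). real (l i) * wt k l * h l)
      = (\<Sum>l\<in>{l \<in> comps k (Suc N). l i \<noteq> 0}. real (l i) * wt k l * h l)"
    by (rule sum.mono_neutral_right) (auto simp: finite_comps)
  also have "\<dots> = (\<Sum>u\<in>comps k N. real (inc u i i) * wt k (inc u i) * h (inc u i))"
    by (rule sum_comps_reindex[OF assms, symmetric])
  also have "\<dots> = (\<Sum>u\<in>comps k N. wt k u * h (inc u i))"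
    by (intro sum.cong refl) (auto simp: wt_inc assms, auto simp: inc_def field_simps)
  finally show ?thesis .
qed

lemma comps_0: "comps k 0 = {\<lambda>_. 0}"
proof (intro equalityI subsetI)
  fix l assume l: "l \<in> comps k 0"
  have "l j = 0" for j
    using l by (cases "j < k") (auto simp: comps_def)
  then show "l \<in> {\<lambda>_. 0}" by auto
qed (auto simp: comps_def)

text \<open>The multinomial theorem in the normalisation of \<open>wt\<close>. Multiplying by
  \<open>Suc N\<close>, the sum of the entries of \<open>l\<close>, lets
  \<open>sum_comps_shift\<close> remove one unit from each coordinate in turn.\<close>

lemma sum_comps_power:
  "(\<Sum>l\<in>comps k N. wt k l * (\<Prod>j<k. z j ^ l j)) = (\<Sum>j<k. z j) ^ N / fact N"
proof (induction N)
  case 0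
  show ?case by (simp add: comps_0 wt_def)
next
  case (Suc N)
  let ?S = "\<lambda>N. \<Sum>l\<in>comps k N. wt k l * (\<Prod>j<k. z j ^ l j)"
  have zi: "(\<Prod>j<k. z j ^ inc u i j) = z i * (\<Prod>j<k. z j ^ u j)" if "i < k" for u i
  proof -
    have "(\<Prod>j<k. z j ^ inc u i j) = z i ^ Suc (u i) * (\<Prod>j\<in>{..<k}-{i}. z j ^ u j)"
      using that by (subst prod.remove[of _ i]) (auto simp: inc_def)
    moreover have "(\<Prod>j<k. z j ^ u j) = z i ^ u i * (\<Prod>j\<in>{..<k}-{i}. z j ^ u j)"
      using that by (subst prod.remove[of _ i]) auto
    ultimately show ?thesis by simp
  qed
  have "real (Suc N) * ?S (Suc N)
      = (\<Sum>l\<in>comps k (Suc N). (\<Sum>i<k. real (l i)) * (wt k l * (\<Prod>j<k. z j ^ l j)))"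
    unfolding sum_distrib_left
    by (intro sum.cong refl) (auto simp: comps_def simp flip: of_nat_sum)
  also have "\<dots> = (\<Sum>i<k. \<Sum>l\<in>comps k (Suc N). real (l i) * wt k l * (\<Prod>j<k. z j ^ l j))"
    by (subst sum.swap) (simp add: sum_distrib_left sum_distrib_right mult_ac)
  also have "\<dots> = (\<Sum>i<k. \<Sum>u\<in>comps k N. wt k u * (\<Prod>j<k. z j ^ inc u i j))"
    by (intro sum.cong refl sum_comps_shift) auto
  also have "\<dots> = (\<Sum>i<k. z i * ?S N)"
    unfolding sum_distrib_left by (intro sum.cong refl) (auto simp: zi)
  also have "\<dots> = (\<Sum>i<k. z i) * ((\<Sum>j<k. z j) ^ N / fact N)"
    by (simp only: Suc sum_distrib_right)
  finally have "?S (Suc N) = (\<Sum>i<k. z i) * ((\<Sum>j<k. z j) ^ N / fact N) / real (Suc N)"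
    by (metis nonzero_mult_div_cancel_left of_nat_neq_0)
  then show ?case
    by (simp add: mult.commute)
qed

section \<open>Moments of the deviation from the balanced tuple\<close>

definition dev :: "nat \<Rightarrow> nat \<Rightarrow> (nat \<Rightarrow> nat) \<Rightarrow> real" where
  "dev k N l = (\<Sum>j<k. \<bar>real (l j) - real N / real k\<bar>)"

lemma exp_le_quadratic:
  fixes t :: real
  assumes "\<bar>t\<bar> \<le> 1"
  shows "exp t \<le> 1 + t + t\<^sup>2"
proof (cases "t \<ge> 0")
  case True
  then show ?thesis using exp_bound[of t] assms by auto
next
  case False
  define x where "x = - t"
  have x: "0 < x" "x \<le> 1" using False assms by (auto simp: x_def)
  have "1 + x \<le> exp x" by simp
  \<comment> \<open>For negative \<open>t\<close> the bound follows from
    \<open>1 + x \<le> exp x\<close> at \<open>x = - t\<close>, because this product is at least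
    1.\<close>
  moreover have "(1 + x) * (1 - x + x\<^sup>2) = 1 + x ^ 3"
    by (simp add: algebra_simps power2_eq_square power3_eq_cube)
  ultimately have "1 \<le> exp x * (1 - x + x\<^sup>2)"
    using x mult_right_mono[of "1 + x" "exp x" "1 - x + x\<^sup>2"] by (smt (verit) zero_le_power zero_le_power2)
  then have "exp (- x) \<le> 1 - x + x\<^sup>2"
    by (simp add: exp_minus field_simps)
  then show ?thesis by (simp add: x_def)
qed

text \<open>Tilting coordinate \<open>i\<close> by \<open>exp t\<close> gives a power by the
  multinomial theorem. Centring at \<open>N / k\<close> cancels the term linear in \<open>t\<close>
  and leaves an exponent of order \<open>N * t\<^sup>2\<close>.\<close>

lemma exp_moment_comps:
  assumes k: "k \<ge> 1" and i: "i < k" and t: "\<bar>t\<bar> \<le> 1"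
  shows "(\<Sum>l\<in>comps k N. wt k l * exp (t * (real (l i) - real N / real k)))
           \<le> real k ^ N / fact N * exp (real N * t\<^sup>2 / real k)"
proof -
  define z where "z = (\<lambda>j. if j = i then exp t else (1::real))"
  have z: "(\<Prod>j<k. z j ^ l j) = exp t ^ l i" for l
    using i by (subst prod.remove[of _ i]) (auto simp: z_def)
  have sz: "(\<Sum>j<k. z j) = real k - 1 + exp t"
    using i k by (subst sum.remove[of _ i]) (auto simp: z_def of_nat_diff)
  have "real k - 1 + exp t \<le> real k * (1 + (t + t\<^sup>2) / real k)"
  proof -
    have "real k * (1 + (t + t\<^sup>2) / real k) = real k + (t + t\<^sup>2)"
      using k by (subst distrib_left) simp
    then show ?thesis using exp_le_quadratic[OF t] by simp
  qed
  also have "\<dots> \<le> real k * exp ((t + t\<^sup>2) / real k)"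
    by (intro mult_left_mono) auto
  finally have le: "real k - 1 + exp t \<le> real k * exp ((t + t\<^sup>2) / real k)" .
  have "(\<Sum>l\<in>comps k N. wt k l * exp (t * (real (l i) - real N / real k)))
      = (\<Sum>l\<in>comps k N. wt k l * (\<Prod>j<k. z j ^ l j)) * exp (- t * real N / real k)"
    unfolding sum_distrib_right z
  proof (intro sum.cong refl)
    fix l
    have "t * (real (l i) - real N / real k) = real (l i) * t + - t * real N / real k"
      by (simp add: right_diff_distrib)
    then show "wt k l * exp (t * (real (l i) - real N / real k)) = wt k l * exp t ^ l i * exp (- t * real N / real k)"
      by (simp only: exp_add exp_of_nat_mult mult.assoc)
  qed
  also have "\<dots> = (real k - 1 + exp t) ^ N / fact N * exp (- t * real N / real k)"
    by (simp add: sum_comps_power sz)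
  also have "\<dots> \<le> (real k * exp ((t + t\<^sup>2) / real k)) ^ N / fact N * exp (- t * real N / real k)"
    using k by (intro mult_right_mono divide_right_mono power_mono le) auto
  also have "\<dots> = real k ^ N / fact N * (exp (real N * ((t + t\<^sup>2) / real k)) * exp (- t * real N / real k))"
    by (simp add: power_mult_distrib flip: exp_of_nat_mult)
  also have "exp (real N * ((t + t\<^sup>2) / real k)) * exp (- t * real N / real k) = exp (real N * t\<^sup>2 / real k)"
    by (simp flip: exp_add add: distrib_left add_divide_distrib mult.commute)
  finally show ?thesis .
qed

lemma power_le_fact_exp:
  fixes x :: real
  assumes "x \<ge> 0"
  shows "x ^ d \<le> fact d * exp x"
proof -
  have "(\<Sum>n\<in>{d}. x ^ n /\<^sub>R fact n) \<le> (\<Sum>n. x ^ n /\<^sub>R fact n)"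
    using assms by (intro sum_le_suminf summable_exp_generic) auto
  then show ?thesis
    by (simp add: exp_def field_simps)
qed

text \<open>Rescaled by \<open>sqrt N\<close>, the deviation has bounded exponential moments, and
  these dominate every power. The shift \<open>c\<close> absorbs the bounded changes made when units
  are moved between coordinates.\<close>

lemma moment_comps:
  fixes c :: real
  assumes k: "k \<ge> 1" and c: "c \<ge> 0"
  shows "\<exists>K>0. \<forall>N\<ge>1. (\<Sum>l\<in>comps k N. wt k l * (dev k N l + c) ^ d) \<le> K * (real k ^ N / fact N) * sqrt N ^ d"
\<comment> \<open>\<open>(k + c) ^ d * fact d * exp 1\<close> turns the power into an exponential;
  \<open>k\<close> counts the coordinates, and \<open>2 * exp 1\<close> bounds the exponential
  moments at \<open>t\<close> and \<open>- t\<close> together.\<close>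
proof (intro exI[of _ "(real k + c) ^ d * fact d * exp 1 * (real k * (2 * exp 1))"] conjI allI impI)
  show "0 < (real k + c) ^ d * fact d * exp 1 * (real k * (2 * exp 1))"
    using k c by (intro mult_pos_pos zero_less_power) auto
next
  fix N :: nat assume N: "N \<ge> 1"
  define D where "D = (real k + c) ^ d * fact d * exp 1"
  \<comment> \<open>With this choice \<open>N * t\<^sup>2 = 1\<close>, so
    \<open>exp_moment_comps\<close> gives a bound that depends on \<open>N\<close> only through
    \<open>k ^ N / fact N\<close>.\<close>
  define t where "t = 1 / sqrt N"
  have t: "0 < t" "t \<le> 1" "t * sqrt N = 1" "real N * t\<^sup>2 = 1"
    using N by (auto simp: t_def field_simps)
  define Y where "Y = (\<lambda>(l :: nat \<Rightarrow> nat) j. real (l j) - real N / real k)"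
  have bound: "(dev k N l + c) ^ d
      \<le> sqrt N ^ d * (\<Sum>j<k. D * (exp (t * Y l j) + exp (- t * Y l j)))" for l
  proof -
    have ne: "{..<k} \<noteq> {}" using k by (auto simp: lessThan_empty_iff)
    \<comment> \<open>The coordinate with the largest deviation controls the whole sum up to the
      factor \<open>k\<close>.\<close>
    obtain m where m: "m < k" "\<And>j. j < k \<Longrightarrow> \<bar>Y l j\<bar> \<le> \<bar>Y l m\<bar>"
    proof -
      have "Max ((\<lambda>j. \<bar>Y l j\<bar>) ` {..<k}) \<in> (\<lambda>j. \<bar>Y l j\<bar>) ` {..<k}"
        using ne by (intro Max_in) auto
      then obtain m where "m < k" "Max ((\<lambda>j. \<bar>Y l j\<bar>) ` {..<k}) = \<bar>Y l m\<bar>" by auto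
      then show ?thesis
        using that[of m] by (metis Max_ge finite_imageI finite_lessThan image_eqI lessThan_iff)
    qed
    define y where "y = t * \<bar>Y l m\<bar>"
    have y: "y \<ge> 0" using t by (auto simp: y_def)
    have "dev k N l \<le> real k * \<bar>Y l m\<bar>"
      unfolding dev_def Y_def[symmetric]
      using sum_bounded_above[of "{..<k}" "\<lambda>j. \<bar>Y l j\<bar>" "\<bar>Y l m\<bar>"] m by (auto simp: Y_def)
    then have "t * dev k N l \<le> t * (real k * \<bar>Y l m\<bar>)"
      using t by (intro mult_left_mono) auto
    moreover have "t * c \<le> 1 * c"
      using t c by (intro mult_right_mono) auto
    ultimately have "t * (dev k N l + c) \<le> real k * y + c"
      unfolding y_def distrib_left mult.left_commute[of "real k"] by linarith
    also have "\<dots> \<le> (real k + c) * (1 + y)"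
      using y k c by (simp add: algebra_simps)
    finally have 1: "t * (dev k N l + c) \<le> (real k + c) * (1 + y)" .
    have "dev k N l + c = sqrt N * (t * (dev k N l + c))"
    proof -
      have "sqrt N * (t * (dev k N l + c)) = (t * sqrt N) * (dev k N l + c)"
        by (simp only: mult_ac)
      then show ?thesis using t by simp
    qed
    then have "(dev k N l + c) ^ d = sqrt N ^ d * (t * (dev k N l + c)) ^ d"
      by (metis power_mult_distrib)
    also have "\<dots> \<le> sqrt N ^ d * ((real k + c) * (1 + y)) ^ d"
      using 1 t c by (intro mult_left_mono power_mono) (auto simp: dev_def intro!: sum_nonneg add_nonneg_nonneg mult_nonneg_nonneg)
    also have "\<dots> \<le> sqrt N ^ d * (D * exp y)"
    proof -
      have "(real k + c) ^ d * (1 + y) ^ d \<le> (real k + c) ^ d * (fact d * exp (1 + y))"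
        using power_le_fact_exp[of "1 + y" d] y c by (intro mult_left_mono) auto
      also have "\<dots> = D * exp y"
        by (simp add: D_def exp_add)
      finally show ?thesis
        by (intro mult_left_mono) (simp_all add: power_mult_distrib)
    qed
    also have "exp y \<le> exp (t * Y l m) + exp (- t * Y l m)"
      by (auto simp: y_def abs_if)
    also have "D * (exp (t * Y l m) + exp (- t * Y l m)) \<le> (\<Sum>j<k. D * (exp (t * Y l j) + exp (- t * Y l j)))"
      using m k c by (intro member_le_sum[of m "{..<k}" "\<lambda>j. D * (exp (t * Y l j) + exp (- t * Y l j))"])
        (auto simp: D_def intro!: mult_nonneg_nonneg add_nonneg_nonneg)
    finally show ?thesis
      using k c by (simp add: D_def mult_left_mono)
  qed
  have D: "D \<ge> 0" using k c by (auto simp: D_def)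
  have em: "(\<Sum>l\<in>comps k N. wt k l * exp (s * Y l j)) \<le> real k ^ N / fact N * exp 1"
    if "j < k" "s = t \<or> s = - t" for j s
  proof -
    have "(\<Sum>l\<in>comps k N. wt k l * exp (s * Y l j)) \<le> real k ^ N / fact N * exp (real N * s\<^sup>2 / real k)"
      unfolding Y_def using that t k by (intro exp_moment_comps) auto
    also have "\<dots> \<le> real k ^ N / fact N * exp 1"
      using that t k by (intro mult_left_mono) auto
    finally show ?thesis .
  qed
  have "(\<Sum>l\<in>comps k N. wt k l * (dev k N l + c) ^ d)
      \<le> (\<Sum>l\<in>comps k N. wt k l * (sqrt N ^ d * (\<Sum>j<k. D * (exp (t * Y l j) + exp (- t * Y l j)))))"
    using wt_pos[of k] less_imp_le by (intro sum_mono mult_left_mono bound) blast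
  also have "\<dots> = (\<Sum>l\<in>comps k N. \<Sum>j<k. sqrt N ^ d * D * (wt k l * exp (t * Y l j) + wt k l * exp (- t * Y l j)))"
    unfolding sum_distrib_left by (intro sum.cong refl) (simp only: distrib_left mult_ac)
  also have "\<dots> = (\<Sum>j<k. sqrt N ^ d * D * (\<Sum>l\<in>comps k N. wt k l * exp (t * Y l j) + wt k l * exp (- t * Y l j)))"
    by (subst sum.swap) (simp only: sum_distrib_left)
  also have "\<dots> = sqrt N ^ d * (\<Sum>j<k. D * ((\<Sum>l\<in>comps k N. wt k l * exp (t * Y l j))
        + (\<Sum>l\<in>comps k N. wt k l * exp (- t * Y l j))))"
    by (simp only: sum_distrib_left[of "sqrt N ^ d"] sum.distrib mult.assoc)
  also have "\<dots> \<le> sqrt N ^ d * (\<Sum>j<k. D * (real k ^ N / fact N * exp 1 + real k ^ N / fact N * exp 1))"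
    using D N by (intro mult_left_mono sum_mono add_mono em) auto
  also have "\<dots> = D * (real k * (2 * exp 1)) * (real k ^ N / fact N) * sqrt N ^ d"
    by (simp add: algebra_simps)
  finally show "(\<Sum>l\<in>comps k N. wt k l * (dev k N l + c) ^ d)
      \<le> (real k + c) ^ d * fact d * exp 1 * (real k * (2 * exp 1)) * (real k ^ N / fact N) * sqrt N ^ d"
    by (simp add: D_def)
qed


section \<open>The Weyl chamber\<close>

text \<open>The number \<open>k * (k - 1) / 2\<close> of factors of \<open>vandermonde k\<close>,
  and also the total shift when 0, ..., k - 1 are added to the column lengths.\<close>

definition choose2 :: "nat \<Rightarrow> nat" where
  "choose2 k = (\<Sum>i<k. i)"

lemma vandermonde_pairs:
  "vandermonde k x = (\<Prod>(i,m)\<in>(SIGMA i:{..<k}. {..<i}). x i - x m)"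
  unfolding vandermonde_def by (subst prod.Sigma) auto

lemma card_pairs: "card (SIGMA i:{..<k}. {..<i::nat}) = choose2 k"
  by (simp add: choose2_def)

lemma abs_prod_le:
  fixes A :: "'a \<Rightarrow> real"
  assumes "\<And>x. x \<in> Q \<Longrightarrow> \<bar>A x\<bar> \<le> M"
  shows "\<bar>prod A Q\<bar> \<le> M ^ card Q"
proof -
  have "\<bar>prod A Q\<bar> = (\<Prod>x\<in>Q. \<bar>A x\<bar>)" by (simp add: abs_prod)
  also have "\<dots> \<le> (\<Prod>x\<in>Q. M)" using assms by (intro prod_mono) auto
  finally show ?thesis by simp
qed

text \<open>The factors are replaced one at a time: the replaced one costs \<open>e\<close> and each
  of the others at most \<open>M\<close>. One power of \<open>M\<close> is thus exchanged for
  \<open>e\<close>, which is the gain over the trivial bound.\<close>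

lemma abs_prod_diff_le:
  fixes A B :: "'a \<Rightarrow> real"
  assumes "finite Q" "M \<ge> 0" "e \<ge> 0"
    and "\<And>x. x \<in> Q \<Longrightarrow> \<bar>A x\<bar> \<le> M" "\<And>x. x \<in> Q \<Longrightarrow> \<bar>B x\<bar> \<le> M" "\<And>x. x \<in> Q \<Longrightarrow> \<bar>A x - B x\<bar> \<le> e"
  shows "\<bar>prod A Q - prod B Q\<bar> \<le> real (card Q) * e * M ^ (card Q - 1)"
  using assms(1,4-6)
proof (induction Q)
  case empty
  then show ?case by simp
next
  case (insert x Q)
  have "prod A (insert x Q) - prod B (insert x Q) = A x * (prod A Q - prod B Q) + (A x - B x) * prod B Q"
    using insert.hyps by (simp add: algebra_simps)
  also have "\<bar>\<dots>\<bar> \<le> \<bar>A x\<bar> * \<bar>prod A Q - prod B Q\<bar> + \<bar>A x - B x\<bar> * \<bar>prod B Q\<bar>"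
    by (metis abs_mult abs_triangle_ineq)
  also have "\<dots> \<le> M * (real (card Q) * e * M ^ (card Q - 1)) + e * M ^ card Q"
    using insert.prems assms(2,3)
    by (intro add_mono mult_mono insert.IH abs_prod_le) auto
  also have "\<dots> = real (card (insert x Q)) * e * M ^ (card (insert x Q) - 1)"
    using insert.hyps by (cases "card Q") (auto simp: algebra_simps)
  finally show ?case .
qed

lemma abs_diff_le_dev:
  assumes "i < k" "m < k" "i \<noteq> m"
  shows "\<bar>real (l i) - real (l m)\<bar> \<le> dev k N l"
proof -
  let ?d = "\<lambda>j. \<bar>real (l j) - real N / real k\<bar>"
  have "(\<Sum>j\<in>{i,m}. ?d j) \<le> dev k N l"
    unfolding dev_def using assms by (intro sum_mono2) auto
  then show ?thesis using assms by simp
qed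

lemma dev_nonneg: "dev k N l \<ge> 0"
  by (auto simp: dev_def intro: sum_nonneg)

lemma abs_vandermonde_le:
  assumes "\<And>i m. m < i \<Longrightarrow> i < k \<Longrightarrow> \<bar>x i - x m\<bar> \<le> M"
  shows "\<bar>vandermonde k x\<bar> \<le> M ^ choose2 k"
  unfolding vandermonde_pairs card_pairs[symmetric]
  by (intro abs_prod_le) (use assms in auto)

lemma abs_vandermonde_diff_le:
  assumes "M \<ge> 0" "e \<ge> 0"
    and "\<And>i m. m < i \<Longrightarrow> i < k \<Longrightarrow> \<bar>x i - x m\<bar> \<le> M"
    and "\<And>i m. m < i \<Longrightarrow> i < k \<Longrightarrow> \<bar>y i - y m\<bar> \<le> M"
    and "\<And>i m. m < i \<Longrightarrow> i < k \<Longrightarrow> \<bar>(x i - x m) - (y i - y m)\<bar> \<le> e"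
  shows "\<bar>vandermonde k x - vandermonde k y\<bar> \<le> real (choose2 k) * e * M ^ (choose2 k - 1)"
  unfolding vandermonde_pairs card_pairs[symmetric]
  by (intro abs_prod_diff_le) (use assms in auto)

text \<open>The product has one nonpositive factor among nonnegative ones. It serves for tuples that
  leave the chamber through a single inverted pair.\<close>

lemma vandermonde_le_0:
  assumes "c < k" "d < c" "x c \<le> x d"
    and "\<And>i m. m < i \<Longrightarrow> i < k \<Longrightarrow> (i, m) \<noteq> (c, d) \<Longrightarrow> x m \<le> x i"
  shows "vandermonde k x \<le> 0"
proof -
  let ?Q = "SIGMA i:{..<k}. {..<i::nat}"
  have "vandermonde k x = (x c - x d) * (\<Prod>(i,m)\<in>?Q - {(c,d)}. x i - x m)"
    unfolding vandermonde_pairs using assms(1,2) by (subst prod.remove[of _ "(c,d)"]) auto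
  moreover have "(\<Prod>(i,m)\<in>?Q - {(c,d)}. x i - x m) \<ge> 0"
    using assms(4) by (intro prod_nonneg) (fastforce split: prod.splits)
  ultimately show ?thesis
    using assms(3) by (simp add: mult_nonpos_nonneg)
qed

lemma vandermonde_pos:
  assumes "\<And>i m. m < i \<Longrightarrow> i < k \<Longrightarrow> x m < x i"
  shows "vandermonde k x > 0"
  unfolding vandermonde_pairs by (intro prod_pos) (use assms in auto)

definition chamber :: "nat \<Rightarrow> nat \<Rightarrow> (nat \<Rightarrow> nat) set" where
  "chamber k N = {l \<in> comps k N. \<forall>i m. m < i \<longrightarrow> i < k \<longrightarrow> l m < l i}"

lemma chamber_subset: "chamber k N \<subseteq> comps k N"
  by (auto simp: chamber_def)

lemma finite_chamber: "finite (chamber k N)"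
  using chamber_subset finite_comps by (rule finite_subset)

lemma vand_chamber_pos: "l \<in> chamber k N \<Longrightarrow> vand k l > 0"
  by (intro vandermonde_pos) (auto simp: chamber_def)

text \<open>The Vandermonde product vanishes on the walls, so the walks confined to the chamber satisfy
  the same recursions as free ones.\<close>

lemma vand_weak_chamber:
  assumes "l \<in> comps k N" "l \<notin> chamber k N" "\<And>i m. m < i \<Longrightarrow> i < k \<Longrightarrow> l m \<le> l i"
  shows "vand k l = 0"
proof -
  obtain i m where "m < i" "i < k" "\<not> l m < l i"
    using assms(1,2) by (auto simp: chamber_def)
  then show ?thesis
    using assms(3)[of m i] by (intro vandermonde_eq_0[of m i]) auto
qed

text \<open>A unit step between the chamber and its complement has its outer endpoint on a wall,
  where the Vandermonde product vanishes. Hence the restriction to the chamber may be imposed on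
  either end of the step.\<close>

lemma vand_inc_wall:
  assumes "i < k" "u \<in> comps k N"
  shows "(if inc u i \<in> chamber k (Suc N) then vand k (inc u i) * vand k u else 0)
       = (if u \<in> chamber k N then vand k (inc u i) * vand k u else 0)"
proof -
  have "vand k u = 0" if "inc u i \<in> chamber k (Suc N)" "u \<notin> chamber k N"
  proof (rule vand_weak_chamber[OF assms(2) that(2)])
    fix a b :: nat assume "b < a" "a < k"
    then have "inc u i b < inc u i a" using that(1) by (auto simp: chamber_def)
    then show "u b \<le> u a" by (auto simp: inc_def split: if_splits)
  qed
  moreover have "vand k (inc u i) = 0" if "inc u i \<notin> chamber k (Suc N)" "u \<in> chamber k N"
  proof (rule vand_weak_chamber[OF inc_in_comps[OF assms] that(1)])
    fix a b :: nat assume "b < a" "a < k"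
    then have "u b < u a" using that(2) by (auto simp: chamber_def)
    then show "inc u i b \<le> inc u i a" by (auto simp: inc_def)
  qed
  ultimately show ?thesis by auto
qed

lemma vand_inc: "vand k (inc u i) = vandermonde k ((\<lambda>j. real (u j))(i := real (u i) + 1))"
  by (rule arg_cong[of _ _ "vandermonde k"]) (auto simp: inc_def)

section \<open>Second and first moments of the Vandermonde product over the chamber\<close>

definition vsum2 :: "nat \<Rightarrow> nat \<Rightarrow> real" where
  "vsum2 k N = (\<Sum>l\<in>chamber k N. wt k l * vand k l ^ 2)"

lemma sum_chamber: "(\<Sum>l\<in>chamber k N. f l) = (\<Sum>l\<in>comps k N. if l \<in> chamber k N then f l else 0)"
  using chamber_subset[of k N] by (simp add: sum.If_cases finite_comps Int_absorb1)

text \<open>The truncated subtraction in \<open>l i - 1\<close> is harmless: when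
  \<open>l i = 0\<close>, the factor \<open>real (l i)\<close> removes the term.\<close>

lemma vand_recursion:
  assumes "l \<in> comps k N"
  shows "(real N - real (choose2 k)) * vand k l
       = (\<Sum>i<k. real (l i) * vand k (l(i := l i - 1)))"
proof -
  let ?x = "\<lambda>j. real (l j)"
  have "(\<Sum>i<k. ?x i * vandermonde k (?x(i := ?x i - 1))) = (real N - real (choose2 k)) * vand k l"
    using sum_mult_vandermonde_decrement[of ?x k] assms
    by (auto simp: comps_def choose2_def)
  moreover have "?x i * vandermonde k (?x(i := ?x i - 1)) = real (l i) * vand k (l(i := l i - 1))" for i
  proof (cases "l i = 0")
    case False
    then have "?x(i := ?x i - 1) = (\<lambda>j. real ((l(i := l i - 1)) j))" by auto
    then show ?thesis by simp
  qed simp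
  ultimately show ?thesis by simp
qed

text \<open>One of the two Vandermonde factors is expanded by decrements,
  \<open>sum_comps_shift\<close> moves the sum one level down, \<open>vand_inc_wall\<close>
  transfers the chamber condition, and the increments of the other factor sum to
  \<open>real k\<close> times the product.\<close>

lemma vsum2_Suc: "(real (Suc N) - real (choose2 k)) * vsum2 k (Suc N) = real k * vsum2 k N"
proof -
  let ?chi = "\<lambda>N l. if l \<in> chamber k N then vand k l else 0"
  have "(real (Suc N) - real (choose2 k)) * vsum2 k (Suc N)
      = (\<Sum>l\<in>comps k (Suc N). wt k l * ?chi (Suc N) l * ((real (Suc N) - real (choose2 k)) * vand k l))"
    unfolding vsum2_def sum_chamber sum_distrib_left
    by (intro sum.cong refl) (auto simp: power2_eq_square)
  also have "\<dots> = (\<Sum>l\<in>comps k (Suc N). wt k l * ?chi (Suc N) l * (\<Sum>i<k. real (l i) * vand k (l(i := l i - 1))))"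
    by (rule sum.cong[OF refl]) (simp only: vand_recursion)
  also have "\<dots> = (\<Sum>l\<in>comps k (Suc N). \<Sum>i<k. real (l i) * wt k l * (?chi (Suc N) l * vand k (l(i := l i - 1))))"
    unfolding sum_distrib_left by (intro sum.cong refl) (simp only: mult_ac)
  also have "\<dots> = (\<Sum>i<k. \<Sum>l\<in>comps k (Suc N). real (l i) * wt k l * (?chi (Suc N) l * vand k (l(i := l i - 1))))"
    by (rule sum.swap)
  also have "\<dots> = (\<Sum>i<k. \<Sum>u\<in>comps k N. wt k u * (?chi (Suc N) (inc u i) * vand k ((inc u i)(i := inc u i i - 1))))"
    by (intro sum.cong refl sum_comps_shift) auto
  also have "\<dots> = (\<Sum>i<k. \<Sum>u\<in>comps k N. wt k u * (?chi N u * vand k (inc u i)))"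
  proof (rule sum.cong[OF refl], rule sum.cong[OF refl], rule arg_cong[of _ _ "(*) _"])
    fix i u assume "i \<in> {..<k}" "u \<in> comps k N"
    moreover have "(inc u i)(i := inc u i i - 1) = u" by (auto simp: inc_def)
    ultimately show "?chi (Suc N) (inc u i) * vand k ((inc u i)(i := inc u i i - 1)) = ?chi N u * vand k (inc u i)"
      using vand_inc_wall[of i k u N] by (auto simp: mult.commute split: if_splits)
  qed
  also have "\<dots> = (\<Sum>u\<in>comps k N. wt k u * ?chi N u * (\<Sum>i<k. vand k (inc u i)))"
    by (subst sum.swap) (simp only: sum_distrib_left mult.assoc)
  also have "\<dots> = (\<Sum>u\<in>comps k N. wt k u * ?chi N u * (real k * vand k u))"
    by (simp only: vand_inc sum_vandermonde_increment)
  also have "\<dots> = real k * vsum2 k N"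
    unfolding vsum2_def sum_chamber sum_distrib_left
    by (intro sum.cong refl) (auto simp: power2_eq_square)
  finally show ?thesis .
qed

lemma vsum2_add: "vsum2 k (choose2 k + n) = real k ^ n / fact n * vsum2 k (choose2 k)"
proof (induction n)
  case (Suc n)
  have "real (Suc n) * vsum2 k (choose2 k + Suc n) = real k * vsum2 k (choose2 k + n)"
    using vsum2_Suc[of "choose2 k + n" k] by (simp add: algebra_simps)
  then have "vsum2 k (choose2 k + Suc n) = real k * vsum2 k (choose2 k + n) / real (Suc n)"
    by (metis nonzero_mult_div_cancel_left of_nat_neq_0)
  then show ?case using Suc by (simp add: mult_ac)
qed simp

lemma vsum2_pos: "vsum2 k (choose2 k) > 0"
proof -
  \<comment> \<open>The staircase 0, 1, ..., k - 1 has sum \<open>choose2 k\<close>, so the chamber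
    is nonempty at this level.\<close>
  define l where "l = (\<lambda>j. if j < k then j else 0)"
  have l: "l \<in> chamber k (choose2 k)"
    by (auto simp: l_def chamber_def comps_def choose2_def)
  have "0 < wt k l * vand k l ^ 2"
    using wt_pos vand_chamber_pos[OF l] by (intro mult_pos_pos) auto
  also have "\<dots> \<le> vsum2 k (choose2 k)"
    unfolding vsum2_def using l finite_chamber
    by (intro member_le_sum[of l _ "\<lambda>l. wt k l * vand k l ^ 2"]) (auto intro!: mult_nonneg_nonneg less_imp_le[OF wt_pos])
  finally show ?thesis .
qed

definition mass :: "nat \<Rightarrow> nat \<Rightarrow> real" where
  "mass k N = real k ^ N / fact N"

definition vsum :: "nat \<Rightarrow> nat \<Rightarrow> real" where
  "vsum k N = (\<Sum>l\<in>chamber k N. wt k l * vand k l)"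

lemma mass_pos: "k \<ge> 1 \<Longrightarrow> mass k N > 0"
  by (simp add: mass_def)

text \<open>The scale of the errors, smaller by \<open>sqrt N\<close> than the lower bound on
  \<open>vsum\<close>. A quotient is used instead of the exponent \<open>choose2 k - 1\<close>
  because \<open>choose2 1 = 0\<close>.\<close>

definition fluct :: "nat \<Rightarrow> nat \<Rightarrow> real" where
  "fluct k N = mass k N * (sqrt N ^ choose2 k / sqrt N)"

lemma mass_Suc: "mass k (Suc n) * real (Suc n) = real k * mass k n"
  by (simp add: mass_def del: of_nat_Suc)

lemma moment_mass:
  assumes "k \<ge> 1" "c \<ge> 0"
  shows "\<exists>K>0. \<forall>N\<ge>1. (\<Sum>l\<in>comps k N. wt k l * (dev k N l + c) ^ d) \<le> K * mass k N * sqrt N ^ d"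
  using moment_comps[OF assms, of d] by (simp add: mass_def)

lemma abs_vand_le: "\<bar>vand k l\<bar> \<le> dev k N l ^ choose2 k"
  by (intro abs_vandermonde_le abs_diff_le_dev) auto

lemma fact_add_ge: "real n ^ c * fact n \<le> fact (n + c)"
proof (induction c)
  case (Suc c)
  have "real n ^ Suc c * fact n = real n * (real n ^ c * fact n)" by simp
  also have "\<dots> \<le> real (Suc (n + c)) * fact (n + c)"
    using Suc by (intro mult_mono) auto
  finally show ?case by simp
qed simp

text \<open>By \<open>vsum2_add\<close> the moment is a constant times
  \<open>real k ^ n / fact n\<close> with \<open>n = N - choose2 k\<close>. For
  \<open>N \<ge> 2 * choose2 k\<close>, replacing \<open>1 / fact n\<close> by
  \<open>1 / fact N\<close> gains at least the factor \<open>(N / 2) ^ choose2 k\<close>.\<close>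

lemma vsum2_ge:
  assumes k: "k \<ge> 1"
  obtains c where "c > 0" "\<And>N. N \<ge> 2 * choose2 k \<Longrightarrow> vsum2 k N \<ge> c * mass k N * real N ^ choose2 k"
proof -
  let ?C = "choose2 k"
  define c where "c = vsum2 k ?C / (2 * real k) ^ ?C"
  show ?thesis
  proof (rule that[of c])
    show "c > 0" using k vsum2_pos[of k] by (simp add: c_def)
    fix N assume N: "N \<ge> 2 * ?C"
    define n where "n = N - ?C"
    have Nn: "N = ?C + n" "real N / 2 \<le> real n" using N by (auto simp: n_def of_nat_diff)
    have "(real N / 2) ^ ?C * fact n \<le> real n ^ ?C * fact n"
      using Nn by (intro mult_right_mono power_mono) auto
    also have "\<dots> \<le> fact N"
      using fact_add_ge[of n ?C] by (simp add: Nn add.commute)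
    finally have le: "(real N / 2) ^ ?C / fact N \<le> 1 / fact n"
      by (simp add: field_simps)
    have "c * mass k N * real N ^ ?C = vsum2 k ?C * real k ^ n * ((real N / 2) ^ ?C / fact N)"
    proof -
      have "real k ^ N = real k ^ ?C * real k ^ n" by (simp add: Nn(1) power_add)
      then show ?thesis
        using k by (simp add: c_def mass_def power_divide power_mult_distrib)
    qed
    also have "\<dots> \<le> vsum2 k ?C * real k ^ n * (1 / fact n)"
      using le vsum2_pos[of k] by (intro mult_left_mono) auto
    also have "\<dots> = vsum2 k N"
      using vsum2_add[of k n] by (simp add: Nn)
    finally show "vsum2 k N \<ge> c * mass k N * real N ^ ?C" .
  qed
qed

text \<open>Cauchy--Schwarz between the first and the third moment of the Vandermonde product bounds its
  first moment from below.\<close>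

lemma vsum_ge:
  assumes k: "k \<ge> 1"
  obtains c where "c > 0"
    "\<And>N. N \<ge> 1 \<Longrightarrow> N \<ge> 2 * choose2 k \<Longrightarrow> vsum k N \<ge> c * mass k N * sqrt N ^ choose2 k"
proof -
  let ?C = "choose2 k"
  obtain c where c: "c > 0" "\<And>N. N \<ge> 2 * ?C \<Longrightarrow> vsum2 k N \<ge> c * mass k N * real N ^ ?C"
    using vsum2_ge[OF k] by blast
  obtain K where K: "K > 0"
    "\<And>N. N \<ge> 1 \<Longrightarrow> (\<Sum>l\<in>comps k N. wt k l * (dev k N l + 0) ^ (3 * ?C)) \<le> K * mass k N * sqrt N ^ (3 * ?C)"
    using moment_mass[OF k order_refl, of "3 * ?C"] by blast
  show ?thesis
  \<comment> \<open>With \<open>m = mass k N\<close> and \<open>s = sqrt N ^ choose2 k\<close>, the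
    second moment is at least \<open>c * m * s\<^sup>2\<close> and the third at most
    \<open>K * m * s ^ 3\<close>; the square of the former divided by the latter is
    \<open>c\<^sup>2 / K * m * s\<close>.\<close>
  proof (rule that[of "c\<^sup>2 / K"])
    show "c\<^sup>2 / K > 0" using c K by simp
    fix N :: nat assume N: "N \<ge> 1" "N \<ge> 2 * ?C"
    let ?m = "mass k N" and ?s = "sqrt N ^ ?C"
    have s: "?s > 0" using N by simp
    have m: "?m > 0" using k by (rule mass_pos)
    have "(\<Sum>l\<in>chamber k N. wt k l * vand k l ^ 3) \<le> (\<Sum>l\<in>chamber k N. wt k l * (dev k N l + 0) ^ (3 * ?C))"
    proof (intro sum_mono mult_left_mono)
      fix l assume "l \<in> chamber k N"
      then have "vand k l ^ 3 \<le> (dev k N l ^ ?C) ^ 3"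
        using abs_vand_le[of k l N] vand_chamber_pos[of l k N] by (intro power_mono) auto
      then show "vand k l ^ 3 \<le> (dev k N l + 0) ^ (3 * ?C)"
        by (simp add: power_mult[symmetric] mult.commute)
    qed (simp add: less_imp_le[OF wt_pos])
    also have "\<dots> \<le> (\<Sum>l\<in>comps k N. wt k l * (dev k N l + 0) ^ (3 * ?C))"
      by (intro sum_mono2 finite_comps chamber_subset)
         (auto intro!: mult_nonneg_nonneg less_imp_le[OF wt_pos] zero_le_power dev_nonneg)
    also have "\<dots> \<le> K * ?m * ?s ^ 3"
      using K(2)[OF N(1)] by (simp add: power_mult[symmetric] mult.commute)
    finally have third: "(\<Sum>l\<in>chamber k N. wt k l * vand k l ^ 3) \<le> K * ?m * ?s ^ 3" .
    have vpos: "vsum k N \<ge> 0"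
      unfolding vsum_def by (intro sum_nonneg mult_nonneg_nonneg less_imp_le[OF wt_pos] less_imp_le[OF vand_chamber_pos])
    have "real N ^ ?C = ?s\<^sup>2"
      by (simp add: power_mult[symmetric] mult.commute[of _ 2] power_mult[of _ 2 "?C"])
    then have "c * ?m * ?s\<^sup>2 \<le> vsum2 k N"
      using c(2)[OF N(2)] by simp
    then have "(c * ?m * ?s\<^sup>2)\<^sup>2 \<le> (vsum2 k N)\<^sup>2"
      using c m s by (intro power_mono) auto
    also have "vsum2 k N = (\<Sum>l\<in>chamber k N. sqrt (wt k l * vand k l) * sqrt (wt k l * vand k l ^ 3))"
      unfolding vsum2_def
    proof (intro sum.cong refl)
      fix l assume "l \<in> chamber k N"
      then have "wt k l * vand k l \<ge> 0" "wt k l * vand k l ^ 2 \<ge> 0"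
        using wt_pos[of k l] vand_chamber_pos[of l k N] by auto
      moreover have "(wt k l * vand k l) * (wt k l * vand k l ^ 3) = (wt k l * vand k l ^ 2)\<^sup>2"
        by (simp add: power2_eq_square power3_eq_cube)
      ultimately show "wt k l * vand k l ^ 2 = sqrt (wt k l * vand k l) * sqrt (wt k l * vand k l ^ 3)"
        by (metis real_sqrt_mult real_sqrt_abs abs_of_nonneg)
    qed
    also have "(\<Sum>l\<in>chamber k N. sqrt (wt k l * vand k l) * sqrt (wt k l * vand k l ^ 3))\<^sup>2
        \<le> (\<Sum>l\<in>chamber k N. (sqrt (wt k l * vand k l))\<^sup>2) * (\<Sum>l\<in>chamber k N. (sqrt (wt k l * vand k l ^ 3))\<^sup>2)"
      by (rule Cauchy_Schwarz_ineq_sum)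
    also have "\<dots> = vsum k N * (\<Sum>l\<in>chamber k N. wt k l * vand k l ^ 3)"
      unfolding vsum_def
      by (intro arg_cong2[of _ _ _ _ "(*)"] sum.cong refl real_sqrt_pow2 mult_nonneg_nonneg zero_le_power
           less_imp_le[OF wt_pos] less_imp_le[OF vand_chamber_pos])
    also have "\<dots> \<le> vsum k N * (K * ?m * ?s ^ 3)"
      using third vpos by (rule mult_left_mono)
    finally have "(c\<^sup>2 / K * ?m * ?s) * (K * ?m * ?s ^ 3) \<le> vsum k N * (K * ?m * ?s ^ 3)"
      using K(1) by (simp add: power2_eq_square power3_eq_cube mult_ac)
    moreover have "K * ?m * ?s ^ 3 > 0"
      using K m s by simp
    ultimately show "vsum k N \<ge> c\<^sup>2 / K * ?m * ?s"
      by (simp only: mult_le_cancel_right_pos)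
  qed
qed

section \<open>Effect of moving one unit between two coordinates\<close>

lemma sum_inc_le:
  assumes "i < k" "\<And>l. f l \<ge> (0::real)"
  shows "(\<Sum>u\<in>comps k N. f (inc u i)) \<le> (\<Sum>l\<in>comps k (Suc N). f l)"
  unfolding sum_comps_reindex[OF assms(1)]
  by (intro sum_mono2) (auto simp: finite_comps assms)

text \<open>The weights differ by \<open>wt k u\<close> times a difference of reciprocals, whose
  common denominator leads to the weight two levels up. The remaining factor
  \<open>real (u a) - real (u b)\<close> is bounded by the deviation.\<close>

lemma wt_inc_diff:
  assumes "a < k" "b < k" "a \<noteq> b"
  shows "wt k (inc u b) - wt k (inc u a) = wt k (inc (inc u a) b) * (real (u a) - real (u b))"
proof -
  have *: "inc u a b = u b" using assms by (simp add: inc_def)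
  have "w / y - w / x = w / x / y * (x - y)" if "x > 0" "y > 0" for w x y :: real
    using that by (simp add: field_simps)
  from this[of "real (u a) + 1" "real (u b) + 1" "wt k u"] show ?thesis
    by (simp add: wt_inc assms *)
qed

text \<open>A product rule: in \<open>vand\<close> one factor is exchanged for a constant, and the
  change of \<open>wt\<close> is given by \<open>wt_inc_diff\<close>. Each part gains a factor of
  order \<open>sqrt N\<close> over the trivial bound.\<close>

lemma shift_variation_le:
  assumes k: "k \<ge> 1" and ab: "a < k" "b < k" "a \<noteq> b"
  obtains K where "K > 0" "\<And>M. (\<Sum>u\<in>comps k M. \<bar>wt k (inc u b) * vand k (inc u b) - wt k (inc u a) * vand k (inc u a)\<bar>)
     \<le> K * fluct k (Suc M)"
proof -
  let ?C = "choose2 k"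
  have C: "?C \<ge> 1"
  proof -
    have "1 \<in> {..<k}" using ab by auto
    then show ?thesis unfolding choose2_def using member_le_sum[of 1 "{..<k}" "\<lambda>i. i"] by auto
  qed
  \<comment> \<open>Differences of coordinates change by at most 2 between \<open>inc u b\<close>
    and \<open>inc u a\<close>, hence the shift 2. In the bound for the weights only the unit at
    \<open>b\<close> is taken away, hence the shift 1 there.\<close>
  obtain K1 where K1: "K1 > 0"
    "\<And>N. N \<ge> 1 \<Longrightarrow> (\<Sum>l\<in>comps k N. wt k l * (dev k N l + 2) ^ (?C - 1)) \<le> K1 * mass k N * sqrt N ^ (?C - 1)"
    using moment_mass[OF k zero_le_numeral, of _ "?C - 1"] by blast
  obtain K2 where K2: "K2 > 0"
    "\<And>N. N \<ge> 1 \<Longrightarrow> (\<Sum>l\<in>comps k N. wt k l * (dev k N l + 1) ^ (?C + 1)) \<le> K2 * mass k N * sqrt N ^ (?C + 1)"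
    using moment_mass[OF k zero_le_one, of "?C + 1"] by blast
  have first: "(\<Sum>u\<in>comps k M. wt k (inc u b) * \<bar>vand k (inc u b) - vand k (inc u a)\<bar>)
      \<le> real ?C * 2 * K1 * (mass k (Suc M) * sqrt (Suc M) ^ (?C - 1))" for M
  proof -
    have "(\<Sum>u\<in>comps k M. wt k (inc u b) * \<bar>vand k (inc u b) - vand k (inc u a)\<bar>)
        \<le> (\<Sum>u\<in>comps k M. wt k (inc u b) * (real ?C * 2 * (dev k (Suc M) (inc u b) + 2) ^ (?C - 1)))"
    proof (intro sum_mono mult_left_mono abs_vandermonde_diff_le)
      fix u i m assume im: "m < i" "i < k"
      have 1: "\<bar>real (inc u b j) - real (inc u a j)\<bar> \<le> 1" for j by (auto simp: inc_def)
      have 2: "\<bar>real (inc u b i) - real (inc u b m)\<bar> \<le> dev k (Suc M) (inc u b)"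
        using im by (intro abs_diff_le_dev) auto
      show "\<bar>real (inc u b i) - real (inc u b m)\<bar> \<le> dev k (Suc M) (inc u b) + 2"
        using 2 by simp
      show "\<bar>real (inc u a i) - real (inc u a m)\<bar> \<le> dev k (Suc M) (inc u b) + 2"
        using 2 1[of i] 1[of m] by linarith
      show "\<bar>real (inc u b i) - real (inc u b m) - (real (inc u a i) - real (inc u a m))\<bar> \<le> 2"
        using 1[of i] 1[of m] by linarith
    qed (auto intro!: less_imp_le[OF wt_pos] add_nonneg_nonneg dev_nonneg)
    also have "\<dots> \<le> (\<Sum>l\<in>comps k (Suc M). wt k l * (real ?C * 2 * (dev k (Suc M) l + 2) ^ (?C - 1)))"
      using ab by (intro sum_inc_le[where f = "\<lambda>l. wt k l * (real ?C * 2 * (dev k (Suc M) l + 2) ^ (?C - 1))"])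
        (auto intro!: mult_nonneg_nonneg less_imp_le[OF wt_pos] add_nonneg_nonneg dev_nonneg zero_le_power)
    also have "\<dots> = real ?C * 2 * (\<Sum>l\<in>comps k (Suc M). wt k l * (dev k (Suc M) l + 2) ^ (?C - 1))"
      by (simp add: sum_distrib_left mult_ac)
    also have "\<dots> \<le> real ?C * 2 * (K1 * mass k (Suc M) * sqrt (Suc M) ^ (?C - 1))"
      by (intro mult_left_mono K1) auto
    finally show ?thesis by (simp only: mult_ac)
  qed
  have second: "(\<Sum>u\<in>comps k M. \<bar>wt k (inc u b) - wt k (inc u a)\<bar> * \<bar>vand k (inc u a)\<bar>)
      \<le> K2 * k * sqrt 2 ^ (?C - 1) * (mass k (Suc M) * sqrt (Suc M) ^ (?C - 1))" for M
  proof -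
    define N where "N = Suc (Suc M)"
    have "(\<Sum>u\<in>comps k M. \<bar>wt k (inc u b) - wt k (inc u a)\<bar> * \<bar>vand k (inc u a)\<bar>)
        \<le> (\<Sum>u\<in>comps k M. wt k (inc (inc u a) b) * (dev k N (inc (inc u a) b) + 1) ^ (?C + 1))"
    proof (rule sum_mono)
      fix u
      let ?v = "inc (inc u a) b"
      have va: "?v a = Suc (u a)" "?v b = Suc (u b)" using ab by (auto simp: inc_def)
      have "\<bar>real (u a) - real (u b)\<bar> \<le> dev k N ?v"
        using abs_diff_le_dev[of a k b ?v N] ab va by simp
      moreover have "\<bar>vand k (inc u a)\<bar> \<le> (dev k N ?v + 1) ^ ?C"
      proof (rule abs_vandermonde_le)
        fix i m assume im: "m < i" "i < k"
        have "\<bar>real (?v i) - real (?v m)\<bar> \<le> dev k N ?v"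
          using im by (intro abs_diff_le_dev) auto
        moreover have "real (?v j) = real (inc u a j) + (if j = b then 1 else 0)" for j
          by (auto simp: inc_def)
        ultimately show "\<bar>real (inc u a i) - real (inc u a m)\<bar> \<le> dev k N ?v + 1"
          using im by (auto split: if_splits)
      qed
      ultimately have "\<bar>real (u a) - real (u b)\<bar> * \<bar>vand k (inc u a)\<bar> \<le> (dev k N ?v + 1) * (dev k N ?v + 1) ^ ?C"
        using dev_nonneg[of k N ?v] by (intro mult_mono) auto
      then have "wt k ?v * (\<bar>real (u a) - real (u b)\<bar> * \<bar>vand k (inc u a)\<bar>) \<le> wt k ?v * (dev k N ?v + 1) ^ (?C + 1)"
        using wt_pos[of k ?v] by (intro mult_left_mono) auto
      then show "\<bar>wt k (inc u b) - wt k (inc u a)\<bar> * \<bar>vand k (inc u a)\<bar> \<le> wt k ?v * (dev k N ?v + 1) ^ (?C + 1)"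
        using wt_pos[of k ?v] by (simp add: wt_inc_diff[OF ab] abs_mult mult.assoc)
    qed
    also have "\<dots> \<le> (\<Sum>l\<in>comps k (Suc M). wt k (inc l b) * (dev k N (inc l b) + 1) ^ (?C + 1))"
      using ab by (intro sum_inc_le[where f = "\<lambda>l. wt k (inc l b) * (dev k N (inc l b) + 1) ^ (?C + 1)"])
        (auto intro!: mult_nonneg_nonneg less_imp_le[OF wt_pos] add_nonneg_nonneg dev_nonneg zero_le_power)
    also have "\<dots> \<le> (\<Sum>l\<in>comps k N. wt k l * (dev k N l + 1) ^ (?C + 1))"
      unfolding N_def
      using ab by (intro sum_inc_le[where f = "\<lambda>l. wt k l * (dev k (Suc (Suc M)) l + 1) ^ (?C + 1)"])
        (auto intro!: mult_nonneg_nonneg less_imp_le[OF wt_pos] add_nonneg_nonneg dev_nonneg zero_le_power)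
    also have "\<dots> \<le> K2 * mass k N * sqrt N ^ (?C + 1)"
      by (intro K2) (simp add: N_def)
    \<comment> \<open>Two of the factors \<open>sqrt N\<close> form \<open>real N\<close>, which
      \<open>mass_Suc\<close> absorbs in stepping down from level \<open>N\<close> to
      \<open>Suc M\<close>.\<close>
    also have "?C + 1 = Suc (Suc (?C - 1))" using C by simp
    also have "K2 * mass k N * sqrt N ^ Suc (Suc (?C - 1)) = K2 * (mass k N * real N) * sqrt N ^ (?C - 1)"
      by simp
    also have "mass k N * real N = real k * mass k (Suc M)"
      by (simp only: mass_Suc N_def)
    \<comment> \<open>The \<open>sqrt 2\<close> comes from
      \<open>N = M + 2 \<le> 2 * Suc M\<close>.\<close>
    also have "K2 * (real k * mass k (Suc M)) * sqrt N ^ (?C - 1)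
        \<le> K2 * (real k * mass k (Suc M)) * (sqrt 2 * sqrt (Suc M)) ^ (?C - 1)"
      using K2(1) mass_pos[OF k, of "Suc M"]
      by (intro mult_left_mono power_mono) (auto simp: N_def simp flip: real_sqrt_mult)
    finally show ?thesis by (simp add: power_mult_distrib mult_ac)
  qed
  have fluct_eq: "mass k (Suc M) * sqrt (Suc M) ^ (?C - 1) = fluct k (Suc M)" for M
    using C by (cases ?C) (auto simp: fluct_def)
  show ?thesis
  proof (rule that[of "real ?C * 2 * K1 + K2 * k * sqrt 2 ^ (?C - 1)"])
    show "real ?C * 2 * K1 + K2 * k * sqrt 2 ^ (?C - 1) > 0"
      using K1 K2 k C by (intro add_pos_pos mult_pos_pos) auto
    fix M
    have "(\<Sum>u\<in>comps k M. \<bar>wt k (inc u b) * vand k (inc u b) - wt k (inc u a) * vand k (inc u a)\<bar>)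
        \<le> (\<Sum>u\<in>comps k M. wt k (inc u b) * \<bar>vand k (inc u b) - vand k (inc u a)\<bar>
            + \<bar>wt k (inc u b) - wt k (inc u a)\<bar> * \<bar>vand k (inc u a)\<bar>)"
    proof (rule sum_mono)
      fix u
      have "wt k (inc u b) * vand k (inc u b) - wt k (inc u a) * vand k (inc u a)
          = wt k (inc u b) * (vand k (inc u b) - vand k (inc u a)) + (wt k (inc u b) - wt k (inc u a)) * vand k (inc u a)"
        by (simp add: algebra_simps)
      then show "\<bar>wt k (inc u b) * vand k (inc u b) - wt k (inc u a) * vand k (inc u a)\<bar>
          \<le> wt k (inc u b) * \<bar>vand k (inc u b) - vand k (inc u a)\<bar> + \<bar>wt k (inc u b) - wt k (inc u a)\<bar> * \<bar>vand k (inc u a)\<bar>"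
        using wt_pos[of k "inc u b"] by (metis abs_mult abs_of_pos abs_triangle_ineq)
    qed
    also have "\<dots> \<le> real ?C * 2 * K1 * (mass k (Suc M) * sqrt (Suc M) ^ (?C - 1))
        + K2 * k * sqrt 2 ^ (?C - 1) * (mass k (Suc M) * sqrt (Suc M) ^ (?C - 1))"
      unfolding sum.distrib by (intro add_mono first second)
    finally show "(\<Sum>u\<in>comps k M. \<bar>wt k (inc u b) * vand k (inc u b) - wt k (inc u a) * vand k (inc u a)\<bar>)
     \<le> (real ?C * 2 * K1 + K2 * k * sqrt 2 ^ (?C - 1)) * fluct k (Suc M)"
      unfolding fluct_eq[symmetric] by (simp only: distrib_right)
  qed
qed

text \<open>An empty coordinate is a deviation of at least \<open>N / k\<close>. Inserting the
  factor \<open>dev k N l * (k / N) \<ge> 1\<close> raises the moment by one power, worth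
  \<open>sqrt N\<close>, and divides it by \<open>N\<close>.\<close>

lemma edge_le:
  assumes k: "k \<ge> 1" and a: "a < k"
  obtains K where "K > 0" "\<And>M. (\<Sum>l | l \<in> comps k (Suc M) \<and> l a = 0. wt k l * \<bar>vand k l\<bar>)
     \<le> K * fluct k (Suc M)"
proof -
  let ?C = "choose2 k"
  obtain K where K: "K > 0"
    "\<And>N. N \<ge> 1 \<Longrightarrow> (\<Sum>l\<in>comps k N. wt k l * (dev k N l + 0) ^ (?C + 1)) \<le> K * mass k N * sqrt N ^ (?C + 1)"
    using moment_mass[OF k order_refl, of "?C + 1"] by blast
  show ?thesis
  proof (rule that[of "K * k"])
    show "K * k > 0" using K k by simp
    fix M
    define N where "N = Suc M"
    have N: "N \<ge> 1" by (simp add: N_def)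
    have "(\<Sum>l | l \<in> comps k N \<and> l a = 0. wt k l * \<bar>vand k l\<bar>)
        \<le> (\<Sum>l | l \<in> comps k N \<and> l a = 0. wt k l * (dev k N l ^ (?C + 1) * (k / N)))"
    proof (intro sum_mono mult_left_mono)
      fix l assume l: "l \<in> {l. l \<in> comps k N \<and> l a = 0}"
      have "\<bar>real (l a) - real N / real k\<bar> \<le> dev k N l"
        unfolding dev_def using a by (intro member_le_sum[where f = "\<lambda>j. \<bar>real (l j) - real N / real k\<bar>"]) auto
      then have "real N / real k \<le> dev k N l" using l by simp
      then have "1 \<le> dev k N l * (k / N)"
        using k N by (simp add: field_simps)
      then have "dev k N l ^ ?C * 1 \<le> dev k N l ^ ?C * (dev k N l * (k / N))"
        by (intro mult_left_mono) (auto simp: dev_nonneg)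
      then show "\<bar>vand k l\<bar> \<le> dev k N l ^ (?C + 1) * (k / N)"
        using abs_vand_le[of k l N] by (simp add: mult_ac)
    qed (simp add: less_imp_le[OF wt_pos])
    also have "\<dots> \<le> (\<Sum>l\<in>comps k N. wt k l * (dev k N l ^ (?C + 1) * (k / N)))"
      by (intro sum_mono2 finite_comps)
         (auto intro!: mult_nonneg_nonneg less_imp_le[OF wt_pos] zero_le_power dev_nonneg divide_nonneg_nonneg)
    also have "\<dots> = (\<Sum>l\<in>comps k N. wt k l * (dev k N l + 0) ^ (?C + 1)) * (k / N)"
      by (simp only: sum_distrib_right add_0_right mult.assoc)
    also have "\<dots> \<le> K * mass k N * sqrt N ^ (?C + 1) * (k / N)"
      by (intro mult_right_mono K N) auto
    also have "\<dots> = K * k * fluct k N"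
    proof -
      have "sqrt N / N = 1 / sqrt N"
        using N by (simp add: real_div_sqrt field_simps)
      then have "sqrt N ^ (?C + 1) * (k / N) = k * (sqrt N ^ ?C / sqrt N)"
        by (simp add: mult.commute) (metis mult.assoc mult.commute times_divide_eq_right mult.right_neutral)
      then have "K * mass k N * (sqrt N ^ (?C + 1) * (k / N)) = K * mass k N * (k * (sqrt N ^ ?C / sqrt N))"
        by (rule arg_cong)
      then show ?thesis by (simp only: fluct_def mult_ac)
    qed
    finally show "(\<Sum>l | l \<in> comps k (Suc M) \<and> l a = 0. wt k l * \<bar>vand k l\<bar>)
     \<le> K * k * fluct k (Suc M)"
      by (simp add: N_def)
  qed
qed


section \<open>Equidistribution of parities\<close>

text \<open>When \<open>l\<close> comes from a shape, \<open>l j - j\<close> is a column length;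
  \<open>l j + j\<close> has the same parity and avoids truncated subtraction. The set thus marks
  the columns of odd length.\<close>

definition oddset :: "nat \<Rightarrow> (nat \<Rightarrow> nat) \<Rightarrow> nat set" where
  "oddset k l = {j. j < k \<and> odd (l j + j)}"

definition toggle :: "'a \<Rightarrow> 'a set \<Rightarrow> 'a set" where
  "toggle j E = (if j \<in> E then E - {j} else insert j E)"

definition class_sum :: "nat \<Rightarrow> nat \<Rightarrow> nat set \<Rightarrow> real" where
  "class_sum k N E = (\<Sum>l | l \<in> chamber k N \<and> oddset k l = E. wt k l * vand k l)"

lemma oddset_inc: "c < k \<Longrightarrow> oddset k (inc u c) = toggle c (oddset k u)"
  by (auto simp: oddset_def toggle_def inc_def)

lemma toggle_toggle: "toggle c (toggle c E) = E"
  by (auto simp: toggle_def)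

lemma toggle_commute: "toggle a (toggle b E) = toggle b (toggle a E)"
  by (auto simp: toggle_def)

text \<open>Compared with \<open>inc u c\<close>, the tuple \<open>inc u d\<close> has one unit less
  at \<open>c\<close> and one more at \<open>d\<close>. Every pair of positions other than
  \<open>d < c\<close> stays weakly ordered, so the product either vanishes on a wall or has a
  single nonpositive factor.\<close>

lemma vand_inc_nonpos:
  assumes cd: "c < k" "d < k" "c \<noteq> d" and u: "u \<in> comps k M"
    and c: "inc u c \<in> chamber k (Suc M)" and d: "inc u d \<notin> chamber k (Suc M)"
  shows "vand k (inc u d) \<le> 0"
proof (cases "d < c \<and> inc u d c \<le> inc u d d")
  case True
  then show ?thesis
  proof (intro vandermonde_le_0[of c k d])
    fix i m :: nat assume "m < i" "i < k" "(i, m) \<noteq> (c, d)"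
    moreover from this have "inc u c m < inc u c i"
      using c by (auto simp: chamber_def)
    ultimately show "real (inc u d m) \<le> real (inc u d i)"
      by (auto simp: inc_def split: if_splits)
  qed (use cd in auto)
next
  case False
  have "vand k (inc u d) = 0"
  proof (rule vand_weak_chamber[OF inc_in_comps[OF cd(2) u] d])
    fix i m :: nat assume "m < i" "i < k"
    moreover from this have "inc u c m < inc u c i"
      using c by (auto simp: chamber_def)
    ultimately show "inc u d m \<le> inc u d i"
      using False by (auto simp: inc_def split: if_splits)
  qed
  then show ?thesis by simp
qed

text \<open>The parity sets of \<open>inc u a\<close> and \<open>inc u b\<close> differ by toggling
  \<open>a\<close> and \<open>b\<close>, so the two class sums are compared term by term along
  \<open>u\<close>. Left over are the tuples with \<open>l a = 0\<close>, bounded by the last sum,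
  and those with \<open>l b = 0\<close>, which lie outside the chamber.\<close>

lemma class_sum_toggle_le:
  assumes ab: "a < b" "b < k"
  shows "\<bar>class_sum k (Suc M) E - class_sum k (Suc M) (toggle a (toggle b E))\<bar>
    \<le> (\<Sum>u\<in>comps k M. \<bar>wt k (inc u b) * vand k (inc u b) - wt k (inc u a) * vand k (inc u a)\<bar>)
      + (\<Sum>l | l \<in> comps k (Suc M) \<and> l a = 0. wt k l * \<bar>vand k l\<bar>)"
proof -
  define E' where "E' = toggle a (toggle b E)"
  define g where "g = (\<lambda>F l. if l \<in> chamber k (Suc M) \<and> oddset k l = F then wt k l * vand k l else 0)"
  have cs: "class_sum k (Suc M) F = (\<Sum>l\<in>comps k (Suc M). g F l)" for F
  proof -
    have "{l. l \<in> chamber k (Suc M) \<and> oddset k l = F}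
        = {l \<in> comps k (Suc M). l \<in> chamber k (Suc M) \<and> oddset k l = F}"
      using chamber_subset by auto
    then show ?thesis
      unfolding class_sum_def g_def by (simp only: sum.inter_filter[OF finite_comps])
  qed
  have split: "(\<Sum>l\<in>comps k (Suc M). g F l) = (\<Sum>u\<in>comps k M. g F (inc u c)) + (\<Sum>l | l \<in> comps k (Suc M) \<and> l c = 0. g F l)"
    if "c < k" for F c
  proof -
    have "comps k (Suc M) = {l \<in> comps k (Suc M). l c \<noteq> 0} \<union> {l \<in> comps k (Suc M). l c = 0}" by auto
    then have "(\<Sum>l\<in>comps k (Suc M). g F l)
        = (\<Sum>l\<in>{l \<in> comps k (Suc M). l c \<noteq> 0}. g F l) + (\<Sum>l\<in>{l \<in> comps k (Suc M). l c = 0}. g F l)"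
      using finite_comps[of k "Suc M"] by (subst sum.union_disjoint[symmetric]) auto
    then show ?thesis using sum_comps_reindex[OF that, of "g F" M] by simp
  qed
  \<comment> \<open>In the chamber \<open>a < b\<close> forces \<open>l a < l b\<close>, so
    coordinate \<open>b\<close> is never empty there.\<close>
  have b0: "(\<Sum>l | l \<in> comps k (Suc M) \<and> l b = 0. g E' l) = 0"
  proof (rule sum.neutral, rule ballI)
    fix l assume "l \<in> {l. l \<in> comps k (Suc M) \<and> l b = 0}"
    then have "l b = 0" by simp
    then have "l \<notin> chamber k (Suc M)"
      using ab unfolding chamber_def by (metis (mono_tags, lifting) mem_Collect_eq not_less0)
    then show "g E' l = 0" by (simp add: g_def)
  qed
  \<comment> \<open>Where only one of the two tuples lies in the chamber, the product at the other
    is nonpositive by \<open>vand_inc_nonpos\<close>, and replacing it by 0 reduces the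
    difference.\<close>
  have step: "\<bar>g E (inc u a) - g E' (inc u b)\<bar> \<le> \<bar>wt k (inc u b) * vand k (inc u b) - wt k (inc u a) * vand k (inc u a)\<bar>"
    if u: "u \<in> comps k M" for u
  proof -
    have "oddset k (inc u a) = E \<longleftrightarrow> oddset k (inc u b) = E'"
    proof -
      define O' where "O' = oddset k u"
      have o: "oddset k (inc u a) = toggle a O'" "oddset k (inc u b) = toggle b O'"
        using ab by (auto simp: oddset_inc O'_def)
      note [simp] = toggle_toggle toggle_commute[of b a]
      have "toggle b O' = E'" if "toggle a O' = E"
        unfolding E'_def that[symmetric] by simp
      moreover have "toggle a O' = E" if "toggle b O' = E'"
      proof -
        have "toggle a (toggle b (toggle b O')) = E"
          unfolding that E'_def by simp
        then show ?thesis by simp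
      qed
      ultimately show ?thesis unfolding o by blast
    qed
    moreover have "vand k (inc u a) > 0 \<and> wt k (inc u a) > 0" if "inc u a \<in> chamber k (Suc M)"
      using vand_chamber_pos[OF that] wt_pos by auto
    moreover have "vand k (inc u b) > 0 \<and> wt k (inc u b) > 0" if "inc u b \<in> chamber k (Suc M)"
      using vand_chamber_pos[OF that] wt_pos by auto
    moreover have "wt k (inc u b) * vand k (inc u b) \<le> 0" if "inc u a \<in> chamber k (Suc M)" "inc u b \<notin> chamber k (Suc M)"
      using vand_inc_nonpos[OF _ _ _ u that] ab wt_pos[of k "inc u b"] by (auto intro: mult_nonneg_nonpos)
    moreover have "wt k (inc u a) * vand k (inc u a) \<le> 0" if "inc u b \<in> chamber k (Suc M)" "inc u a \<notin> chamber k (Suc M)"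
      using vand_inc_nonpos[OF _ _ _ u that] ab wt_pos[of k "inc u a"] by (auto intro: mult_nonneg_nonpos)
    moreover have "wt k (inc u a) * vand k (inc u a) \<ge> 0" if "inc u a \<in> chamber k (Suc M)"
      using vand_chamber_pos[OF that] wt_pos[of k "inc u a"] by auto
    moreover have "wt k (inc u b) * vand k (inc u b) \<ge> 0" if "inc u b \<in> chamber k (Suc M)"
      using vand_chamber_pos[OF that] wt_pos[of k "inc u b"] by auto
    ultimately show ?thesis
      unfolding g_def
      by (cases "inc u a \<in> chamber k (Suc M)"; cases "inc u b \<in> chamber k (Suc M)"; cases "oddset k (inc u a) = E") auto
  qed
  have "\<bar>class_sum k (Suc M) E - class_sum k (Suc M) E'\<bar>
      = \<bar>(\<Sum>u\<in>comps k M. g E (inc u a) - g E' (inc u b)) + (\<Sum>l | l \<in> comps k (Suc M) \<and> l a = 0. g E l)\<bar>"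
    using split[of a E] split[of b E'] b0 ab by (simp add: cs sum_subtractf)
  also have "\<dots> \<le> (\<Sum>u\<in>comps k M. \<bar>g E (inc u a) - g E' (inc u b)\<bar>) + (\<Sum>l | l \<in> comps k (Suc M) \<and> l a = 0. \<bar>g E l\<bar>)"
    by (intro order_trans[OF abs_triangle_ineq] add_mono sum_abs)
  also have "\<dots> \<le> (\<Sum>u\<in>comps k M. \<bar>wt k (inc u b) * vand k (inc u b) - wt k (inc u a) * vand k (inc u a)\<bar>)
      + (\<Sum>l | l \<in> comps k (Suc M) \<and> l a = 0. wt k l * \<bar>vand k l\<bar>)"
  proof (rule add_mono)
    show "(\<Sum>u\<in>comps k M. \<bar>g E (inc u a) - g E' (inc u b)\<bar>)
        \<le> (\<Sum>u\<in>comps k M. \<bar>wt k (inc u b) * vand k (inc u b) - wt k (inc u a) * vand k (inc u a)\<bar>)"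
      by (rule sum_mono) (rule step)
    have "\<bar>g E l\<bar> \<le> wt k l * \<bar>vand k l\<bar>" for l
      using wt_pos[of k l] by (simp add: g_def abs_mult)
    then show "(\<Sum>l | l \<in> comps k (Suc M) \<and> l a = 0. \<bar>g E l\<bar>)
        \<le> (\<Sum>l | l \<in> comps k (Suc M) \<and> l a = 0. wt k l * \<bar>vand k l\<bar>)"
      by (rule sum_mono)
  qed
  finally show ?thesis by (simp add: E'_def)
qed

lemma class_sum_toggle_bound:
  assumes k: "k \<ge> 1"
  obtains K where "K > 0"
    "\<And>a b N E. a < b \<Longrightarrow> b < k \<Longrightarrow> N \<ge> 1 \<Longrightarrow>
       \<bar>class_sum k N E - class_sum k N (toggle a (toggle b E))\<bar> \<le> K * fluct k N"
proof -
  let ?pr = "\<lambda>p K. fst p < snd p \<longrightarrow> snd p < k \<longrightarrow>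
    (\<forall>N E. N \<ge> 1 \<longrightarrow> \<bar>class_sum k N E - class_sum k N (toggle (fst p) (toggle (snd p) E))\<bar> \<le> K * fluct k N)"
  have "\<exists>K>0. ?pr p K" for p
  proof (cases "fst p < snd p \<and> snd p < k")
    case True
    define a b where "a = fst p" and "b = snd p"
    have ab: "a < b" "b < k" using True by (auto simp: a_def b_def)
    obtain K1 where K1: "K1 > 0" "\<And>M. (\<Sum>u\<in>comps k M. \<bar>wt k (inc u b) * vand k (inc u b) - wt k (inc u a) * vand k (inc u a)\<bar>)
     \<le> K1 * fluct k (Suc M)"
      using shift_variation_le[OF k, of a b] ab by auto
    obtain K2 where K2: "K2 > 0" "\<And>M. (\<Sum>l | l \<in> comps k (Suc M) \<and> l a = 0. wt k l * \<bar>vand k l\<bar>)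
     \<le> K2 * fluct k (Suc M)"
      using edge_le[OF k, of a] ab by auto
    have "?pr p (K1 + K2)"
    proof (intro impI allI)
      fix N :: nat and E assume "N \<ge> 1"
      then obtain M where N: "N = Suc M" by (cases N) auto
      show "\<bar>class_sum k N E - class_sum k N (toggle (fst p) (toggle (snd p) E))\<bar> \<le> (K1 + K2) * fluct k N"
        using class_sum_toggle_le[OF ab, of M E] K1(2)[of M] K2(2)[of M]
        unfolding N a_def[symmetric] b_def[symmetric] distrib_right by linarith
    qed
    then show ?thesis using K1 K2 by (intro exI[of _ "K1 + K2"]) auto
  next
    case False
    then show ?thesis by (intro exI[of _ 1]) auto
  qed
  then obtain K where K: "\<And>p. K p > 0" "\<And>p. ?pr p (K p)" by metis
  define L where "L = 1 + (\<Sum>p\<in>{..<k} \<times> {..<k}. K p)"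
  show ?thesis
  proof (rule that[of L])
    show "L > 0" unfolding L_def using K(1) by (intro add_pos_nonneg sum_nonneg) (auto simp: less_imp_le)
    fix a b N E assume ab: "a < b" "b < k" "N \<ge> (1::nat)"
    have "K (a, b) \<le> (\<Sum>p\<in>{..<k} \<times> {..<k}. K p)"
      using ab K(1) by (intro member_le_sum) (auto simp: less_imp_le)
    then have "K (a, b) * fluct k N \<le> L * fluct k N"
      using mass_pos[OF k, of N] unfolding L_def fluct_def by (intro mult_right_mono) auto
    then show "\<bar>class_sum k N E - class_sum k N (toggle a (toggle b E))\<bar> \<le> L * fluct k N"
      using K(2)[of "(a, b)"] ab by (auto intro: order_trans)
  qed
qed

text \<open>The parity hypothesis makes the cardinality of the symmetric difference even, so it can
  be exhausted by toggling two of its elements at a time, each time at cost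
  \<open>B\<close>.\<close>

lemma class_sum_diff_bound:
  assumes step: "\<And>a b E. a < b \<Longrightarrow> b < k \<Longrightarrow> \<bar>class_sum k N E - class_sum k N (toggle a (toggle b E))\<bar> \<le> B"
    and "E \<subseteq> {..<k}" "F \<subseteq> {..<k}" "even (card E + card F)"
  shows "\<bar>class_sum k N E - class_sum k N F\<bar> \<le> real (card (sym_diff E F)) * B"
  using assms(2-4)
proof (induction "card (sym_diff E F)" arbitrary: E rule: less_induct)
  case less
  have fin: "finite E" "finite F" "finite (sym_diff E F)"
    using less.prems by (auto intro: finite_subset)
  have par: "even (card (sym_diff E F))"
  proof -
    have "card E = card (E - F) + card (E \<inter> F)" "card F = card (F - E) + card (E \<inter> F)"
      using fin by (metis Diff_disjoint Int_Diff_Un Int_commute card_Un_disjoint finite_Diff finite_Int Int_Diff_disjoint Un_commute add.commute)+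
    moreover have "card (sym_diff E F) = card (E - F) + card (F - E)"
      using fin by (intro card_Un_disjoint) auto
    ultimately show ?thesis using less.prems(3) by presburger
  qed
  show ?case
  proof (cases "sym_diff E F = {}")
    case True
    then have "E = F" by auto
    then show ?thesis by simp
  next
    case False
    then have "card (sym_diff E F) \<noteq> 0" using fin by auto
    then have "card (sym_diff E F) > 1" using par by presburger
    then obtain a b where "a \<in> sym_diff E F" "b \<in> sym_diff E F" "a \<noteq> b"
      using card_le_Suc0_iff_eq[OF fin(3)] by (auto simp: not_le[symmetric])
    then obtain a b where ab: "a \<in> sym_diff E F" "b \<in> sym_diff E F" "a < b"
      by (metis linorder_neqE_nat)
    define E' where "E' = toggle a (toggle b E)"
    have sd: "sym_diff E' F = sym_diff E F - {a, b}"
      using ab unfolding E'_def toggle_def by auto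
    have c: "card (sym_diff E' F) + 2 = card (sym_diff E F)"
    proof -
      have "card {a, b} \<le> card (sym_diff E F)" using ab fin by (intro card_mono) auto
      then show ?thesis unfolding sd using ab fin by (subst card_Diff_subset) auto
    qed
    have E': "E' \<subseteq> {..<k}" using less.prems ab unfolding E'_def toggle_def by auto
    have tp: "odd (card (toggle x G) + card G)" if "finite G" for x :: nat and G
      using that by (cases "x \<in> G") (auto simp: toggle_def card_Diff_singleton_if card_gt_0_iff)
    have "finite (toggle b E)" using fin by (auto simp: toggle_def)
    then have "even (card E' + card F)"
      using tp[OF fin(1), of b] tp[of "toggle b E" a] less.prems(3) unfolding E'_def even_add by blast
    then have IH: "\<bar>class_sum k N E' - class_sum k N F\<bar> \<le> real (card (sym_diff E' F)) * B"
      using less.hyps[of E'] c E' less.prems by auto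
    have 1: "\<bar>class_sum k N E - class_sum k N E'\<bar> \<le> B"
      unfolding E'_def using ab less.prems by (intro step) auto
    then have "B \<ge> 0" by linarith
    then show ?thesis using IH 1 unfolding c[symmetric] by (simp add: algebra_simps)
  qed
qed

section \<open>Averaging over the parity classes\<close>

definition odd_sum :: "nat \<Rightarrow> nat \<Rightarrow> nat \<Rightarrow> real" where
  "odd_sum k N i = (\<Sum>l | l \<in> chamber k N \<and> card (oddset k l) = i. wt k l * vand k l)"

text \<open>The numbers \<open>l j + j\<close> sum to \<open>N + choose2 k\<close>, and the parity
  of a sum is that of the number of its odd terms.\<close>

lemma even_card_oddset: "l \<in> chamber k N \<Longrightarrow> even (card (oddset k l)) \<longleftrightarrow> even (N + choose2 k)"
proof -
  assume l: "l \<in> chamber k N"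
  have "even (\<Sum>j<k. l j + j) \<longleftrightarrow> even (card {j \<in> {..<k}. odd (l j + j)})"
    by (rule even_sum_iff) simp
  also have "{j \<in> {..<k}. odd (l j + j)} = oddset k l"
    by (auto simp: oddset_def)
  finally show ?thesis
    using l by (simp add: chamber_def comps_def sum.distrib choose2_def)
qed

lemma sum_over_oddset:
  "(\<Sum>l | l \<in> chamber k N \<and> P (oddset k l). f l)
     = (\<Sum>E | E \<subseteq> {..<k} \<and> P E. \<Sum>l | l \<in> chamber k N \<and> oddset k l = E. f l)"
proof -
  have "(\<Sum>l | l \<in> chamber k N \<and> P (oddset k l). f l)
      = (\<Sum>E | E \<subseteq> {..<k} \<and> P E. \<Sum>l\<in>{l \<in> {l. l \<in> chamber k N \<and> P (oddset k l)}. oddset k l = E}. f l)"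
    by (rule sum.group[symmetric]) (auto simp: finite_chamber oddset_def intro: finite_subset[of _ "Pow {..<k}"])
  also have "\<dots> = (\<Sum>E | E \<subseteq> {..<k} \<and> P E. \<Sum>l | l \<in> chamber k N \<and> oddset k l = E. f l)"
    by (intro sum.cong) auto
  finally show ?thesis .
qed

lemma odd_sum_eq: "odd_sum k N i = (\<Sum>E | E \<subseteq> {..<k} \<and> card E = i. class_sum k N E)"
  unfolding odd_sum_def class_sum_def by (rule sum_over_oddset)

lemma vsum_eq: "vsum k N = (\<Sum>E | E \<subseteq> {..<k} \<and> even (card E + (N + choose2 k)). class_sum k N E)"
proof -
  have "{l. l \<in> chamber k N \<and> even (card (oddset k l) + (N + choose2 k))} = chamber k N"
    by (auto simp: even_card_oddset)
  then show ?thesis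
    unfolding vsum_def class_sum_def using sum_over_oddset[where k = k and N = N and P = "\<lambda>E. even (card E + (N + choose2 k))"] by simp
qed

lemma odd_sum_eq_0: "odd (i + (N + choose2 k)) \<Longrightarrow> odd_sum k N i = 0"
proof -
  assume "odd (i + (N + choose2 k))"
  then have "{l. l \<in> chamber k N \<and> card (oddset k l) = i} = {}"
    by (auto simp: even_card_oddset)
  then show ?thesis by (simp only: odd_sum_def) simp
qed

text \<open>Grouped by cardinality, this is a sum of binomial coefficients over indices of one
  parity, which is half of \<open>2 ^ k\<close>.\<close>

lemma card_parity_subsets:
  assumes "k \<ge> 1"
  shows "card {E. E \<subseteq> {..<k} \<and> even (card E + m)} = 2 ^ (k - 1)"
proof -
  have "card {E. E \<subseteq> {..<k} \<and> even (card E + m)} = (\<Sum>E | E \<subseteq> {..<k} \<and> even (card E + m). 1)" by simp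
  also have "\<dots> = (\<Sum>i\<le>k. \<Sum>E\<in>{E \<in> {E. E \<subseteq> {..<k} \<and> even (card E + m)}. card E = i}. 1)"
    by (rule sum.group[symmetric])
       (auto intro: finite_subset[of _ "Pow {..<k}"] dest: card_mono[rotated])
  also have "\<dots> = (\<Sum>i\<le>k. if even (i + m) then k choose i else 0)"
  proof (rule sum.cong[OF refl])
    fix i
    have "{E \<in> {E. E \<subseteq> {..<k} \<and> even (card E + m)}. card E = i}
        = (if even (i + m) then {E. E \<subseteq> {..<k} \<and> card E = i} else {})" by auto
    then show "(\<Sum>E\<in>{E \<in> {E. E \<subseteq> {..<k} \<and> even (card E + m)}. card E = i}. 1) = (if even (i + m) then k choose i else 0)"
      using n_subsets[of "{..<k}" i] by simp
  qed
  finally have *: "card {E. E \<subseteq> {..<k} \<and> even (card E + m)} = (\<Sum>i\<le>k. if even (i + m) then k choose i else 0)" .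
  have "2 * (\<Sum>i\<le>k. if even (i + m) then real (k choose i) else 0) = 2 ^ k"
    using choose_even_sum[of k] choose_odd_sum[of k] assms by (cases "even m") auto
  also have "\<dots> = 2 * 2 ^ (k - 1)" using assms by (cases k) auto
  finally have "real (\<Sum>i\<le>k. if even (i + m) then k choose i else 0) = real (2 ^ (k - 1))"
    unfolding of_nat_sum by (simp add: if_distrib[of real] cong: if_cong)
  then show ?thesis unfolding * by (simp only: of_nat_eq_iff)
qed

text \<open>\<open>vsum\<close> is a sum of \<open>2 ^ (k - 1)\<close> class sums that differ
  pairwise by at most a multiple of \<open>fluct k N\<close>, so each is close to their average;
  \<open>odd_sum\<close> collects \<open>k choose i\<close> of them.\<close>

lemma odd_sum_ratio:
  assumes k: "k \<ge> 1"
  shows "\<exists>K\<ge>0. \<exists>N0. \<forall>N\<ge>N0. \<forall>i. even (i + (N + choose2 k)) \<longrightarrow>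
       \<bar>odd_sum k N i / vsum k N - real (k choose i) / 2 ^ (k - 1)\<bar> \<le> K / sqrt N"
proof -
  obtain c where c: "c > 0"
    "\<And>N. N \<ge> 1 \<Longrightarrow> N \<ge> 2 * choose2 k \<Longrightarrow> vsum k N \<ge> c * mass k N * sqrt N ^ choose2 k"
    using vsum_ge[OF k] by blast
  obtain B where B: "B > 0"
    "\<And>a b N E. a < b \<Longrightarrow> b < k \<Longrightarrow> N \<ge> 1 \<Longrightarrow>
       \<bar>class_sum k N E - class_sum k N (toggle a (toggle b E))\<bar> \<le> B * fluct k N"
    using class_sum_toggle_bound[OF k] by blast
  define N0 where "N0 = max 1 (2 * choose2 k)"
  have vpos: "vsum k N > 0" if "N \<ge> N0" for N
  proof -
    have "0 < c * mass k N * sqrt N ^ choose2 k"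
      using c(1) mass_pos[OF k, of N] that by (auto simp: N0_def intro!: mult_pos_pos)
    also have "\<dots> \<le> vsum k N" using that by (intro c) (auto simp: N0_def)
    finally show ?thesis .
  qed
  \<comment> \<open>\<open>k\<close> bounds the size of a symmetric difference, \<open>B\<close> the
    cost of two toggles, and \<open>c\<close> comes from the lower bound on
    \<open>vsum\<close>.\<close>
  define K1 where "K1 = real k * B / c"
  have one: "\<bar>class_sum k N E / vsum k N - 1 / 2 ^ (k - 1)\<bar> \<le> K1 / sqrt N"
    if N: "N \<ge> N0" and E: "E \<subseteq> {..<k}" "even (card E + (N + choose2 k))" for N E
  proof -
    let ?F = "{F. F \<subseteq> {..<k} \<and> even (card F + (N + choose2 k))}"
    have N1: "N \<ge> 1" "N \<ge> 2 * choose2 k" using N by (auto simp: N0_def)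
    have sc: "fluct k N \<ge> 0" using mass_pos[OF k, of N] by (auto simp: fluct_def)
    have d: "\<bar>class_sum k N E - class_sum k N F\<bar> \<le> real k * (B * fluct k N)" if "F \<in> ?F" for F
    proof -
      have "\<bar>class_sum k N E - class_sum k N F\<bar> \<le> real (card (sym_diff E F)) * (B * fluct k N)"
      proof (rule class_sum_diff_bound)
        show "even (card E + card F)" using that E by auto
      qed (use that E B(2)[OF _ _ N1(1)] in auto)
      also have "\<dots> \<le> real k * (B * fluct k N)"
      proof -
        have "card (sym_diff E F) \<le> card {..<k}" using that E by (intro card_mono) auto
        then show ?thesis using sc B(1) by (intro mult_right_mono) auto
      qed
      finally show ?thesis .
    qed
    have cF: "real (card ?F) = 2 ^ (k - 1)"
      by (simp only: card_parity_subsets[OF k]) simp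
    have "2 ^ (k - 1) * class_sum k N E - vsum k N = (\<Sum>F\<in>?F. class_sum k N E - class_sum k N F)"
      unfolding vsum_eq sum_subtractf by (simp only: sum_constant cF)
    also have "\<bar>\<dots>\<bar> \<le> (\<Sum>F\<in>?F. real k * (B * fluct k N))"
      by (intro order_trans[OF sum_abs] sum_mono d)
    also have "\<dots> = 2 ^ (k - 1) * (real k * (B * fluct k N))"
      by (simp only: sum_constant cF)
    finally have D: "\<bar>2 ^ (k - 1) * class_sum k N E - vsum k N\<bar> \<le> 2 ^ (k - 1) * (real k * (B * fluct k N))" .
    have "\<bar>class_sum k N E / vsum k N - 1 / 2 ^ (k - 1)\<bar>
        = \<bar>2 ^ (k - 1) * class_sum k N E - vsum k N\<bar> / (2 ^ (k - 1) * vsum k N)"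
    proof -
      have "class_sum k N E / vsum k N - 1 / 2 ^ (k - 1) = (2 ^ (k - 1) * class_sum k N E - vsum k N) / (2 ^ (k - 1) * vsum k N)"
        using vpos[OF N] by (simp add: diff_divide_distrib)
      then show ?thesis using vpos[OF N] by (simp add: abs_mult)
    qed
    also have "\<dots> \<le> 2 ^ (k - 1) * (real k * (B * fluct k N)) / (2 ^ (k - 1) * vsum k N)"
      using D vpos[OF N] by (intro divide_right_mono) auto
    also have "\<dots> = real k * B * fluct k N / vsum k N" by simp
    also have "\<dots> \<le> K1 / sqrt N"
    proof -
      have "real k * B * fluct k N * sqrt N = real k * B / c * (c * mass k N * sqrt N ^ choose2 k)"
        using c(1) N1 by (simp add: fluct_def)
      also have "\<dots> \<le> real k * B / c * vsum k N"
        using k B(1) c(1) by (intro mult_left_mono c(2) N1) auto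
      finally have "real k * B * fluct k N * sqrt N \<le> K1 * vsum k N"
        by (simp only: K1_def)
      moreover have "x / v \<le> y / s" if "x * s \<le> y * v" "v > 0" "s > 0" for x y v s :: real
        using that by (simp add: field_simps)
      ultimately show ?thesis
        using vpos[OF N] N1 by simp
    qed
    finally show ?thesis .
  qed
  show ?thesis
  \<comment> \<open>\<open>2 ^ k\<close> bounds every \<open>k choose i\<close>, so the constant
    does not depend on \<open>i\<close>.\<close>
  proof (intro exI[of _ "2 ^ k * K1"] conjI exI[of _ N0] allI impI)
    show "2 ^ k * K1 \<ge> 0" using B(1) c(1) by (simp add: K1_def)
    fix N i assume N: "N \<ge> N0" and i: "even (i + (N + choose2 k))"
    let ?S = "{E. E \<subseteq> {..<k} \<and> card E = i}"
    have cS: "card ?S = k choose i" using n_subsets[of "{..<k}" i] by simp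
    have "odd_sum k N i / vsum k N - real (k choose i) / 2 ^ (k - 1) = (\<Sum>E\<in>?S. class_sum k N E / vsum k N - 1 / 2 ^ (k - 1))"
      by (simp add: odd_sum_eq sum_divide_distrib sum_subtractf cS)
    also have "\<bar>\<dots>\<bar> \<le> (\<Sum>E\<in>?S. K1 / sqrt N)"
      using N i by (intro order_trans[OF sum_abs] sum_mono one) auto
    also have "\<dots> = real (k choose i) * (K1 / sqrt N)" by (simp add: cS)
    also have "\<dots> \<le> 2 ^ k * (K1 / sqrt N)"
    proof (rule mult_right_mono)
      have "card ?S \<le> card (Pow {..<k})" by (intro card_mono) auto
      then have "k choose i \<le> 2 ^ k" by (simp add: cS card_Pow)
      then show "real (k choose i) \<le> 2 ^ k" by (metis of_nat_le_iff of_nat_numeral of_nat_power)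
      show "0 \<le> K1 / sqrt N" using B(1) c(1) by (simp add: K1_def)
    qed
    finally show "\<bar>odd_sum k N i / vsum k N - real (k choose i) / 2 ^ (k - 1)\<bar> \<le> 2 ^ k * K1 / sqrt N" by simp
  qed
qed


section \<open>Fomin's growth diagrams\<close>

text \<open>A partition, given by its row lengths with rows numbered from 0.\<close>

definition shape :: "(nat \<Rightarrow> nat) \<Rightarrow> bool" where
  "shape f \<longleftrightarrow> (\<forall>r. f (Suc r) \<le> f r) \<and> finite {r. f r \<noteq> 0}"

definition step :: "(nat \<Rightarrow> nat) \<Rightarrow> (nat \<Rightarrow> nat) \<Rightarrow> bool" where
  "step f g \<longleftrightarrow> f = g \<or> (\<exists>r. g = inc f r)"

text \<open>General row weights \<open>h\<close> cover the size and the alternating sum at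
  once.\<close>

definition wsum :: "(nat \<Rightarrow> int) \<Rightarrow> (nat \<Rightarrow> nat) \<Rightarrow> int" where
  "wsum h f = (\<Sum>r | f r \<noteq> 0. h r * int (f r))"

abbreviation size_shape :: "(nat \<Rightarrow> nat) \<Rightarrow> int" where
  "size_shape \<equiv> wsum (\<lambda>_. 1)"

text \<open>The alternating sum of the row lengths is the number of columns of odd length.\<close>

abbreviation alt_shape :: "(nat \<Rightarrow> nat) \<Rightarrow> int" where
  "alt_shape \<equiv> wsum (\<lambda>r. (- 1) ^ r)"

lemma inc_apply: "inc f r s = (if s = r then Suc (f r) else f s)"
  by (simp add: inc_def)

lemma inc_neq: "inc f r \<noteq> f" "f \<noteq> inc f r"
  by (metis inc_apply n_not_Suc_n)+

lemma inc_right_inj: "inc f r = inc f s \<longleftrightarrow> r = s"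
  by (metis inc_apply n_not_Suc_n)

lemma inc_left_inj: "inc f r = inc g r \<longleftrightarrow> f = g"
  using inj_inc[of r UNIV] by (auto dest: injD)

lemma shape_0: "shape (\<lambda>_. 0)"
  by (simp add: shape_def)

lemma finite_support_inc: "finite {r. f r \<noteq> 0} \<Longrightarrow> finite {s. inc f r s \<noteq> 0}"
  by (rule finite_subset[of _ "insert r {r. f r \<noteq> 0}"]) (auto simp: inc_apply)

lemma wsum_inc:
  assumes "finite {r. f r \<noteq> 0}"
  shows "wsum h (inc f r) = wsum h f + h r"
proof -
  let ?S = "insert r {r. f r \<noteq> 0}"
  have "wsum h (inc f r) = (\<Sum>s\<in>?S. h s * int (inc f r s))"
    unfolding wsum_def using assms by (intro sum.mono_neutral_left) (auto simp: inc_apply)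
  also have "\<dots> = (\<Sum>s\<in>?S. h s * int (f s) + (if s = r then h s else 0))"
    by (intro sum.cong) (auto simp: inc_apply algebra_simps)
  also have "\<dots> = (\<Sum>s\<in>?S. h s * int (f s)) + h r"
    unfolding sum.distrib using assms by simp
  also have "(\<Sum>s\<in>?S. h s * int (f s)) = wsum h f"
    unfolding wsum_def using assms by (intro sum.mono_neutral_right) auto
  finally show ?thesis .
qed

lemma shape_wsum_inc: "shape f \<Longrightarrow> wsum h (inc f r) = wsum h f + h r"
  by (intro wsum_inc) (simp add: shape_def)

text \<open>The local rules of Fomin's growth diagrams for the Robinson--Schensted correspondence: the
  shapes \<open>\<rho>\<close>, \<open>\<mu>\<close>, \<open>\<nu>\<close> at three corners of a cell and the presence \<open>b\<close> of a cross in it determine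
  the shape at the fourth corner, and this can be inverted.\<close>

definition grow :: "bool \<Rightarrow> (nat \<Rightarrow> nat) \<Rightarrow> (nat \<Rightarrow> nat) \<Rightarrow> (nat \<Rightarrow> nat) \<Rightarrow> nat \<Rightarrow> nat" where
  "grow b \<rho> \<mu> \<nu> =
     (if b then inc \<rho> 0
      else if \<mu> \<noteq> \<nu> then (\<lambda>r. max (\<mu> r) (\<nu> r))
      else if \<mu> = \<rho> then \<rho>
      else inc \<mu> (Suc (SOME r. \<mu> = inc \<rho> r)))"

text \<open>When \<mu> = \<nu>, an extra box of \<kappa> in row 0 can only come from a cross; an
  extra box in row \<open>Suc s\<close> was pushed down by a box added in row \<open>s\<close>,
  which is taken away again.\<close>

definition shrink :: "(nat \<Rightarrow> nat) \<Rightarrow> (nat \<Rightarrow> nat) \<Rightarrow> (nat \<Rightarrow> nat) \<Rightarrow> bool \<times> (nat \<Rightarrow> nat)" where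
  "shrink \<kappa> \<mu> \<nu> =
     (if \<mu> \<noteq> \<nu> then (False, \<lambda>r. min (\<mu> r) (\<nu> r))
      else if \<kappa> = \<mu> then (False, \<mu>)
      else (case SOME r. \<kappa> = inc \<mu> r of 0 \<Rightarrow> (True, \<mu>) | Suc s \<Rightarrow> (False, \<mu>(s := \<mu> s - 1))))"

lemma some_inc: "(SOME s. inc f r = inc f s) = r"
  by (rule some_equality) (simp_all add: inc_right_inj)

lemma grow_inc: "grow False \<rho> (inc \<rho> r) (inc \<rho> r) = inc (inc \<rho> r) (Suc r)"
  by (simp add: grow_def inc_neq some_inc)

lemma shrink_inc_0: "shrink (inc \<mu> 0) \<mu> \<mu> = (True, \<mu>)"
  by (simp add: shrink_def inc_neq some_inc)

lemma shrink_inc_Suc: "shrink (inc \<mu> (Suc s)) \<mu> \<mu> = (False, \<mu>(s := \<mu> s - 1))"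
  by (simp add: shrink_def inc_neq some_inc)

lemma max_inc_inc: "r \<noteq> s \<Longrightarrow> (\<lambda>t. max (inc f r t) (inc f s t)) = inc (inc f r) s"
  by (auto simp: inc_apply)

lemma min_inc_inc: "r \<noteq> s \<Longrightarrow> (\<lambda>t. min (inc f r t) (inc f s t)) = f"
  by (auto simp: inc_apply)

lemma max_inc: "(\<lambda>t. max (inc f r t) (f t)) = inc f r" "(\<lambda>t. max (f t) (inc f r t)) = inc f r"
  by (auto simp: inc_apply)

lemma min_inc: "(\<lambda>t. min (inc f r t) (f t)) = f" "(\<lambda>t. min (f t) (inc f r t)) = f"
  by (auto simp: inc_apply)

lemma inc_commute: "inc (inc f r) s = inc (inc f s) r"
  by (auto simp: inc_def)

lemma step_inc: "step f f" "step f (inc f r)" "step (inc f s) (inc (inc f r) s)"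
  unfolding step_def using inc_commute[of f r s] by blast+

text \<open>The local rules as a relation that prefers neither direction; \<open>grow\<close> and
  \<open>shrink\<close> are both read off from it, which makes them inverse to each other. The
  corner \<rho> is next to the origin and \<kappa> is opposite to it.\<close>

inductive cell :: "bool \<Rightarrow> (nat \<Rightarrow> nat) \<Rightarrow> (nat \<Rightarrow> nat) \<Rightarrow> (nat \<Rightarrow> nat) \<Rightarrow> (nat \<Rightarrow> nat) \<Rightarrow> bool" where
  cell_cross: "shape \<rho> \<Longrightarrow> shape (inc \<rho> 0) \<Longrightarrow> cell True \<rho> \<rho> \<rho> (inc \<rho> 0)"
| cell_left: "shape \<rho> \<Longrightarrow> shape \<nu> \<Longrightarrow> step \<rho> \<nu> \<Longrightarrow> cell False \<rho> \<rho> \<nu> \<nu>"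
| cell_right: "shape \<rho> \<Longrightarrow> shape \<mu> \<Longrightarrow> step \<rho> \<mu> \<Longrightarrow> cell False \<rho> \<mu> \<rho> \<mu>"
| cell_diff: "shape \<rho> \<Longrightarrow> shape (inc \<rho> r) \<Longrightarrow> shape (inc \<rho> s) \<Longrightarrow> shape (inc (inc \<rho> r) s) \<Longrightarrow> r \<noteq> s \<Longrightarrow>
    cell False \<rho> (inc \<rho> r) (inc \<rho> s) (inc (inc \<rho> r) s)"
| cell_same: "shape \<rho> \<Longrightarrow> shape (inc \<rho> r) \<Longrightarrow> shape (inc (inc \<rho> r) (Suc r)) \<Longrightarrow>
    cell False \<rho> (inc \<rho> r) (inc \<rho> r) (inc (inc \<rho> r) (Suc r))"

lemma cell_grow: "cell b \<rho> \<mu> \<nu> \<kappa> \<Longrightarrow> grow b \<rho> \<mu> \<nu> = \<kappa>"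
proof (induction rule: cell.induct)
  case (cell_cross \<rho>)
  then show ?case by (simp add: grow_def)
next
  case (cell_left \<rho> \<nu>)
  then show ?case by (auto simp: grow_def step_def max_inc)
next
  case (cell_right \<rho> \<mu>)
  then show ?case by (auto simp: grow_def step_def max_inc)
next
  case (cell_diff \<rho> r s)
  then show ?case by (simp add: grow_def max_inc_inc inc_right_inj)
next
  case (cell_same \<rho> r)
  then show ?case by (simp add: grow_inc)
qed

lemma cell_shrink: "cell b \<rho> \<mu> \<nu> \<kappa> \<Longrightarrow> shrink \<kappa> \<mu> \<nu> = (b, \<rho>)"
proof (induction rule: cell.induct)
  case (cell_cross \<rho>)
  then show ?case by (simp add: shrink_inc_0)
next
  case (cell_left \<rho> \<nu>)
  then show ?case by (auto simp: shrink_def step_def min_inc)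
next
  case (cell_right \<rho> \<mu>)
  then show ?case by (auto simp: shrink_def step_def min_inc)
next
  case (cell_diff \<rho> r s)
  then show ?case by (simp add: shrink_def min_inc_inc inc_right_inj)
next
  case (cell_same \<rho> r)
  have "(inc \<rho> r)(r := inc \<rho> r r - 1) = \<rho>" by (auto simp: inc_def)
  then show ?case by (simp add: shrink_inc_Suc)
qed

lemma cell_step:
  assumes "cell b \<rho> \<mu> \<nu> \<kappa>"
  shows "shape \<rho>" "shape \<mu>" "shape \<nu>" "shape \<kappa>" "step \<rho> \<mu>" "step \<rho> \<nu>" "step \<mu> \<kappa>" "step \<nu> \<kappa>"
  using assms by (induction rule: cell.induct) (simp_all add: step_inc)

lemma shapeI: "(\<And>r. f (Suc r) \<le> f r) \<Longrightarrow> finite {r. f r \<noteq> 0} \<Longrightarrow> shape f"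
  by (simp add: shape_def)

lemma shape_Suc_le: "shape f \<Longrightarrow> f (Suc r) \<le> f r"
  by (simp add: shape_def)

lemma shape_finite: "shape f \<Longrightarrow> finite {r. f r \<noteq> 0}"
  by (simp add: shape_def)

lemma shape_diff:
  assumes "shape f" "shape (inc f r)" "shape (inc f s)" "r \<noteq> s"
  shows "shape (inc (inc f r) s)"
proof (rule shapeI)
  fix t show "inc (inc f r) s (Suc t) \<le> inc (inc f r) s t"
    using shape_Suc_le[OF assms(1), of t] shape_Suc_le[OF assms(2), of t] shape_Suc_le[OF assms(3), of t] assms(4)
    by (auto simp: inc_apply split: if_splits)
qed (intro finite_support_inc shape_finite assms(1))

text \<open>The box added to row \<open>r\<close> makes that row strictly longer than row
  \<open>Suc r\<close>, so one box fits below.\<close>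

lemma shape_same:
  assumes "shape f" "shape (inc f r)"
  shows "shape (inc (inc f r) (Suc r))"
proof (rule shapeI)
  fix t show "inc (inc f r) (Suc r) (Suc t) \<le> inc (inc f r) (Suc r) t"
    using shape_Suc_le[OF assms(1), of t] shape_Suc_le[OF assms(2), of t]
    by (auto simp: inc_apply split: if_splits)
qed (intro finite_support_inc shape_finite assms(1))

lemma shape_inc_0:
  assumes "shape f"
  shows "shape (inc f 0)"
proof (rule shapeI)
  fix t show "inc f 0 (Suc t) \<le> inc f 0 t"
    using shape_Suc_le[OF assms, of t] by (auto simp: inc_apply)
qed (intro finite_support_inc shape_finite assms)

text \<open>The hypothesis on \<open>b\<close> reflects that a permutation has one cross in each row
  and column: the strips leading to a cross contain no other, so the three known shapes coincide
  there.\<close>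

lemma cell_forward:
  assumes "shape \<rho>" "shape \<mu>" "shape \<nu>" "step \<rho> \<mu>" "step \<rho> \<nu>" "b \<Longrightarrow> \<mu> = \<rho> \<and> \<nu> = \<rho>"
  shows "cell b \<rho> \<mu> \<nu> (grow b \<rho> \<mu> \<nu>)"
proof -
  have "\<exists>\<kappa>. cell b \<rho> \<mu> \<nu> \<kappa>"
  proof (cases b)
    case True
    then show ?thesis using assms cell_cross[of \<rho>] shape_inc_0[of \<rho>] by auto
  next
    case False
    consider "\<mu> = \<rho>" | "\<nu> = \<rho>" | r s where "\<mu> = inc \<rho> r" "\<nu> = inc \<rho> s"
      using assms(4,5) by (auto simp: step_def)
    then show ?thesis
    proof cases
      case 1
      then show ?thesis using cell_left[of \<rho> \<nu>] False assms by auto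
    next
      case 2
      then show ?thesis using cell_right[of \<rho> \<mu>] False assms by auto
    next
      case (3 r s)
      show ?thesis
      proof (cases "r = s")
        case True
        then show ?thesis using 3 False assms shape_same[of \<rho> r] cell_same[of \<rho> r] by auto
      next
        case neq: False
        then show ?thesis using 3 False assms shape_diff[of \<rho> r s] cell_diff[of \<rho> r s] by auto
      qed
    qed
  qed
  then show ?thesis by (metis cell_grow)
qed

lemma shape_min:
  assumes "shape f" "shape g"
  shows "shape (\<lambda>r. min (f r) (g r))"
proof (rule shapeI)
  fix r show "min (f (Suc r)) (g (Suc r)) \<le> min (f r) (g r)"
    using assms by (intro min.mono shape_Suc_le)
  show "finite {r. min (f r) (g r) \<noteq> 0}"
    by (rule finite_subset[OF _ shape_finite[OF assms(1)]]) auto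
qed

lemma cell_backward:
  assumes "shape \<mu>" "shape \<nu>" "shape \<kappa>" "step \<mu> \<kappa>" "step \<nu> \<kappa>"
  shows "cell (fst (shrink \<kappa> \<mu> \<nu>)) (snd (shrink \<kappa> \<mu> \<nu>)) \<mu> \<nu> \<kappa>"
proof -
  have "\<exists>b \<rho>. cell b \<rho> \<mu> \<nu> \<kappa>"
  proof -
    consider "\<mu> = \<kappa>" | "\<nu> = \<kappa>" | r s where "\<kappa> = inc \<mu> r" "\<kappa> = inc \<nu> s"
      using assms(4,5) unfolding step_def by blast
    then show ?thesis
    proof cases
      case 1
      then show ?thesis using cell_right assms by blast
    next
      case 2
      then show ?thesis using cell_left assms by blast
    next
      case (3 r s)
      show ?thesis
      proof (cases "r = s")
        case False
        define \<rho> where "\<rho> = (\<lambda>t. min (\<mu> t) (\<nu> t))"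
        have eq: "inc \<mu> r t = inc \<nu> s t" for t using 3 by simp
        have "\<mu> = inc \<rho> s"
        proof
          fix t show "\<mu> t = inc \<rho> s t"
            using eq[of t] False by (auto simp: inc_apply \<rho>_def split: if_splits)
        qed
        moreover have "\<nu> = inc \<rho> r"
        proof
          fix t show "\<nu> t = inc \<rho> r t"
            using eq[of t] False by (auto simp: inc_apply \<rho>_def split: if_splits)
        qed
        moreover have "shape \<rho>" unfolding \<rho>_def using assms by (intro shape_min)
        ultimately show ?thesis using cell_diff[of \<rho> s r] 3 False assms by auto
      next
        case True
        then have mn: "\<mu> = \<nu>" using 3 by (simp add: inc_left_inj)
        show ?thesis
        proof (cases r)
          case 0
          then show ?thesis using cell_cross[of \<mu>] 3 mn assms by auto
        next
          case (Suc t)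
          \<comment> \<open>Since \<kappa> is a shape with an extra box in row \<open>Suc t\<close>,
            row \<open>t\<close> of \<mu> is strictly longer than the next one, and its last box can
            be removed.\<close>
          define \<rho> where "\<rho> = \<mu>(t := \<mu> t - 1)"
          have le: "inc \<mu> (Suc t) (Suc u) \<le> inc \<mu> (Suc t) u" for u
            using assms(3) 3 Suc by (auto simp: shape_def)
          have pos: "\<mu> (Suc t) < \<mu> t"
            using le[of t] by (simp add: inc_apply)
          have m: "\<mu> = inc \<rho> t" using pos by (auto simp: \<rho>_def inc_def)
          have "\<rho> (Suc u) \<le> \<rho> u" for u
            using assms(1) pos by (cases "u = t"; cases "Suc u = t") (auto simp: shape_def \<rho>_def intro: le_trans[OF diff_le_self])
          moreover have "finite {u. \<rho> u \<noteq> 0}"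
            by (rule finite_subset[of _ "{u. \<mu> u \<noteq> 0}"]) (use assms(1) in \<open>auto simp: \<rho>_def shape_def\<close>)
          ultimately have "shape \<rho>" by (simp add: shape_def)
          then show ?thesis using cell_same[of \<rho> t] m mn Suc 3 assms by auto
        qed
      qed
    qed
  qed
  then show ?thesis by (metis cell_shrink fst_conv snd_conv)
qed

text \<open>Local form of the fact that the size at a corner counts the crosses between it and the
  origin.\<close>

lemma cell_size:
  assumes "cell b \<rho> \<mu> \<nu> \<kappa>"
  shows "size_shape \<kappa> + size_shape \<rho> = size_shape \<mu> + size_shape \<nu> + of_bool b"
  using assms by cases (auto simp: shape_wsum_inc)

text \<open>Used on the diagonal, where symmetry makes the two middle corners equal. Without a
  cross, boxes arrive in two consecutive rows or not at all and cancel in the alternating sum; a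
  cross adds a box in row 0.\<close>

lemma cell_alt:
  assumes "cell b \<rho> \<mu> \<mu> \<kappa>"
  shows "alt_shape \<kappa> = alt_shape \<rho> + of_bool b"
  using assms by cases (auto simp: shape_wsum_inc inc_right_inj)

text \<open>The recursion of the longest increasing subsequence: a cross extends it by one, and
  otherwise a pushed box lands below row 0.\<close>

lemma cell_row_0:
  assumes "cell b \<rho> \<mu> \<nu> \<kappa>"
  shows "\<kappa> 0 = max (\<mu> 0) (\<nu> 0) + of_bool b"
  using assms by cases (auto simp: inc_apply step_def)

lemma grow_commute: "grow b \<rho> \<mu> \<nu> = grow b \<rho> \<nu> \<mu>"
  by (auto simp: grow_def max.commute)

lemma shrink_commute: "shrink \<kappa> \<mu> \<nu> = shrink \<kappa> \<nu> \<mu>"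
  by (auto simp: shrink_def min.commute)


section \<open>Involutions and chains of shapes\<close>

fun diagram :: "(nat \<Rightarrow> nat) \<Rightarrow> nat \<Rightarrow> nat \<Rightarrow> nat \<Rightarrow> nat" where
  "diagram p 0 j = (\<lambda>_. 0)"
| "diagram p (Suc i) 0 = (\<lambda>_. 0)"
| "diagram p (Suc i) (Suc j) =
     grow (p (Suc i) = Suc j) (diagram p i j) (diagram p (Suc i) j) (diagram p i (Suc j))"

lemma diagram_0_right: "diagram p i 0 = (\<lambda>_. 0)"
  by (cases i) auto

lemma grow_left: "step \<rho> \<nu> \<Longrightarrow> grow False \<rho> \<rho> \<nu> = \<nu>"
  by (auto simp: grow_def step_def max_inc)

lemma grow_right: "step \<rho> \<mu> \<Longrightarrow> grow False \<rho> \<mu> \<rho> = \<mu>"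
  by (auto simp: grow_def step_def max_inc)

text \<open>The conditional equalities say that a strip without crosses changes nothing. At a cross,
  injectivity of \<open>p\<close> provides two such strips, as \<open>cell_forward\<close> demands;
  hence shape, step and equality are proved in one induction.\<close>

lemma diagram_invariant:
  assumes "inj p"
  shows "(shape (diagram p i j) \<and> shape (diagram p (Suc i) j) \<and> step (diagram p i j) (diagram p (Suc i) j) \<and>
           ((\<forall>b\<in>{1..j}. p (Suc i) \<noteq> b) \<longrightarrow> diagram p (Suc i) j = diagram p i j)) \<and>
         (shape (diagram p i (Suc j)) \<and> step (diagram p i j) (diagram p i (Suc j)) \<and>
           ((\<forall>a\<in>{1..i}. p a \<noteq> Suc j) \<longrightarrow> diagram p i (Suc j) = diagram p i j))"
    (is "?Q1 i j \<and> ?Q2 i j")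
proof (induction "i + j" arbitrary: i j rule: less_induct)
  case less
  have cell: "cell (p (Suc i') = Suc j') (diagram p i' j') (diagram p (Suc i') j') (diagram p i' (Suc j')) (diagram p (Suc i') (Suc j'))"
    if "i' + j' < i + j" for i' j'
  proof -
    note Q = conjunct1[OF less[OF that]] conjunct2[OF less[OF that]]
    have "diagram p (Suc i') j' = diagram p i' j' \<and> diagram p i' (Suc j') = diagram p i' j'"
      if b: "p (Suc i') = Suc j'"
    proof -
      have "\<forall>a\<in>{1..i'}. p a \<noteq> Suc j'"
      proof (intro ballI notI)
        fix a assume "a \<in> {1..i'}" "p a = Suc j'"
        then have "a = Suc i'" using injD[OF assms, of a "Suc i'"] b by simp
        then show False using \<open>a \<in> {1..i'}\<close> by auto
      qed
      moreover have "\<forall>c\<in>{1..j'}. p (Suc i') \<noteq> c" using b by auto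
      ultimately show ?thesis using Q by blast
    qed
    then show ?thesis
      unfolding diagram.simps(3) using Q by (intro cell_forward) auto
  qed
  have "?Q1 i j"
  proof (cases j)
    case 0
    then show ?thesis by (simp add: diagram_0_right shape_0 step_inc)
  next
    case (Suc j')
    have c: "cell (p (Suc i) = Suc j') (diagram p i j') (diagram p (Suc i) j') (diagram p i (Suc j')) (diagram p (Suc i) (Suc j'))"
      using Suc by (intro cell) auto
    have "diagram p (Suc i) (Suc j') = diagram p i (Suc j')" if nb: "\<forall>b\<in>{1..Suc j'}. p (Suc i) \<noteq> b"
    proof -
      have "diagram p (Suc i) j' = diagram p i j'"
        using less[of i j'] Suc nb by auto
      moreover have "p (Suc i) \<noteq> Suc j'" using nb by auto
      ultimately show ?thesis using cell_step(6)[OF c] by (simp add: grow_left)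
    qed
    then show ?thesis using cell_step[OF c] Suc by blast
  qed
  moreover have "?Q2 i j"
  proof (cases i)
    case 0
    then show ?thesis by (simp add: shape_0 step_inc)
  next
    case (Suc i')
    have c: "cell (p (Suc i') = Suc j) (diagram p i' j) (diagram p (Suc i') j) (diagram p i' (Suc j)) (diagram p (Suc i') (Suc j))"
      using Suc by (intro cell) auto
    have "diagram p (Suc i') (Suc j) = diagram p (Suc i') j" if na: "\<forall>a\<in>{1..Suc i'}. p a \<noteq> Suc j"
    proof -
      have "diagram p i' (Suc j) = diagram p i' j"
        using less[of i' j] Suc na by auto
      moreover have "p (Suc i') \<noteq> Suc j" using na by auto
      ultimately show ?thesis using cell_step(5)[OF c] by (simp add: grow_right)
    qed
    then show ?thesis using cell_step[OF c] Suc by blast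
  qed
  ultimately show ?case by blast
qed

lemma diagram_cell:
  assumes "inj p"
  shows "cell (p (Suc i) = Suc j) (diagram p i j) (diagram p (Suc i) j) (diagram p i (Suc j)) (diagram p (Suc i) (Suc j))"
proof -
  note Q = diagram_invariant[OF assms, of i j]
  have "diagram p (Suc i) j = diagram p i j \<and> diagram p i (Suc j) = diagram p i j"
    if b: "p (Suc i) = Suc j"
  proof -
    have "\<forall>a\<in>{1..i}. p a \<noteq> Suc j"
    proof (intro ballI notI)
      fix a assume "a \<in> {1..i}" "p a = Suc j"
      then have "a = Suc i" using injD[OF assms, of a "Suc i"] b by simp
      then show False using \<open>a \<in> {1..i}\<close> by auto
    qed
    moreover have "\<forall>c\<in>{1..j}. p (Suc i) \<noteq> c" using b by auto
    ultimately show ?thesis using Q by blast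
  qed
  then show ?thesis
    unfolding diagram.simps(3) using Q by (intro cell_forward) auto
qed

lemma shape_diagram: "inj p \<Longrightarrow> shape (diagram p i j)"
  using diagram_invariant by blast

lemma step_diagram: "inj p \<Longrightarrow> step (diagram p i j) (diagram p (Suc i) j)"
  using diagram_invariant by blast

text \<open>Adding up \<open>cell_size\<close> along the strip, which contains the cross of
  \<open>Suc i\<close> exactly when \<open>p (Suc i)\<close> lies in \<open>{1..j}\<close>.\<close>

lemma size_diagram_Suc:
  assumes "inj p"
  shows "size_shape (diagram p (Suc i) j) = size_shape (diagram p i j) + of_bool (1 \<le> p (Suc i) \<and> p (Suc i) \<le> j)"
proof (induction j)
  case 0
  show ?case by (simp add: diagram_0_right)
next
  case (Suc j)
  show ?case
    using cell_size[OF diagram_cell[OF assms, of i j]] Suc by (auto simp: le_Suc_eq)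
qed

text \<open>The crosses of an involution are symmetric about the diagonal, and so is the local
  rule.\<close>

lemma diagram_sym:
  assumes "\<And>x. p (p x) = x"
  shows "diagram p i j = diagram p j i"
proof (induction i arbitrary: j)
  case 0
  then show ?case by (simp add: diagram_0_right)
next
  case (Suc i)
  note IH = Suc
  show ?case
  proof (induction j)
    case 0
    then show ?case by (simp add: diagram_0_right)
  next
    case (Suc j)
    have "p (Suc i) = Suc j \<longleftrightarrow> p (Suc j) = Suc i" using assms by metis
    then show ?case
      using Suc IH[of j] IH[of "Suc j"] by (simp add: grow_commute)
  qed
qed

text \<open>Schuetzenberger's theorem on fixed points, by adding up \<open>cell_alt\<close> along
  the diagonal.\<close>

lemma alt_diagram:
  assumes "inj p" "\<And>i j. diagram p i j = diagram p j i"
  shows "alt_shape (diagram p n n) = int (card {i \<in> {1..n}. p i = i})"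
proof (induction n)
  case 0
  show ?case by (simp add: wsum_def)
next
  case (Suc n)
  have "alt_shape (diagram p (Suc n) (Suc n)) = alt_shape (diagram p n n) + of_bool (p (Suc n) = Suc n)"
    using diagram_cell[OF assms(1), of n n] assms(2)[of n "Suc n"] by (intro cell_alt) auto
  moreover have "{i \<in> {1..Suc n}. p i = i} = {i \<in> {1..n}. p i = i} \<union> (if p (Suc n) = Suc n then {Suc n} else {})"
    by (auto simp: le_Suc_eq)
  ultimately show ?case using Suc by auto
qed

section \<open>Schensted's theorem on the first row\<close>

definition increasing_in :: "(nat \<Rightarrow> nat) \<Rightarrow> nat \<Rightarrow> nat \<Rightarrow> nat set \<Rightarrow> bool" where
  "increasing_in p i j S \<longleftrightarrow> S \<subseteq> {1..i} \<and> p ` S \<subseteq> {1..j} \<and> strict_mono_on S p"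

lemma increasing_in_mono: "increasing_in p i j S \<Longrightarrow> i \<le> i' \<Longrightarrow> j \<le> j' \<Longrightarrow> increasing_in p i' j' S"
  unfolding increasing_in_def by fastforce

lemma increasing_in_finite: "increasing_in p i j S \<Longrightarrow> finite S"
  unfolding increasing_in_def by (auto intro: finite_subset)

lemma increasing_in_empty: "increasing_in p i j {}"
  by (simp add: increasing_in_def strict_mono_on_def)

lemma cell_cross_eq: "cell b \<rho> \<mu> \<nu> \<kappa> \<Longrightarrow> b \<Longrightarrow> \<mu> = \<rho> \<and> \<nu> = \<rho>"
  by (induction rule: cell.induct) auto

text \<open>\<open>cell_row_0\<close> is matched with the recursion for increasing subsequences in a
  rectangle. Quantifying over every \<open>m\<close> up to the row length, instead of stating a
  maximum, turns the rule for \<open>max\<close> into a disjunction.\<close>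

lemma row_0_diagram:
  "inj p \<Longrightarrow> m \<le> diagram p i j 0 \<longleftrightarrow> (\<exists>S. increasing_in p i j S \<and> card S = m)"
proof (induction p i j arbitrary: m rule: diagram.induct)
  case (1 p j)
  have "(\<exists>S. increasing_in p 0 j S \<and> card S = m) \<longleftrightarrow> m = 0"
    by (auto simp: increasing_in_def strict_mono_on_def)
  then show ?case by simp
next
  case (2 p i)
  have "(\<exists>S. increasing_in p (Suc i) 0 S \<and> card S = m) \<longleftrightarrow> m = 0"
    by (auto simp: increasing_in_def strict_mono_on_def)
  then show ?case by simp
next
  case (3 p i j)
  note cell = diagram_cell[OF \<open>inj p\<close>, of i j]
  show ?case
  proof (cases "p (Suc i) = Suc j")
    case True
    have row: "diagram p (Suc i) (Suc j) 0 = Suc (diagram p i j 0)"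
      using cell_row_0[OF cell] cell_cross_eq[OF cell True] True by simp
    show ?thesis
    proof
      assume m: "m \<le> diagram p (Suc i) (Suc j) 0"
      show "\<exists>S. increasing_in p (Suc i) (Suc j) S \<and> card S = m"
      proof (cases m)
        case 0
        then show ?thesis using increasing_in_empty by (intro exI[of _ "{}"]) auto
      next
        case (Suc m')
        then have "m' \<le> diagram p i j 0" using m row by simp
        then obtain S where S: "increasing_in p i j S" "card S = m'"
          using 3 by blast
        have "increasing_in p (Suc i) (Suc j) (insert (Suc i) S)"
          unfolding increasing_in_def
        proof (intro conjI strict_mono_onI)
          fix x y assume xy: "x \<in> insert (Suc i) S" "y \<in> insert (Suc i) S" "x < y"
          have "x \<in> S" using xy S(1) by (auto simp: increasing_in_def)
          then have "p x \<le> j" using S(1) by (auto simp: increasing_in_def)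
          then show "p x < p y"
            using xy \<open>x \<in> S\<close> S(1) True by (auto simp: increasing_in_def dest: strict_mono_onD)
        qed (use S(1) True in \<open>auto simp: increasing_in_def\<close>)
        moreover have "Suc i \<notin> S" using S(1) by (auto simp: increasing_in_def)
        then have "card (insert (Suc i) S) = m"
          using S increasing_in_finite[OF S(1)] Suc by simp
        ultimately show ?thesis by blast
      qed
    next
      assume "\<exists>S. increasing_in p (Suc i) (Suc j) S \<and> card S = m"
      then obtain S where S: "increasing_in p (Suc i) (Suc j) S" "card S = m" by blast
      have "increasing_in p i j (S - {Suc i})"
        unfolding increasing_in_def
      proof (intro conjI subsetI)
        fix x assume x: "x \<in> S - {Suc i}"
        then show "x \<in> {1..i}" using S(1) by (auto simp: increasing_in_def le_Suc_eq)
      next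
        fix y assume "y \<in> p ` (S - {Suc i})"
        then obtain x where x: "x \<in> S" "x \<noteq> Suc i" "y = p x" by auto
        then have "p x \<noteq> Suc j" using True 3(4) by (metis injD)
        then show "y \<in> {1..j}" using x S(1) by (force simp: increasing_in_def le_Suc_eq)
      next
        show "strict_mono_on (S - {Suc i}) p"
          using S(1) by (auto simp: increasing_in_def strict_mono_on_def)
      qed
      then have "card (S - {Suc i}) \<le> diagram p i j 0"
        using 3 by blast
      moreover have "m \<le> Suc (card (S - {Suc i}))"
        using S increasing_in_finite[OF S(1)] by (cases "Suc i \<in> S") (auto simp: card_Diff_singleton)
      ultimately show "m \<le> diagram p (Suc i) (Suc j) 0" using row by simp
    qed
  next
    case False
    have row: "diagram p (Suc i) (Suc j) 0 = max (diagram p (Suc i) j 0) (diagram p i (Suc j) 0)"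
      using cell_row_0[OF cell] False by simp
    have "(\<exists>S. increasing_in p (Suc i) (Suc j) S \<and> card S = m)
      \<longleftrightarrow> (\<exists>S. increasing_in p (Suc i) j S \<and> card S = m) \<or> (\<exists>S. increasing_in p i (Suc j) S \<and> card S = m)"
    proof
      assume "\<exists>S. increasing_in p (Suc i) (Suc j) S \<and> card S = m"
      then obtain S where S: "increasing_in p (Suc i) (Suc j) S" "card S = m" by blast
      \<comment> \<open>The last position and the largest value cannot both be used, since they
        would have to meet in a cross.\<close>
      have "increasing_in p (Suc i) j S \<or> increasing_in p i (Suc j) S"
      proof (cases "Suc i \<in> S")
        case True
        have "p x \<le> j" if "x \<in> S" for x
        proof (cases "x = Suc i")
          case True
          then show ?thesis using that S(1) False by (force simp: increasing_in_def le_Suc_eq)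
        next
          case neq: False
          then have "x < Suc i" using that S(1) by (force simp: increasing_in_def)
          then have "p x < p (Suc i)"
            using S(1) True that by (auto simp: increasing_in_def dest: strict_mono_onD)
          moreover have "p (Suc i) \<le> Suc j" using S(1) True by (force simp: increasing_in_def)
          ultimately show ?thesis by simp
        qed
        then show ?thesis using S(1) by (force simp: increasing_in_def)
      next
        case False
        then show ?thesis using S(1) by (force simp: increasing_in_def le_Suc_eq)
      qed
      then show "(\<exists>S. increasing_in p (Suc i) j S \<and> card S = m) \<or> (\<exists>S. increasing_in p i (Suc j) S \<and> card S = m)"
        using S by blast
    next
      have "increasing_in p (Suc i) (Suc j) S" if "increasing_in p (Suc i) j S" for S
        using that by (rule increasing_in_mono) auto
      moreover have "increasing_in p (Suc i) (Suc j) S" if "increasing_in p i (Suc j) S" for S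
        using that by (rule increasing_in_mono) auto
      moreover assume "(\<exists>S. increasing_in p (Suc i) j S \<and> card S = m) \<or> (\<exists>S. increasing_in p i (Suc j) S \<and> card S = m)"
      ultimately show "\<exists>S. increasing_in p (Suc i) (Suc j) S \<and> card S = m" by blast
    qed
    then show ?thesis
      using 3 unfolding row le_max_iff_disj by blast
  qed
qed

text \<open>Standard Young tableaux of size \<open>n\<close>, as growing sequences of shapes. They
  are made constant from \<open>n\<close> on so that each chain is a single function.\<close>

definition shape_chains :: "nat \<Rightarrow> (nat \<Rightarrow> nat \<Rightarrow> nat) set" where
  "shape_chains n = {c. c 0 = (\<lambda>_. 0) \<and> (\<forall>i<n. shape (c (Suc i)) \<and> (\<exists>r. c (Suc i) = inc (c i) r)) \<and>
                  (\<forall>i\<ge>n. c i = c n)}"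

definition involutions :: "nat \<Rightarrow> (nat \<Rightarrow> nat) set" where
  "involutions n = {p. p permutes {1..n} \<and> (\<forall>x. p (p x) = x)}"

lemma involutions_inj: "p \<in> involutions n \<Longrightarrow> inj p"
  by (auto simp: involutions_def dest: permutes_inj)

lemma involutions_sym: "p \<in> involutions n \<Longrightarrow> diagram p i j = diagram p j i"
  by (auto simp: involutions_def intro: diagram_sym)

text \<open>Up to height \<open>n\<close>, the strip at \<open>Suc i\<close> contains a cross when
  \<open>i < n\<close> and none when \<open>i \<ge> n\<close>, so the size, and with it the shape,
  grows exactly in the first \<open>n\<close> steps.\<close>

lemma diagram_in_shape_chains:
  assumes p: "p \<in> involutions n"
  shows "(\<lambda>i. diagram p i n) \<in> shape_chains n"
proof -
  note inj = involutions_inj[OF p]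
  have perm: "p permutes {1..n}" using p by (simp add: involutions_def)
  have ex: "\<exists>r. diagram p (Suc i) n = inc (diagram p i n) r" if "i < n" for i
  proof -
    have "p (Suc i) \<in> {1..n}" using permutes_in_image[OF perm, of "Suc i"] that by simp
    then have "size_shape (diagram p (Suc i) n) \<noteq> size_shape (diagram p i n)"
      by (subst size_diagram_Suc[OF inj]) auto
    then show ?thesis using step_diagram[OF inj, of i n] by (auto simp: step_def)
  qed
  have const: "diagram p i n = diagram p n n" if "i \<ge> n" for i
    using that
  proof (induction i rule: dec_induct)
    case (step i)
    have "p (Suc i) = Suc i" using perm step by (auto intro: permutes_not_in)
    then have "size_shape (diagram p (Suc i) n) = size_shape (diagram p i n)"
      using step by (subst size_diagram_Suc[OF inj]) auto
    moreover have "size_shape (inc (diagram p i n) r) \<noteq> size_shape (diagram p i n)" for r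
      by (subst shape_wsum_inc[OF shape_diagram[OF inj]]) simp
    ultimately have "diagram p (Suc i) n = diagram p i n"
      using step_diagram[OF inj, of i n] by (auto simp: step_def)
    then show ?case using step by simp
  qed simp
  show ?thesis
    unfolding shape_chains_def mem_Collect_eq
    by (intro conjI allI impI diagram.simps(1) shape_diagram[OF inj] ex const)
qed

text \<open>The growth diagram read backwards from its boundary chain \<open>c\<close>: \<open>codiagram c n a b\<close> is the
  shape at the corner \<open>(n - a, n - b)\<close>.\<close>

fun codiagram :: "(nat \<Rightarrow> nat \<Rightarrow> nat) \<Rightarrow> nat \<Rightarrow> nat \<Rightarrow> nat \<Rightarrow> nat \<Rightarrow> nat" where
  "codiagram c n 0 b = c (n - b)"
| "codiagram c n (Suc a) 0 = c (n - Suc a)"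
| "codiagram c n (Suc a) (Suc b) =
     snd (shrink (codiagram c n a b) (codiagram c n a (Suc b)) (codiagram c n (Suc a) b))"

text \<open>This concerns the cell whose corner farthest from the origin is
  \<open>(n - a, n - b)\<close>, so it stands for \<open>p (n - a) = n - b\<close>.\<close>

definition cross :: "(nat \<Rightarrow> nat \<Rightarrow> nat) \<Rightarrow> nat \<Rightarrow> nat \<Rightarrow> nat \<Rightarrow> bool" where
  "cross c n a b = fst (shrink (codiagram c n a b) (codiagram c n a (Suc b)) (codiagram c n (Suc a) b))"

lemma codiagram_0_right: "codiagram c n a 0 = c (n - a)"
  by (cases a) auto

lemma codiagram_sym: "codiagram c n a b = codiagram c n b a"
proof (induction c n a b rule: codiagram.induct)
  case (3 c n a b)
  show ?case
    unfolding codiagram.simps(3)[of c n a b] 3 by (simp add: shrink_commute)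
qed (auto simp: codiagram_0_right)

lemma cross_sym: "cross c n a b = cross c n b a"
  unfolding cross_def by (metis codiagram_sym shrink_commute)

lemma shape_chains_0: "c \<in> shape_chains n \<Longrightarrow> c 0 = (\<lambda>_. 0)"
  unfolding shape_chains_def by blast

lemma shape_chains_inc: "c \<in> shape_chains n \<Longrightarrow> i < n \<Longrightarrow> \<exists>r. c (Suc i) = inc (c i) r"
  unfolding shape_chains_def by blast

lemma shape_chains_const: "c \<in> shape_chains n \<Longrightarrow> n \<le> i \<Longrightarrow> c i = c n"
  unfolding shape_chains_def by blast

lemma shape_chains_step: "c \<in> shape_chains n \<Longrightarrow> step (c (n - Suc a)) (c (n - a))"
proof -
  assume c: "c \<in> shape_chains n"
  show ?thesis
  proof (cases "a < n")
    case True
    then have "n - a = Suc (n - Suc a)" "n - Suc a < n" by auto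
    then show ?thesis using shape_chains_inc[OF c, of "n - Suc a"] by (simp add: step_def)
  qed (simp add: step_def)
qed

lemma shape_chains_shape: "c \<in> shape_chains n \<Longrightarrow> shape (c i)"
proof -
  assume c: "c \<in> shape_chains n"
  have le: "shape (c i)" if "i \<le> n" for i
  proof (cases i)
    case 0
    then show ?thesis using shape_chains_0[OF c] shape_0 by simp
  next
    case (Suc m)
    then show ?thesis using c that unfolding shape_chains_def by (metis (mono_tags, lifting) Suc_le_eq mem_Collect_eq)
  qed
  show ?thesis
    using le[of i] le[of n] shape_chains_const[OF c, of i] by (cases "i \<le> n") auto
qed

text \<open>The mirror image of \<open>diagram_invariant\<close>: read backwards,
  \<open>shrink\<close> itself decides where the crosses are, so shape and step form the
  invariant.\<close>

lemma codiagram_cell: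
  assumes c: "c \<in> shape_chains n"
  shows "cell (cross c n a b) (codiagram c n (Suc a) (Suc b)) (codiagram c n a (Suc b))
           (codiagram c n (Suc a) b) (codiagram c n a b)"
proof -
  have inv: "(shape (codiagram c n a b) \<and> shape (codiagram c n (Suc a) b) \<and> step (codiagram c n (Suc a) b) (codiagram c n a b)) \<and>
      (shape (codiagram c n a (Suc b)) \<and> step (codiagram c n a (Suc b)) (codiagram c n a b))" for a b
  proof (induction "a + b" arbitrary: a b rule: less_induct)
    case less
    have cell: "cell (cross c n a' b') (codiagram c n (Suc a') (Suc b')) (codiagram c n a' (Suc b'))
           (codiagram c n (Suc a') b') (codiagram c n a' b')" if "a' + b' < a + b" for a' b'
      unfolding cross_def codiagram.simps(3) using less[OF that] by (intro cell_backward) auto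
    have "shape (codiagram c n a b) \<and> shape (codiagram c n (Suc a) b) \<and> step (codiagram c n (Suc a) b) (codiagram c n a b)"
    proof (cases b)
      case 0
      then show ?thesis using c by (simp add: codiagram_0_right shape_chains_shape shape_chains_step)
    next
      case (Suc b')
      then show ?thesis using cell_step[OF cell[of a b']] by auto
    qed
    moreover have "shape (codiagram c n a (Suc b)) \<and> step (codiagram c n a (Suc b)) (codiagram c n a b)"
    proof (cases a)
      case 0
      then show ?thesis using c by (simp add: shape_chains_shape shape_chains_step)
    next
      case (Suc a')
      then show ?thesis using cell_step[OF cell[of a' b]] by auto
    qed
    ultimately show ?case by blast
  qed
  show ?thesis
    unfolding cross_def codiagram.simps(3) using inv[of a b] by (intro cell_backward) auto
qed

text \<open>The side starts at \<open>c 0\<close>, and each further corner is contained in the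
  previous one; only the empty shape is contained in the empty shape.\<close>

lemma codiagram_full:
  assumes c: "c \<in> shape_chains n"
  shows "codiagram c n n b = (\<lambda>_. 0)"
proof (induction b)
  case 0
  then show ?case using shape_chains_0[OF c] by (simp add: codiagram_0_right)
next
  case (Suc b)
  have "inc f r \<noteq> (\<lambda>_. 0)" for f r by (metis inc_apply nat.distinct(1))
  then show ?case
    using cell_step(7)[OF codiagram_cell[OF c, of n b]] Suc by (auto simp: step_def) metis
qed

section \<open>The growth diagram as a bijection from involutions to chains\<close>

lemma codiagram_diagram:
  assumes "p \<in> involutions n" "c = (\<lambda>i. diagram p i n)" "a \<le> n" "b \<le> n"
  shows "codiagram c n a b = diagram p (n - a) (n - b)"
  using assms
proof (induction c n a b rule: codiagram.induct)
  case (1 c n b)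
  then show ?case using involutions_sym[of p n n "n - b"] by simp
next
  case (2 c n a)
  then show ?case by simp
next
  case (3 c n a b)
  have i: "Suc (n - Suc a) = n - a" "Suc (n - Suc b) = n - b" using 3 by auto
  note cell = diagram_cell[OF involutions_inj[OF 3(4)], of "n - Suc a" "n - Suc b", unfolded i]
  show ?case
    using cell_shrink[OF cell] 3 by simp
qed

lemma cross_diagram:
  assumes p: "p \<in> involutions n" and "a < n" "b < n"
  shows "cross (\<lambda>i. diagram p i n) n a b \<longleftrightarrow> p (n - a) = n - b"
proof -
  have i: "Suc (n - Suc a) = n - a" "Suc (n - Suc b) = n - b" using assms by auto
  note cell = diagram_cell[OF involutions_inj[OF p], of "n - Suc a" "n - Suc b", unfolded i]
  show ?thesis
    using cell_shrink[OF cell] assms by (simp add: cross_def codiagram_diagram[OF p refl])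
qed

text \<open>An involution is determined by the crosses of its diagram, and these are read off the
  boundary chain alone.\<close>

lemma inj_on_diagram: "inj_on (\<lambda>p i. diagram p i n) (involutions n)"
proof (rule inj_onI)
  fix p q assume p: "p \<in> involutions n" and q: "q \<in> involutions n"
    and eq: "(\<lambda>i. diagram p i n) = (\<lambda>i. diagram q i n)"
  have perm: "p permutes {1..n}" "q permutes {1..n}" using p q by (auto simp: involutions_def)
  show "p = q"
  proof
    fix x
    show "p x = q x"
    proof (cases "x \<in> {1..n}")
      case True
      then have "p x \<in> {1..n}" using permutes_in_image[OF perm(1)] by simp
      then have *: "n - x < n" "n - p x < n" "n - (n - x) = x" "n - (n - p x) = p x" using True by auto
      show ?thesis
        using cross_diagram[OF p *(1,2)] cross_diagram[OF q *(1,2)] eq by (simp add: *)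
    next
      case False
      then show ?thesis using perm by (simp add: permutes_not_in)
    qed
  qed
qed

text \<open>The difference of the sizes on the two sides of the strip is 1 at the outer boundary,
  where \<open>c\<close> grows by one box, and 0 at the empty boundary; in between it drops by one
  at each cross.\<close>

lemma cross_unique:
  assumes c: "c \<in> shape_chains n" and a: "a < n"
  shows "\<exists>!b. b < n \<and> cross c n a b"
proof -
  define e where "e = (\<lambda>b. size_shape (codiagram c n a b) - size_shape (codiagram c n (Suc a) b))"
  have "e b - e (Suc b) = of_bool (cross c n a b)" for b
    using cell_size[OF codiagram_cell[OF c, of a b]] by (simp add: e_def)
  then have "(\<Sum>b<n. of_bool (cross c n a b)) = (\<Sum>b<n. e b - e (Suc b))" by simp
  also have "\<dots> = e 0 - e n" by (rule sum_lessThan_telescope')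
  also have "e n = 0"
    unfolding e_def by (subst (1 2) codiagram_sym) (simp add: codiagram_full[OF c])
  also have "e 0 = 1"
  proof -
    have "n - a = Suc (n - Suc a)" "n - Suc a < n" using a by auto
    moreover from this have "\<exists>r. c (Suc (n - Suc a)) = inc (c (n - Suc a)) r"
      using shape_chains_inc[OF c] by blast
    ultimately obtain r where "c (n - a) = inc (c (n - Suc a)) r" by auto
    then show ?thesis
      by (simp add: e_def codiagram_0_right shape_wsum_inc[OF shape_chains_shape[OF c]])
  qed
  finally have "int (card {b \<in> {..<n}. cross c n a b}) = 1"
    by (simp add: sum_of_bool_eq Int_def)
  then have "card {b \<in> {..<n}. cross c n a b} = 1" by simp
  then obtain b where "{b \<in> {..<n}. cross c n a b} = {b}" by (auto simp: card_1_singleton_iff)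
  then show ?thesis by (intro ex1I[of _ b]) auto
qed

text \<open>The crosses read backwards from \<open>c\<close> form a permutation matrix by
  \<open>cross_unique\<close>, and it is symmetric because \<open>c\<close> is put on both outer
  sides of the square. The forward rules applied to it retrace the same shapes.\<close>

lemma shape_chains_in_image:
  assumes c: "c \<in> shape_chains n"
  shows "\<exists>p\<in>involutions n. (\<lambda>i. diagram p i n) = c"
proof -
  define q where "q = (\<lambda>a. THE b. b < n \<and> cross c n a b)"
  have q: "q a < n \<and> cross c n a (q a)" if "a < n" for a
    unfolding q_def using theI'[OF cross_unique[OF c that]] .
  have q_eq: "q a = b" if "a < n" "b < n" "cross c n a b" for a b
    using q[OF that(1)] cross_unique[OF c that(1)] that by blast
  have qq: "q (q a) = a" if "a < n" for a
    using q[OF that] that by (intro q_eq) (auto simp: cross_sym)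
  \<comment> \<open>Backward indices count from the far corner: position \<open>x\<close> has index
    \<open>n - x\<close>, which runs through 0, ..., n - 1.\<close>
  define p where "p = (\<lambda>x. if x \<in> {1..n} then n - q (n - x) else x)"
  have r: "n - x < n" "n - (n - x) = x" if "x \<in> {1..n}" for x using that by auto
  have p_in: "p x \<in> {1..n}" if "x \<in> {1..n}" for x
    using q[OF r(1)[OF that]] that by (auto simp: p_def)
  have pp: "p (p x) = x" for x
  proof (cases "x \<in> {1..n}")
    case True
    have "n - (n - q (n - x)) = q (n - x)" using q[OF r(1)[OF True]] by simp
    then have "p (p x) = n - q (q (n - x))"
      using p_in[OF True] True by (simp add: p_def)
    then show ?thesis using qq[OF r(1)[OF True]] r(2)[OF True] by simp
  next
    case False
    then have "p x = x" unfolding p_def by (simp only: if_False)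
    then show ?thesis by simp
  qed
  have "p permutes {1..n}"
  proof (rule bij_imp_permutes)
    show "bij_betw p {1..n} {1..n}"
      by (rule bij_betw_byWitness[where f' = p]) (use pp p_in in auto)
  qed (auto simp: p_def)
  then have pI: "p \<in> involutions n" using pp by (auto simp: involutions_def)
  have G: "diagram p i j = codiagram c n (n - i) (n - j)" if "i \<le> n" "j \<le> n" for i j
    using that
  proof (induction i arbitrary: j)
    case 0
    then show ?case by (simp add: codiagram_full[OF c])
  next
    case (Suc i)
    note IH = Suc.IH and i = Suc.prems(1)
    show ?case
      using \<open>j \<le> n\<close>
    proof (induction j)
      case 0
      then show ?case by (subst codiagram_sym) (simp add: codiagram_full[OF c])
    next
      case (Suc j)
      define a b where "a = n - Suc i" and "b = n - Suc j"
      have ab: "a < n" "b < n" "Suc a = n - i" "Suc b = n - j" "n - a = Suc i" "n - b = Suc j"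
        using i Suc.prems by (auto simp: a_def b_def)
      have "p (Suc i) = Suc j \<longleftrightarrow> q a = b"
        using i Suc.prems q[OF ab(1)] by (auto simp: p_def a_def b_def)
      also have "\<dots> \<longleftrightarrow> cross c n a b"
        using q[OF ab(1)] q_eq[OF ab(1,2)] by blast
      finally have X: "p (Suc i) = Suc j \<longleftrightarrow> cross c n a b" .
      have "diagram p i j = codiagram c n (Suc a) (Suc b)"
        "diagram p i (Suc j) = codiagram c n (Suc a) b"
        "diagram p (Suc i) j = codiagram c n a (Suc b)"
        using IH[of j] IH[of "Suc j"] Suc i by (auto simp: ab(3,4) simp flip: a_def b_def)
      then show ?case
        using cell_grow[OF codiagram_cell[OF c, of a b]] by (simp add: X flip: a_def b_def)
    qed
  qed
  have "diagram p i n = c i" for i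
  proof (cases "i \<le> n")
    case True
    then show ?thesis using G[of i n] by (simp add: codiagram_0_right)
  next
    case False
    then show ?thesis
      using G[of n n] shape_chains_const[OF diagram_in_shape_chains[OF pI], of i] shape_chains_const[OF c, of i]
      by simp
  qed
  then show ?thesis using pI by blast
qed

lemma bij_betw_diagram: "bij_betw (\<lambda>p i. diagram p i n) (involutions n) (shape_chains n)"
proof (rule bij_betw_imageI[OF inj_on_diagram])
  show "(\<lambda>p i. diagram p i n) ` involutions n = shape_chains n"
  proof (intro equalityI subsetI)
    fix c assume "c \<in> shape_chains n"
    then obtain p where "p \<in> involutions n" "(\<lambda>i. diagram p i n) = c"
      using shape_chains_in_image by blast
    then show "c \<in> (\<lambda>p i. diagram p i n) ` involutions n" by (intro image_eqI) auto
  qed (auto intro: diagram_in_shape_chains)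
qed


section \<open>Counting chains of shapes\<close>

text \<open>Bounding row 0 limits the number of columns; this is how avoidance of the increasing
  pattern enters.\<close>

definition shapes :: "nat \<Rightarrow> nat \<Rightarrow> (nat \<Rightarrow> nat) set" where
  "shapes k n = {f. shape f \<and> f 0 \<le> k \<and> size_shape f = int n}"

text \<open>The column lengths of \<open>f\<close>, listed in increasing order and made distinct by adding \<open>0, \<dots>, k - 1\<close>.\<close>

definition beta :: "nat \<Rightarrow> (nat \<Rightarrow> nat) \<Rightarrow> nat \<Rightarrow> nat" where
  "beta k f = (\<lambda>j. if j < k then j + card {r. k \<le> f r + j} else 0)"

text \<open>Row \<open>r\<close> has as many boxes as there are columns longer than
  \<open>r\<close>, and column \<open>j\<close> has length \<open>l j - j\<close>.\<close>

definition unbeta :: "nat \<Rightarrow> (nat \<Rightarrow> nat) \<Rightarrow> nat \<Rightarrow> nat" where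
  "unbeta k l = (\<lambda>r. card {j. j < k \<and> r + j < l j})"

lemma down_closed_eq:
  fixes S :: "nat set"
  assumes "finite S" "\<And>x y. x \<in> S \<Longrightarrow> y < x \<Longrightarrow> y \<in> S"
  shows "S = {..<card S}"
proof (cases "S = {}")
  case False
  have "S = {..Max S}"
  proof (intro equalityI subsetI)
    fix y assume "y \<in> {..Max S}"
    then show "y \<in> S"
      using assms(2)[of "Max S" y] Max_in[OF assms(1) False] by (cases "y = Max S") auto
  qed (use assms(1) in auto)
  moreover from this have "card S = Suc (Max S)" by (metis card_atMost)
  ultimately show ?thesis by (simp add: lessThan_Suc_atMost)
qed simp

lemma shape_antimono: "shape f \<Longrightarrow> r \<le> s \<Longrightarrow> f s \<le> f r"
  by (rule lift_Suc_antimono_le) (auto simp: shape_def)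

lemma column_eq:
  assumes "shape f" "j < k"
  shows "{r. k \<le> f r + j} = {..<card {r. k \<le> f r + j}}"
proof (rule down_closed_eq)
  show "finite {r. k \<le> f r + j}"
    by (rule finite_subset[OF _ shape_finite[OF assms(1)]]) (use assms(2) in auto)
  fix r s assume "r \<in> {r. k \<le> f r + j}" "s < r"
  then show "s \<in> {r. k \<le> f r + j}"
    using shape_antimono[OF assms(1), of s r] by auto
qed

lemma column_iff:
  assumes "shape f" "j < k"
  shows "r < card {r. k \<le> f r + j} \<longleftrightarrow> k \<le> f r + j"
  using column_eq[OF assms] by blast

lemma card_columns:
  assumes "(m :: nat) \<le> k"
  shows "card {j. j < k \<and> k \<le> m + j} = m"
proof -
  have "{j. j < k \<and> k \<le> m + j} = {k - m..<k}" by auto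
  then show ?thesis using assms by simp
qed

lemma unbeta_beta:
  assumes "shape f" "f 0 \<le> k"
  shows "unbeta k (beta k f) = f"
proof
  fix r
  have "{j. j < k \<and> r + j < beta k f j} = {j. j < k \<and> k \<le> f r + j}"
    using column_iff[OF assms(1), of _ k r] by (auto simp: beta_def)
  moreover have "f r \<le> k" using shape_antimono[OF assms(1), of 0 r] assms(2) by simp
  ultimately show "unbeta k (beta k f) r = f r"
    by (simp add: unbeta_def card_columns)
qed

text \<open>Double counting of the boxes, each weighted according to its row.\<close>

lemma wsum_columns:
  assumes "shape f" "f 0 \<le> k"
  shows "wsum h f = (\<Sum>j<k. \<Sum>r<beta k f j - j. h r)"
proof -
  let ?S = "{r. f r \<noteq> 0}"
  have fin: "finite ?S" using assms(1) by (rule shape_finite)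
  have "wsum h f = (\<Sum>r\<in>?S. \<Sum>j<k. if k \<le> f r + j then h r else 0)"
    unfolding wsum_def
  proof (rule sum.cong[OF refl])
    fix r
    have "f r \<le> k" using shape_antimono[OF assms(1), of 0 r] assms(2) by simp
    then have "int (f r) = (\<Sum>j | j < k \<and> k \<le> f r + j. 1)"
      using card_columns[of "f r" k] by simp
    then have "h r * int (f r) = (\<Sum>j\<in>{j \<in> {..<k}. k \<le> f r + j}. h r)"
      by (simp add: card_columns \<open>f r \<le> k\<close>)
    then show "h r * int (f r) = (\<Sum>j<k. if k \<le> f r + j then h r else 0)"
      by (simp only: sum.inter_filter[OF finite_lessThan])
  qed
  also have "\<dots> = (\<Sum>j<k. \<Sum>r\<in>?S. if k \<le> f r + j then h r else 0)"
    by (rule sum.swap)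
  also have "\<dots> = (\<Sum>j<k. \<Sum>r<beta k f j - j. h r)"
  proof (rule sum.cong[OF refl])
    fix j assume j: "j \<in> {..<k}"
    have "(\<Sum>r\<in>?S. if k \<le> f r + j then h r else 0) = (\<Sum>r\<in>{r \<in> ?S. k \<le> f r + j}. h r)"
      by (rule sum.inter_filter[OF fin, symmetric])
    also have "{r \<in> ?S. k \<le> f r + j} = {r. k \<le> f r + j}" using j by auto
    also have "\<dots> = {..<beta k f j - j}"
      using column_eq[OF assms(1), of j k] j by (simp add: beta_def)
    finally show "(\<Sum>r\<in>?S. if k \<le> f r + j then h r else 0) = (\<Sum>r<beta k f j - j. h r)" .
  qed
  finally show ?thesis .
qed

lemma beta_ge: "j < k \<Longrightarrow> j \<le> beta k f j"
  by (simp add: beta_def)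

lemma sum_diff_columns:
  assumes "\<And>j. j < k \<Longrightarrow> j \<le> l j"
  shows "(\<Sum>j<k. int (l j - j)) = int (\<Sum>j<k. l j) - int (choose2 k)"
proof -
  have "(\<Sum>j<k. int (l j - j)) = (\<Sum>j<k. int (l j) - int j)"
    using assms by (intro sum.cong refl) (auto simp: of_nat_diff)
  then show ?thesis by (simp add: sum_subtractf choose2_def)
qed

lemma beta_in_chamber:
  assumes "f \<in> shapes k n"
  shows "beta k f \<in> chamber k (n + choose2 k)"
proof -
  have f: "shape f" "f 0 \<le> k" "size_shape f = int n" using assms by (auto simp: shapes_def)
  have "int (\<Sum>j<k. beta k f j) = int n + int (choose2 k)"
    using wsum_columns[OF f(1,2), of "\<lambda>_. 1"] f(3) sum_diff_columns[of k "beta k f"] beta_ge by simp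
  then have "(\<Sum>j<k. beta k f j) = n + choose2 k"
    by (metis of_nat_add of_nat_eq_iff)
  moreover have "beta k f m < beta k f i" if "m < i" "i < k" for i m
  proof -
    have "card {r. k \<le> f r + m} \<le> card {r. k \<le> f r + i}"
      by (rule card_mono, subst column_eq[OF f(1) that(2)]) (use that in auto)
    then show ?thesis using that by (simp add: beta_def)
  qed
  ultimately show ?thesis
    by (auto simp: chamber_def comps_def) (simp add: beta_def)
qed

lemma chamber_gap:
  assumes "l \<in> chamber k N" "a \<le> b" "b < k"
  shows "l a + (b - a) \<le> l b"
  using assms(2,3)
proof (induction b rule: dec_induct)
  case (step b)
  have "l b < l (Suc b)" using assms(1) step by (auto simp: chamber_def)
  then show ?case using step by simp
qed simp

lemma chamber_ge: "l \<in> chamber k N \<Longrightarrow> j < k \<Longrightarrow> j \<le> l j"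
  using chamber_gap[of l k N 0 j] by simp

lemma beta_unbeta:
  assumes l: "l \<in> chamber k N"
  shows "beta k (unbeta k l) = l"
proof
  fix j
  show "beta k (unbeta k l) j = l j"
  proof (cases "j < k")
    case True
    \<comment> \<open>The lengths \<open>l j - j\<close> increase weakly with \<open>j\<close>, so
      the columns longer than \<open>r\<close> form a final segment of the indices, which contains
      \<open>j\<close> exactly when it has at least \<open>k - j\<close> elements.\<close>
    have iff: "k \<le> unbeta k l r + j \<longleftrightarrow> r + j < l j" for r
    proof
      assume "r + j < l j"
      have "{j..<k} \<subseteq> {i. i < k \<and> r + i < l i}"
      proof
        fix i assume "i \<in> {j..<k}"
        then show "i \<in> {i. i < k \<and> r + i < l i}"
          using chamber_gap[OF l, of j i] \<open>r + j < l j\<close> by auto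
      qed
      then have "card {j..<k} \<le> unbeta k l r"
        unfolding unbeta_def by (intro card_mono) auto
      then show "k \<le> unbeta k l r + j" by simp
    next
      assume "k \<le> unbeta k l r + j"
      show "r + j < l j"
      proof (rule ccontr)
        assume n: "\<not> r + j < l j"
        have "{i. i < k \<and> r + i < l i} \<subseteq> {Suc j..<k}"
        proof
          fix i assume i: "i \<in> {i. i < k \<and> r + i < l i}"
          have "j < i"
          proof (rule ccontr)
            assume "\<not> j < i"
            then show False using chamber_gap[OF l, of i j] True n i by auto
          qed
          then show "i \<in> {Suc j..<k}" using i by auto
        qed
        then have "unbeta k l r \<le> card {Suc j..<k}"
          unfolding unbeta_def by (intro card_mono) auto
        then show False using \<open>k \<le> unbeta k l r + j\<close> True by simp
      qed
    qed
    have "{r. k \<le> unbeta k l r + j} = {..<l j - j}"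
      unfolding iff by auto
    then show ?thesis using True chamber_ge[OF l True] by (simp add: beta_def)
  next
    case False
    then show ?thesis using l by (auto simp: beta_def chamber_def comps_def)
  qed
qed

lemma unbeta_in_shapes:
  assumes l: "l \<in> chamber k (n + choose2 k)"
  shows "unbeta k l \<in> shapes k n"
proof -
  have sh: "shape (unbeta k l)"
  proof (rule shapeI)
    fix r show "unbeta k l (Suc r) \<le> unbeta k l r"
      unfolding unbeta_def by (intro card_mono) auto
    have "l j \<le> n + choose2 k" if "j < k" for j
      using l that member_le_sum[of j "{..<k}" l] by (auto simp: chamber_def comps_def)
    then have "{j. j < k \<and> r + j < l j} = {}" if "r > n + choose2 k" for r
      using that by fastforce
    then have "unbeta k l r = 0" if "r > n + choose2 k" for r
      using that by (simp only: unbeta_def) simp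
    then have "{r. unbeta k l r \<noteq> 0} \<subseteq> {..n + choose2 k}"
      by (auto simp: not_less[symmetric])
    then show "finite {r. unbeta k l r \<noteq> 0}" by (rule finite_subset) simp
  qed
  have "card {j. j < k \<and> 0 + j < l j} \<le> card {..<k}"
    by (intro card_mono) auto
  then have le: "unbeta k l 0 \<le> k" by (simp add: unbeta_def)
  have "(\<Sum>j<k. l j) = n + choose2 k" using l by (simp add: chamber_def comps_def)
  then have "size_shape (unbeta k l) = int n"
    using wsum_columns[OF sh le, of "\<lambda>_. 1"] sum_diff_columns[of k l] chamber_ge[OF l]
    by (simp add: beta_unbeta[OF l])
  then show ?thesis using sh le by (simp add: shapes_def)
qed

lemma bij_betw_beta: "bij_betw (beta k) (shapes k n) (chamber k (n + choose2 k))"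
proof (rule bij_betw_byWitness[where f' = "unbeta k"])
  show "\<forall>f\<in>shapes k n. unbeta k (beta k f) = f"
    by (auto simp: shapes_def unbeta_beta)
qed (use beta_unbeta beta_in_chamber unbeta_in_shapes in blast)+

lemma finite_shapes: "finite (shapes k n)"
  using bij_betw_finite[OF bij_betw_beta] finite_chamber by blast

text \<open>A column of height \<open>h\<close> contributes \<open>h\<close> alternating signs
  starting with 1, which sum to 1 for odd \<open>h\<close> and to 0 for even
  \<open>h\<close>.\<close>

lemma alt_columns:
  assumes "f \<in> shapes k n"
  shows "alt_shape f = int (card (oddset k (beta k f)))"
proof -
  have f: "shape f" "f 0 \<le> k" using assms by (auto simp: shapes_def)
  have *: "(\<Sum>r<h. (- 1) ^ r) = (of_bool (odd h) :: int)" for h :: nat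
    by (induction h) auto
  have "alt_shape f = (\<Sum>j<k. of_bool (odd (beta k f j - j)))"
    by (simp add: wsum_columns[OF f] *)
  also have "\<dots> = int (card {j \<in> {..<k}. odd (beta k f j - j)})"
    by (simp add: sum_of_bool_eq Int_def)
  also have "{j \<in> {..<k}. odd (beta k f j - j)} = oddset k (beta k f)"
  proof -
    have "odd (beta k f j - j) \<longleftrightarrow> odd (beta k f j + j)" if "j < k" for j
      using beta_ge[OF that, of f] by (simp add: even_diff_nat)
    then show ?thesis by (auto simp: oddset_def)
  qed
  finally show ?thesis .
qed

text \<open>The new box lies in column \<open>f r + 1\<close>, counted from 1; index
  \<open>j\<close> stands for column \<open>k - j\<close>, which gives
  \<open>k - 1 - f r\<close>.\<close>

lemma beta_inc:
  assumes "shape f" "f r < k"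
  shows "beta k (inc f r) = inc (beta k f) (k - 1 - f r)"
proof
  fix j
  show "beta k (inc f r) j = inc (beta k f) (k - 1 - f r) j"
  proof (cases "j < k")
    case True
    have fin: "finite {s. k \<le> f s + j}"
      by (subst column_eq[OF assms(1) True]) simp
    show ?thesis
    proof (cases "j = k - 1 - f r")
      case eq: True
      have "{s. k \<le> inc f r s + j} = insert r {s. k \<le> f s + j}"
        using eq assms by (auto simp: inc_apply)
      moreover have "r \<notin> {s. k \<le> f s + j}" using eq assms by auto
      ultimately show ?thesis using True eq fin by (simp add: beta_def inc_apply)
    next
      case neq: False
      have "{s. k \<le> inc f r s + j} = {s. k \<le> f s + j}"
        using neq assms by (auto simp: inc_apply)
      then show ?thesis using True neq by (simp add: beta_def inc_apply)
    qed
  next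
    case False
    then show ?thesis using assms by (auto simp: beta_def inc_apply)
  qed
qed

text \<open>Column \<open>i\<close> occupies the rows before \<open>l i - i\<close>, so its new box
  lies in row \<open>l i - i\<close>.\<close>

lemma unbeta_inc:
  assumes "l \<in> chamber k N" "i < k"
  shows "unbeta k (inc l i) = inc (unbeta k l) (l i - i)"
proof
  fix r
  have le: "i \<le> l i" using assms by (rule chamber_ge)
  show "unbeta k (inc l i) r = inc (unbeta k l) (l i - i) r"
  proof (cases "r = l i - i")
    case True
    have "{j. j < k \<and> r + j < inc l i j} = insert i {j. j < k \<and> r + j < l j}"
      using True le assms(2) by (auto simp: inc_apply)
    moreover have "i \<notin> {j. j < k \<and> r + j < l j}" using True le by auto
    ultimately show ?thesis using True by (simp add: unbeta_def inc_apply)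
  next
    case False
    have "{j. j < k \<and> r + j < inc l i j} = {j. j < k \<and> r + j < l j}"
      using False le by (auto simp: inc_apply)
    then show ?thesis using False by (simp add: unbeta_def inc_apply)
  qed
qed

section \<open>Recursion for the number of chains\<close>

definition chain_count :: "nat \<Rightarrow> (nat \<Rightarrow> nat) \<Rightarrow> nat" where
  "chain_count n f = card {c \<in> shape_chains n. c n = f}"

lemma finite_shape_chains: "finite (shape_chains n)"
proof -
  have "finite (involutions n)"
    by (rule finite_subset[OF _ finite_permutations[of "{1..n}"]]) (auto simp: involutions_def)
  then show ?thesis using bij_betw_finite[OF bij_betw_diagram] by blast
qed

lemma chain_count_Suc:
  assumes f: "f \<in> shapes k (Suc n)"
  shows "chain_count (Suc n) f = (\<Sum>g | g \<in> shapes k n \<and> (\<exists>r. f = inc g r). chain_count n g)"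
proof -
  let ?P = "{g. g \<in> shapes k n \<and> (\<exists>r. f = inc g r)}"
  let ?A = "{c \<in> shape_chains (Suc n). c (Suc n) = f}"
  let ?B = "\<Union>g\<in>?P. {c \<in> shape_chains n. c n = g}"
  \<comment> \<open>Composition with \<open>min i n\<close> drops the last shape and keeps the
    sequence constant from \<open>n\<close> on.\<close>
  have "bij_betw (\<lambda>c i. c (min i n)) ?A ?B"
  proof (rule bij_betw_byWitness[where f' = "\<lambda>c i. if i \<le> n then c i else f"])
    show "\<forall>c\<in>?A. (\<lambda>i. if i \<le> n then c (min i n) else f) = c"
    proof
      fix c assume c: "c \<in> ?A"
      then have "c i = f" if "Suc n \<le> i" for i
        using shape_chains_const[of c "Suc n" i] that by auto
      then show "(\<lambda>i. if i \<le> n then c (min i n) else f) = c"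
        by (auto simp: fun_eq_iff min_def)
    qed
    show "\<forall>c\<in>?B. (\<lambda>i. if min i n \<le> n then c (min i n) else f) = c"
    proof
      fix c assume "c \<in> ?B"
      then have "c \<in> shape_chains n" by auto
      then have eq: "c i = c n" if "n \<le> i" for i
        using that by (rule shape_chains_const)
      have "c (min i n) = c i" for i
        using eq[of i] by (cases "n \<le> i") (simp_all add: min_def)
      then show "(\<lambda>i. if min i n \<le> n then c (min i n) else f) = c"
        by simp
    qed
    show "(\<lambda>c i. c (min i n)) ` ?A \<subseteq> ?B"
    proof
      fix d assume "d \<in> (\<lambda>c i. c (min i n)) ` ?A"
      then obtain c where c: "c \<in> shape_chains (Suc n)" "c (Suc n) = f" and d: "d = (\<lambda>i. c (min i n))" by auto
      have sh: "shape (c i)" for i using c(1) by (rule shape_chains_shape)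
      obtain r where r: "f = inc (c n) r" using shape_chains_inc[OF c(1), of n] c(2) by auto
      have "c n \<in> shapes k n"
      proof -
        have "c n 0 \<le> f 0" unfolding r by (simp add: inc_apply)
        then show ?thesis
          using f shape_wsum_inc[OF sh, of "\<lambda>_. 1" n r] sh unfolding r by (auto simp: shapes_def)
      qed
      moreover have "d \<in> shape_chains n"
        unfolding shape_chains_def mem_Collect_eq
      proof (intro conjI allI impI)
        show "d 0 = (\<lambda>_. 0)" using shape_chains_0[OF c(1)] by (simp add: d)
        fix i assume "i < n"
        then show "shape (d (Suc i))" "\<exists>r. d (Suc i) = inc (d i) r"
          using sh shape_chains_inc[OF c(1), of i] by (auto simp: d)
      qed (simp add: d)
      ultimately show "d \<in> ?B" using r by (auto simp: d)
    qed
    show "(\<lambda>c i. if i \<le> n then c i else f) ` ?B \<subseteq> ?A"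
    proof
      fix d assume "d \<in> (\<lambda>c i. if i \<le> n then c i else f) ` ?B"
      then obtain c r where c: "c \<in> shape_chains n" and r: "f = inc (c n) r"
        and d: "d = (\<lambda>i. if i \<le> n then c i else f)" by auto
      have "d \<in> shape_chains (Suc n)"
        unfolding shape_chains_def mem_Collect_eq
      proof (intro conjI allI impI)
        show "d 0 = (\<lambda>_. 0)" using shape_chains_0[OF c] by (simp add: d)
        fix i assume "i < Suc n"
        then show "shape (d (Suc i))"
          using shape_chains_shape[OF c] f by (auto simp: d shapes_def)
        show "\<exists>r. d (Suc i) = inc (d i) r"
        proof (cases "i = n")
          case True
          then show ?thesis using r by (auto simp: d)
        next
          case False
          then show ?thesis using shape_chains_inc[OF c, of i] \<open>i < Suc n\<close> by (simp add: d)
        qed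
      qed (simp add: d)
      then show "d \<in> ?A" by (simp add: d)
    qed
  qed
  then have "chain_count (Suc n) f = card ?B"
    unfolding chain_count_def by (rule bij_betw_same_card)
  also have "\<dots> = (\<Sum>g\<in>?P. card {c \<in> shape_chains n. c n = g})"
    using finite_shapes finite_shape_chains by (intro card_UN_disjoint) auto
  finally show ?thesis by (simp add: chain_count_def)
qed

text \<open>At the staircase the Vandermonde product is the product of the factorials that form the
  denominator of \<open>wt\<close>; this is the base case of the count.\<close>

lemma vand_staircase:
  "wt k (\<lambda>j. if j < k then j else 0) * vand k (\<lambda>j. if j < k then j else 0) = 1"
proof -
  have "vand k (\<lambda>j. if j < k then j else 0) = (\<Prod>i<k. fact i)"
    unfolding vandermonde_def
  proof (rule prod.cong[OF refl])
    fix i assume "i \<in> {..<k}"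
    then have "(\<Prod>m<i. real (if i < k then i else 0) - real (if m < k then m else 0)) = (\<Prod>m<i. real (i - m))"
      by (intro prod.cong refl) (auto simp: of_nat_diff)
    then show "(\<Prod>m<i. real (if i < k then i else 0) - real (if m < k then m else 0)) = fact i"
      by (simp add: fact_prod_rev lessThan_atLeast0)
  qed
  moreover have "(\<Prod>j<k. fact (if j < k then j else 0)) = (\<Prod>i<k. fact i :: real)"
    by (intro prod.cong) auto
  ultimately show ?thesis by (simp add: wt_def)
qed

lemma shapes_0: "shapes k 0 = {\<lambda>_. 0}"
proof (intro equalityI subsetI)
  fix f assume "f \<in> shapes k 0"
  then have f: "shape f" "size_shape f = 0" by (auto simp: shapes_def)
  have "f r = 0" for r
  proof (rule ccontr)
    assume "f r \<noteq> 0"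
    then have "int (f r) \<le> size_shape f"
      unfolding wsum_def using shape_finite[OF f(1)]
      by (intro order_trans[OF _ member_le_sum[of r "{r. f r \<noteq> 0}" "\<lambda>r. 1 * int (f r)"]]) auto
    then show False using f(2) \<open>f r \<noteq> 0\<close> by simp
  qed
  then show "f \<in> {\<lambda>_. 0}" by auto
qed (auto simp: shapes_def shape_0 wsum_def)

text \<open>The Frame--Robinson--Thrall number of standard Young tableaux of shape \<open>f\<close>, in terms of the
  shifted column lengths.\<close>

lemma chain_count_eq:
  "f \<in> shapes k n \<Longrightarrow> real (chain_count n f) = fact n * (wt k (beta k f) * vand k (beta k f))"
proof (induction n arbitrary: f)
  case 0
  have f: "f = (\<lambda>_. 0)" using 0 shapes_0 by blast
  have "shape_chains 0 = {\<lambda>_ _. 0}"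
  proof (intro equalityI subsetI)
    fix c assume "c \<in> shape_chains 0"
    then have "c i = (\<lambda>_. 0)" for i using shape_chains_const[of c 0 i] shape_chains_0[of c 0] by simp
    then show "c \<in> {\<lambda>_ _. 0}" by auto
  qed (auto simp: shape_chains_def)
  then have "{c \<in> shape_chains 0. c 0 = f} = {\<lambda>_ _. 0}" using f by auto
  then have "chain_count 0 f = 1" by (simp add: chain_count_def)
  moreover have "beta k f = (\<lambda>j. if j < k then j else 0)"
    by (auto simp: beta_def f)
  ultimately show ?case using vand_staircase[of k] by simp
next
  case (Suc n)
  let ?N = "n + choose2 k"
  define l where "l = beta k f"
  define q where "q = (\<lambda>l. wt k l * vand k l)"
  have l: "l \<in> chamber k (Suc ?N)" using beta_in_chamber[OF Suc.prems] by (simp add: l_def)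
  have f: "shape f" "f 0 \<le> k" using Suc.prems by (auto simp: shapes_def)
  let ?P = "{g. g \<in> shapes k n \<and> (\<exists>r. f = inc g r)}"
  let ?L = "{l' \<in> chamber k ?N. \<exists>i<k. l = inc l' i}"
  \<comment> \<open>Removing a box from the shape corresponds to lowering one coordinate of the
    shifted column lengths.\<close>
  have "bij_betw (beta k) ?P ?L"
  proof (rule bij_betw_byWitness[where f' = "unbeta k"])
    show "beta k ` ?P \<subseteq> ?L"
    proof
      fix l' assume "l' \<in> beta k ` ?P"
      then obtain g r where g: "g \<in> shapes k n" "f = inc g r" "l' = beta k g" by auto
      have "f r \<le> k" using shape_antimono[OF f(1), of 0 r] f(2) by simp
      then have "g r < k" using g(2) by (simp add: inc_apply)
      then have "l = inc l' (k - 1 - g r)" "k - 1 - g r < k"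
        using beta_inc[of g r k] g by (auto simp: l_def shapes_def)
      then show "l' \<in> ?L" using beta_in_chamber[OF g(1)] g(3) by blast
    qed
    show "unbeta k ` ?L \<subseteq> ?P"
    proof
      fix g assume "g \<in> unbeta k ` ?L"
      then obtain l' i where l': "l' \<in> chamber k ?N" "i < k" "l = inc l' i" "g = unbeta k l'" by auto
      have "f = inc g (l' i - i)"
        using unbeta_inc[OF l'(1,2)] unbeta_beta[OF f] l'(3,4) by (simp add: l_def)
      then show "g \<in> ?P" using unbeta_in_shapes[OF l'(1)] l'(4) by blast
    qed
  qed (auto simp: unbeta_beta beta_unbeta shapes_def)
  then have "(\<Sum>g\<in>?P. q (beta k g)) = (\<Sum>l'\<in>?L. q l')"
    by (rule sum.reindex_bij_betw)
  also have "\<dots> = (\<Sum>i | i < k \<and> l i \<noteq> 0 \<and> l(i := l i - 1) \<in> chamber k ?N. q (l(i := l i - 1)))"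
    (is "_ = sum _ ?I")
  proof (rule sum.reindex_bij_betw[symmetric], rule bij_betw_imageI)
    show "inj_on (\<lambda>i. l(i := l i - 1)) ?I"
    proof (rule inj_onI)
      fix i j assume "i \<in> ?I" and j: "j \<in> ?I" and eq: "l(i := l i - 1) = l(j := l j - 1)"
      then have i: "l i \<noteq> 0" by simp
      show "i = j"
        using fun_cong[OF eq, of i] i by (auto split: if_splits)
    qed
    show "(\<lambda>i. l(i := l i - 1)) ` ?I = ?L"
    proof (intro equalityI subsetI)
      fix l' assume "l' \<in> (\<lambda>i. l(i := l i - 1)) ` ?I"
      then obtain i where i: "i < k" "l i \<noteq> 0" "l' \<in> chamber k ?N" "l' = l(i := l i - 1)" by auto
      then have "l = inc l' i" by (auto simp: inc_def)
      then show "l' \<in> ?L" using i by blast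
    next
      fix l' assume "l' \<in> ?L"
      then obtain i where i: "i < k" "l' \<in> chamber k ?N" "l = inc l' i" by auto
      then have "l' = l(i := l i - 1)" "l i \<noteq> 0" by (auto simp: inc_def)
      then show "l' \<in> (\<lambda>i. l(i := l i - 1)) ` ?I" using i by blast
    qed
  qed
  also have "\<dots> = (\<Sum>i\<in>?I. wt k l * (real (l i) * vand k (l(i := l i - 1))))"
  proof (rule sum.cong[OF refl])
    fix i assume i: "i \<in> ?I"
    then have "l = inc (l(i := l i - 1)) i" by (auto simp: inc_def)
    then have "wt k l = wt k (l(i := l i - 1)) / (real (l i - 1) + 1)"
      using wt_inc[of i k "l(i := l i - 1)"] i by simp
    then have "wt k (l(i := l i - 1)) = wt k l * real (l i)"
      using i by (simp add: of_nat_diff)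
    then show "q (l(i := l i - 1)) = wt k l * (real (l i) * vand k (l(i := l i - 1)))"
      by (simp add: q_def)
  qed
  also have "\<dots> = (\<Sum>i<k. wt k l * (real (l i) * vand k (l(i := l i - 1))))"
  proof (rule sum.mono_neutral_left)
    \<comment> \<open>The coordinates left out contribute nothing: either \<open>l i = 0\<close>, or
      lowering it leads onto a wall.\<close>
    show "\<forall>i\<in>{..<k} - ?I. wt k l * (real (l i) * vand k (l(i := l i - 1))) = 0"
    proof
      fix i assume i: "i \<in> {..<k} - ?I"
      show "wt k l * (real (l i) * vand k (l(i := l i - 1))) = 0"
      proof (cases "l i = 0")
        case False
        let ?u = "l(i := l i - 1)"
        have "l \<in> {l \<in> comps k (Suc ?N). l i \<noteq> 0}" using l False by (auto simp: chamber_def)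
        then obtain u where u: "u \<in> comps k ?N" "l = inc u i"
          using inc_image[of i k ?N] i by blast
        then have "?u = u" by (auto simp: inc_def)
        then have "?u \<in> comps k ?N" using u by simp
        moreover have "?u \<notin> chamber k ?N" using i False by auto
        moreover have "?u m \<le> ?u j" if "m < j" "j < k" for j m
        proof -
          have "l m < l j" using l that by (auto simp: chamber_def)
          then show ?thesis by auto
        qed
        ultimately have "vand k ?u = 0" by (rule vand_weak_chamber)
        then show ?thesis by simp
      qed simp
    qed
  qed auto
  \<comment> \<open>The level is \<open>Suc n + choose2 k\<close>, so the factor of the recursion is
    \<open>Suc n\<close>, which completes the factorial.\<close>
  also have "\<dots> = wt k l * ((real (Suc ?N) - real (choose2 k)) * vand k l)"
    using vand_recursion[of l k "Suc ?N"] l by (simp add: chamber_def sum_distrib_left)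
  also have "\<dots> = real (Suc n) * q l" by (simp add: q_def)
  finally have main: "(\<Sum>g\<in>?P. q (beta k g)) = real (Suc n) * q l" .
  have "real (chain_count (Suc n) f) = (\<Sum>g\<in>?P. fact n * q (beta k g))"
    unfolding chain_count_Suc[OF Suc.prems] of_nat_sum by (intro sum.cong refl) (auto simp: Suc.IH q_def)
  also have "\<dots> = fact n * (real (Suc n) * q l)"
    by (simp only: main flip: sum_distrib_left)
  finally show ?case by (simp add: q_def l_def algebra_simps)
qed


section \<open>The law of the number of fixed points\<close>

text \<open>An occurrence of the increasing pattern is determined by its set of positions, and the
  embedding is recovered by listing that set in increasing order.\<close>

lemma contains_increasing_iff:
  assumes p: "p permutes {1..n}"
  shows "contains_pattern n p m increasing_pattern \<longleftrightarrow> (\<exists>S. increasing_in p n n S \<and> card S = m)"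
proof
  assume "contains_pattern n p m increasing_pattern"
  then obtain f where f: "f ` {1..m} \<subseteq> {1..n}" "strict_mono_on {1..m} f"
      "\<forall>a\<in>{1..m}. \<forall>b\<in>{1..m}. p (f a) < p (f b) \<longleftrightarrow> a < b"
    by (auto simp: contains_pattern_def increasing_pattern_def)
  have "strict_mono_on (f ` {1..m}) p"
  proof (rule strict_mono_onI)
    fix x y assume "x \<in> f ` {1..m}" "y \<in> f ` {1..m}" "x < y"
    then obtain a b where ab: "a \<in> {1..m}" "b \<in> {1..m}" "x = f a" "y = f b" by auto
    have "a < b"
    proof (rule ccontr)
      assume "\<not> a < b"
      then have "f b \<le> f a"
        using strict_mono_onD[OF f(2) ab(2,1)] by (cases "a = b") auto
      then show False using ab \<open>x < y\<close> by simp
    qed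
    then show "p x < p y" using f(3) ab by blast
  qed
  moreover have "p ` f ` {1..m} \<subseteq> {1..n}"
    using f(1) permutes_in_image[OF p] by blast
  moreover have "card (f ` {1..m}) = m"
    using card_image[OF strict_mono_on_imp_inj_on[OF f(2)]] by simp
  ultimately show "\<exists>S. increasing_in p n n S \<and> card S = m"
    using f(1) by (intro exI[of _ "f ` {1..m}"]) (simp add: increasing_in_def)
next
  assume "\<exists>S. increasing_in p n n S \<and> card S = m"
  then obtain S where S: "S \<subseteq> {1..n}" "strict_mono_on S p" "card S = m"
    by (auto simp: increasing_in_def)
  have fin: "finite S" using S(1) by (rule finite_subset) simp
  obtain h where h: "bij_betw h {..<card S} S" "strict_mono_on {..<card S} h"
    using ex_bij_betw_strict_mono_card[OF fin] by blast
  \<comment> \<open>\<open>h\<close> is indexed from 0, positions of a pattern from 1.\<close>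
  define f where "f = (\<lambda>a. h (a - 1))"
  have fS: "f a \<in> S" if "a \<in> {1..m}" for a
    using bij_betwE[OF h(1)] that S(3) by (auto simp: f_def)
  have mono: "f a < f b" if "a \<in> {1..m}" "b \<in> {1..m}" "a < b" for a b
    unfolding f_def using that S(3) by (intro strict_mono_onD[OF h(2)]) auto
  have pmono: "p (f a) < p (f b)" if "a \<in> {1..m}" "b \<in> {1..m}" "a < b" for a b
    using that by (intro strict_mono_onD[OF S(2)] fS mono)
  have "p (f a) < p (f b) \<longleftrightarrow> a < b" if "a \<in> {1..m}" "b \<in> {1..m}" for a b
    using pmono[OF that] pmono[OF that(2,1)] by (cases a b rule: linorder_cases) auto
  then show "contains_pattern n p m increasing_pattern"
    unfolding contains_pattern_def increasing_pattern_def
    using fS S(1) mono by (intro exI[of _ f]) (auto intro!: strict_mono_onI)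
qed

lemma Iv_eq: "Iv n (Suc k) increasing_pattern = {p \<in> involutions n. diagram p n n 0 \<le> k}"
proof -
  have "p \<in> Iv n (Suc k) increasing_pattern \<longleftrightarrow> p \<in> involutions n \<and> diagram p n n 0 \<le> k" for p
  proof (cases "p permutes {1..n}")
    case True
    have "Hilbert_Choice.inv p = p \<longleftrightarrow> (\<forall>x. p (p x) = x)"
      using permutes_inverses[OF True] permutes_inj[OF True] by (metis inv_equality)
    moreover have "contains_pattern n p (Suc k) increasing_pattern \<longleftrightarrow> Suc k \<le> diagram p n n 0"
      unfolding contains_increasing_iff[OF True] row_0_diagram[OF permutes_inj[OF True]] ..
    ultimately show ?thesis
      using True by (auto simp: Iv_def involutions_def)
  qed (auto simp: Iv_def involutions_def)
  then show ?thesis by blast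
qed

lemma fp_eq_alt: "p \<in> involutions n \<Longrightarrow> int (fp n p) = alt_shape (diagram p n n)"
  unfolding fp_def by (rule alt_diagram[symmetric]) (auto intro: involutions_inj involutions_sym)

lemma size_shape_chains:
  assumes c: "c \<in> shape_chains n"
  shows "i \<le> n \<Longrightarrow> size_shape (c i) = int i"
proof (induction i)
  case 0
  then show ?case by (simp add: shape_chains_0[OF c] wsum_def)
next
  case (Suc i)
  then obtain r where "c (Suc i) = inc (c i) r"
    using shape_chains_inc[OF c, of i] by auto
  then show ?case using Suc shape_wsum_inc[OF shape_chains_shape[OF c]] by simp
qed

text \<open>The predicate \<open>P\<close> lets one argument serve both the total count and the
  count at a given number of fixed points.\<close>

lemma card_Iv_shapes:
  "card {p \<in> Iv n (Suc k) increasing_pattern. P (alt_shape (diagram p n n))}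
     = (\<Sum>f | f \<in> shapes k n \<and> P (alt_shape f). chain_count n f)"
proof -
  let ?A = "{p \<in> Iv n (Suc k) increasing_pattern. P (alt_shape (diagram p n n))}"
  let ?B = "{c \<in> shape_chains n. c n \<in> {f. f \<in> shapes k n \<and> P (alt_shape f)}}"
  have "bij_betw (\<lambda>p i. diagram p i n) ?A ?B"
  proof (rule bij_betw_subset[OF bij_betw_diagram])
    show "?A \<subseteq> involutions n" by (auto simp: Iv_eq)
    show "(\<lambda>p i. diagram p i n) ` ?A = ?B"
    proof (intro equalityI subsetI)
      fix c assume "c \<in> (\<lambda>p i. diagram p i n) ` ?A"
      then obtain p where p: "p \<in> involutions n" "diagram p n n 0 \<le> k" "P (alt_shape (diagram p n n))"
        and c: "c = (\<lambda>i. diagram p i n)" by (auto simp: Iv_eq)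
      have ch: "c \<in> shape_chains n" unfolding c by (rule diagram_in_shape_chains[OF p(1)])
      then show "c \<in> ?B"
        using p shape_chains_shape[OF ch, of n] size_shape_chains[OF ch, of n] by (simp add: shapes_def c)
    next
      fix c assume c: "c \<in> ?B"
      then obtain p where "p \<in> involutions n" "(\<lambda>i. diagram p i n) = c"
        using shape_chains_in_image by blast
      moreover from this have "diagram p n n = c n" by auto
      ultimately show "c \<in> (\<lambda>p i. diagram p i n) ` ?A"
        using c by (intro image_eqI[of _ _ p]) (auto simp: Iv_eq shapes_def)
    qed
  qed
  then have "card ?A = card ?B" by (rule bij_betw_same_card)
  also have "?B = (\<Union>f\<in>{f. f \<in> shapes k n \<and> P (alt_shape f)}. {c \<in> shape_chains n. c n = f})" by auto
  also have "card \<dots> = (\<Sum>f | f \<in> shapes k n \<and> P (alt_shape f). card {c \<in> shape_chains n. c n = f})"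
    using finite_shapes finite_shape_chains by (intro card_UN_disjoint) auto
  finally show ?thesis by (simp add: chain_count_def)
qed

lemma sum_chain_count:
  "real (\<Sum>f | f \<in> shapes k n \<and> P (alt_shape f). chain_count n f)
     = fact n * (\<Sum>l | l \<in> chamber k (n + choose2 k) \<and> P (int (card (oddset k l))). wt k l * vand k l)"
proof -
  let ?S = "{f. f \<in> shapes k n \<and> P (alt_shape f)}"
  let ?L = "{l. l \<in> chamber k (n + choose2 k) \<and> P (int (card (oddset k l)))}"
  have bij: "bij_betw (beta k) ?S ?L"
  proof (rule bij_betw_subset[OF bij_betw_beta])
    show "beta k ` ?S = ?L"
    proof (intro equalityI subsetI)
      fix l assume l: "l \<in> ?L"
      have "unbeta k l \<in> shapes k n" using l by (auto intro: unbeta_in_shapes)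
      moreover have "beta k (unbeta k l) = l" using l by (auto intro: beta_unbeta)
      ultimately show "l \<in> beta k ` ?S"
        using l alt_columns[of "unbeta k l" k n] by (intro image_eqI[of _ _ "unbeta k l"]) auto
    qed (auto simp: alt_columns intro: beta_in_chamber)
  qed auto
  have "real (\<Sum>f\<in>?S. chain_count n f) = (\<Sum>f\<in>?S. fact n * (wt k (beta k f) * vand k (beta k f)))"
    unfolding of_nat_sum by (intro sum.cong) (auto simp: chain_count_eq)
  also have "\<dots> = (\<Sum>l\<in>?L. fact n * (wt k l * vand k l))"
    by (rule sum.reindex_bij_betw[OF bij])
  finally show ?thesis by (simp add: sum_distrib_left)
qed

lemma card_Iv_fp:
  "real (card {p \<in> Iv n (Suc k) increasing_pattern. fp n p = i}) = fact n * odd_sum k (n + choose2 k) i"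
proof -
  have "{p \<in> Iv n (Suc k) increasing_pattern. fp n p = i}
      = {p \<in> Iv n (Suc k) increasing_pattern. alt_shape (diagram p n n) = int i}"
    unfolding Iv_eq by (auto simp: fp_eq_alt[symmetric])
  then show ?thesis
    using card_Iv_shapes[where n = n and k = k and P = "\<lambda>a. a = int i"]
      sum_chain_count[where n = n and k = k and P = "\<lambda>a. a = int i"]
    by (simp add: odd_sum_def)
qed

lemma card_Iv: "real (card (Iv n (Suc k) increasing_pattern)) = fact n * vsum k (n + choose2 k)"
  using card_Iv_shapes[where n = n and k = k and P = "\<lambda>_. True"]
    sum_chain_count[where n = n and k = k and P = "\<lambda>_. True"]
  by (simp add: vsum_def)

section \<open>Point probabilities and convergence in distribution\<close>

definition fp_pmf :: "nat \<Rightarrow> nat \<Rightarrow> nat pmf" where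
  "fp_pmf k n = map_pmf (fp n) (pmf_of_set (Iv n (Suc k) increasing_pattern))"

lemma fp_law_eq: "fp_law k n = distr (measure_pmf (fp_pmf k n)) borel real"
  unfolding fp_law_def fp_pmf_def map_pmf_rep_eq Suc_eq_plus1 by (subst distr_distr) (auto simp: comp_def)

text \<open>Both counts carry the factor \<open>fact n\<close>, which cancels.\<close>

lemma pmf_fp_pmf:
  assumes "k \<ge> 1"
  shows "pmf (fp_pmf k n) i = odd_sum k (n + choose2 k) i / vsum k (n + choose2 k)"
proof -
  let ?I = "Iv n (Suc k) increasing_pattern"
  have "pmf (fp_pmf k n) i = real (card (?I \<inter> fp n -` {i})) / real (card ?I)"
    unfolding fp_pmf_def pmf_map using Iv_increasing_nonempty[OF assms, of n] finite_Iv
    by (subst measure_pmf_of_set) auto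
  also have "?I \<inter> fp n -` {i} = {p \<in> ?I. fp n p = i}" by auto
  finally show ?thesis by (simp add: card_Iv_fp card_Iv del: One_nat_def)
qed

lemma odd_sum_gt: "i > k \<Longrightarrow> odd_sum k N i = 0"
proof -
  assume i: "i > k"
  have "card (oddset k l) \<le> card {..<k}" for l
    by (intro card_mono) (auto simp: oddset_def)
  then have "{l. l \<in> chamber k N \<and> card (oddset k l) = i} = {}"
    using i by (auto simp: not_le[symmetric])
  then show ?thesis by (simp only: odd_sum_def) simp
qed

text \<open>All laws live on \<open>{0..k}\<close>, so each distribution function is a finite sum of
  point masses and converges at every point, whether or not the limit is continuous there.\<close>

lemma weak_conv_m_pmf:
  fixes q :: "nat \<Rightarrow> nat pmf" and r :: "nat pmf"
  assumes "\<And>n i. i > k \<Longrightarrow> pmf (q n) i = 0" "\<And>i. i > k \<Longrightarrow> pmf r i = 0"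
    and "\<And>i. (\<lambda>n. pmf (q n) i) \<longlonglongrightarrow> pmf r i"
  shows "weak_conv_m (\<lambda>n. distr (measure_pmf (q n)) borel real) (distr (measure_pmf r) borel real)"
proof -
  have cdf: "cdf (distr (measure_pmf s) borel real) x = (\<Sum>i | i \<le> k \<and> real i \<le> x. pmf s i)"
    if "\<And>i. i > k \<Longrightarrow> pmf s i = 0" for s :: "nat pmf" and x
  proof -
    have "cdf (distr (measure_pmf s) borel real) x = measure (measure_pmf s) {i. real i \<le> x}"
      by (simp add: cdf_def measure_distr vimage_def)
    also have "\<dots> = measure (measure_pmf s) ({i. real i \<le> x} \<inter> set_pmf s)"
      by (simp add: measure_Int_set_pmf)
    also have "{i. real i \<le> x} \<inter> set_pmf s = {i. i \<le> k \<and> real i \<le> x} \<inter> set_pmf s"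
    proof -
      have "i \<le> k" if "i \<in> set_pmf s" for i
        using that \<open>\<And>i. i > k \<Longrightarrow> pmf s i = 0\<close>[of i] by (auto simp: set_pmf_iff not_less[symmetric])
      then show ?thesis by auto
    qed
    also have "measure (measure_pmf s) \<dots> = measure (measure_pmf s) {i. i \<le> k \<and> real i \<le> x}"
      by (simp add: measure_Int_set_pmf)
    also have "\<dots> = (\<Sum>i | i \<le> k \<and> real i \<le> x. pmf s i)"
      by (intro measure_measure_pmf_finite) auto
    finally show ?thesis .
  qed
  show ?thesis
    unfolding weak_conv_m_def weak_conv_def
    using assms by (auto simp: cdf intro!: tendsto_sum)
qed

text \<open>Stated along a sequence of lengths of eventually constant parity, so that it serves the
  even and the odd case.\<close>

lemma pmf_fp_pmf_tendsto:
  assumes k: "k \<ge> 1" and s: "filterlim s at_top sequentially" and e: "\<forall>\<^sub>F n in sequentially. even (s n) \<longleftrightarrow> e"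
  shows "(\<lambda>n. pmf (fp_pmf k (s n)) i)
    \<longlonglongrightarrow> (if even i \<longleftrightarrow> e then real (k choose i) / 2 ^ (k - 1) else 0)"
proof (cases "even i \<longleftrightarrow> e")
  case True
  obtain K N0 where K: "\<forall>N\<ge>N0. \<forall>i. even (i + (N + choose2 k)) \<longrightarrow>
       \<bar>odd_sum k N i / vsum k N - real (k choose i) / 2 ^ (k - 1)\<bar> \<le> K / sqrt N"
    using odd_sum_ratio[OF k] by blast
  define N where "N = (\<lambda>n. s n + choose2 k)"
  have N: "filterlim N at_top sequentially"
    unfolding N_def by (rule filterlim_at_top_mono[OF s]) auto
  have "(\<lambda>n. K / sqrt (N n)) \<longlonglongrightarrow> 0"
    by (intro tendsto_divide_0[OF tendsto_const] filterlim_at_top_imp_at_infinity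
        filterlim_compose[OF sqrt_at_top] filterlim_compose[OF filterlim_real_sequentially] N)
  moreover have "\<forall>\<^sub>F n in sequentially. norm (pmf (fp_pmf k (s n)) i - real (k choose i) / 2 ^ (k - 1)) \<le> K / sqrt (N n)"
    using e eventually_compose_filterlim[OF eventually_ge_at_top[of N0] N]
  proof eventually_elim
    case (elim n)
    \<comment> \<open>\<open>choose2 k\<close> occurs twice, once inside \<open>N n\<close>, and so
      drops out of the parity.\<close>
    have "even (i + (N n + choose2 k))" using elim True by (auto simp: N_def)
    then show ?case using K[rule_format, of "N n" i] elim by (simp add: pmf_fp_pmf[OF k] N_def)
  qed
  ultimately have "(\<lambda>n. pmf (fp_pmf k (s n)) i - real (k choose i) / 2 ^ (k - 1)) \<longlonglongrightarrow> 0"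
    by (rule Lim_null_comparison[rotated])
  then show ?thesis using True by (simp add: LIM_zero_iff)
next
  case False
  have "\<forall>\<^sub>F n in sequentially. pmf (fp_pmf k (s n)) i = 0"
    using e
  proof eventually_elim
    case (elim n)
    have "odd (i + ((s n + choose2 k) + choose2 k))" using elim False by auto
    then have "odd_sum k (s n + choose2 k) i = 0" by (rule odd_sum_eq_0)
    then show ?case by (simp add: pmf_fp_pmf[OF k])
  qed
  then show ?thesis using False by (simp add: tendsto_eventually)
qed

theorem theorem2:
  fixes k :: nat
  assumes "k \<ge> 1"
  shows "weak_conv_m (\<lambda>n. fp_law k (2 * n)) (distr (measure_pmf (X_even k)) borel real)
       \<and> weak_conv_m (\<lambda>n. fp_law k (2 * n - 1)) (distr (measure_pmf (X_odd k)) borel real)"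
proof
  have gt: "pmf (fp_pmf k n) i = 0" if "i > k" for n i
    using that by (simp add: pmf_fp_pmf[OF assms] odd_sum_gt)
  show "weak_conv_m (\<lambda>n. fp_law k (2 * n)) (distr (measure_pmf (X_even k)) borel real)"
    unfolding fp_law_eq
  proof (rule weak_conv_m_pmf[of k])
    have "filterlim (\<lambda>n::nat. 2 * n) at_top sequentially"
      by (rule filterlim_at_top_mono[OF filterlim_ident]) auto
    then show "(\<lambda>n. pmf (fp_pmf k (2 * n)) i) \<longlonglongrightarrow> pmf (X_even k) i" for i
      using pmf_fp_pmf_tendsto[OF assms, of "\<lambda>n. 2 * n" True i] by (simp add: pmf_X_even[OF assms])
  qed (auto simp: gt pmf_X_even[OF assms])
  show "weak_conv_m (\<lambda>n. fp_law k (2 * n - 1)) (distr (measure_pmf (X_odd k)) borel real)"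
    unfolding fp_law_eq
  proof (rule weak_conv_m_pmf[of k])
    have "filterlim (\<lambda>n::nat. 2 * n - 1) at_top sequentially"
    proof (rule filterlim_at_top_mono[OF filterlim_ident])
      show "\<forall>\<^sub>F n in sequentially. n \<le> 2 * n - 1"
        using eventually_ge_at_top[of "1::nat"] by eventually_elim auto
    qed
    \<comment> \<open>At \<open>n = 0\<close> the truncated \<open>2 * n - 1\<close> is 0, which is
      even; the parity is therefore asserted only eventually.\<close>
    moreover have "\<forall>\<^sub>F n in sequentially. even (2 * n - 1) \<longleftrightarrow> False"
      using eventually_ge_at_top[of "1::nat"] by eventually_elim auto
    ultimately show "(\<lambda>n. pmf (fp_pmf k (2 * n - 1)) i) \<longlonglongrightarrow> pmf (X_odd k) i" for i
      using pmf_fp_pmf_tendsto[OF assms, of "\<lambda>n. 2 * n - 1" False i] by (simp add: pmf_X_odd[OF assms])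
  qed (auto simp: gt pmf_X_odd[OF assms])
qed

end
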